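(* Assume (A1)–(A5) below. Fix $i\le s$ with $\omega_i^2>1/g(\lambda_+^+)$, and let $\rho_i>\lambda_+$ be the unique real number with $\omega_i^2g(\rho_i)=1$. Let $(b_{1,n})$, $(b_{2,n})$ be deterministic sequences of vectors in $\mathbb C^N$ with bounded norms. Then \[ b_{1,n}^*\widehat\Pi_{i,n}b_{2,n}-\frac{\rho_im(\rho_i)^2\tilde m(\rho_i)}{(\rho m(\rho)\tilde m(\rho))'|_{\rho=\rho_i}}\,b_{1,n}^*\Pi_{i,n}b_{2,n}\xrightarrow[n\to\infty]{a.s.}0 . \]
   Context: $N=N(n)$. (A1) $N\le n$, $n\to\infty$, $N/n\to c\in(0,1]$. (A2) $X_n=L_n\Gamma_nR_n^*$ random $N\times n$, with $L_n,\Gamma_n,R_n$ independent, $L_n$ Haar on $\mathcal U(N)$, $\Gamma_n$ $N\times N$ diagonal nonnegative, $R_n$ an $n\times N$ submatrix (made of $N$ columns) of a Haar matrix on $\mathcal U(n)$. $Q_n(z)=(X_nX_n^*-zI_N)^{-1}$, $\alpha_n(z)=N^{-1}\operatorname{tr}Q_n(z)$. (A3) For all $z$ with $\Im z>0$, $\alpha_n(z)\to m(z)$ a.s., $m(z)=\int\frac{\pi(dt)}{t-z}$ the Stieltjes transform of a probability measure $\pi$ supported on a compact $[\lambda_-,\lambda_+]$; $m$ is defined off $[\lambda_-,\lambda_+]$ by the same integral and $\tilde m(z)=cm(z)-(1-c)/z$. (A4) $\|X_nX_n^*\|\to\lambda_+$ a.s. (A5) $P_n$ deterministic $N\times n$ of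 rank $r$ (fixed) for $n$ large, with SVD $P_n=U_n\Omega_nV_n^*$, $U_n=[u_{1,n},\dots,u_{r,n}]$ ($N\times r$ isometry), $\Omega_n=\operatorname{diag}(\omega_{1,n}\ge\dots\ge\omega_{r,n})\to O=\operatorname{diag}(\omega_1I_{j_1},\dots,\omega_sI_{j_s})$, $\omega_1>\dots>\omega_s>0$, $j_1+\dots+j_s=r$. Let $\Sigma_n=X_n+P_n$, with eigenvalues $\hat\lambda_{1,n}\ge\dots\ge\hat\lambda_{N,n}$ of $\Sigma_n\Sigma_n^*$ and associated orthonormal eigenvectors $\hat u_{k,n}$. For $k\le r$, $i(k)$ is the index $i$ with $j_1+\dots+j_{i-1}<k\le j_1+\dots+j_i$. $\widehat\Pi_{i,n}=\sum_{k:i(k)=i}\hat u_{k,n}\hat u_{k,n}^*$ and $\Pi_{i,n}=\sum_{k:i(k)=i}u_{k,n}u_{k,n}^*$. For $x>\lambda_+$, $g(x)=xm(x)\tilde m(x)$; it decreases to $0$ on $(\lambda_+,\infty)$, and $g(\lambda_+^+)=\lim_{x\downarrow\lambda_+}g(x)$. *)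

theory Defs
  imports "HOL-Probability.Probability"
    "Jordan_Normal_Form.Gauss_Jordan_Elimination"
    "Jordan_Normal_Form.Schur_Decomposition"
begin

text \<open>Complex matrices are Jordan_Normal_Form matrices (type complex mat, dimensions are values).
  Indices of groups and of singular values/eigenvalues are 0-based.\<close>

definition unitary_mat :: "nat \<Rightarrow> complex mat \<Rightarrow> bool" where
  "unitary_mat d U \<longleftrightarrow> U \<in> carrier_mat d d \<and> mat_adjoint U * U = 1\<^sub>m d \<and> U * mat_adjoint U = 1\<^sub>m d"

definition mat_space :: "nat \<Rightarrow> nat \<Rightarrow> complex mat measure" where
  "mat_space nr nc = vimage_algebra (carrier_mat nr nc)
     (\<lambda>A. \<lambda>ij\<in>{..<nr}\<times>{..<nc}. A $$ ij) (PiM ({..<nr}\<times>{..<nc}) (\<lambda>_. borel))"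

definition haar_unitary :: "nat \<Rightarrow> complex mat measure \<Rightarrow> bool" where
  "haar_unitary d \<mu> \<longleftrightarrow> prob_space \<mu> \<and> sets \<mu> = sets (mat_space d d) \<and>
     (AE U in \<mu>. unitary_mat d U) \<and>
     (\<forall>U. unitary_mat d U \<longrightarrow> distr \<mu> (mat_space d d) (\<lambda>A. U * A) = \<mu>)"

definition mtrace :: "complex mat \<Rightarrow> complex" where
  "mtrace A = (\<Sum>i<dim_row A. A $$ (i,i))"

definition vnorm :: "complex vec \<Rightarrow> real" where
  "vnorm v = sqrt (\<Sum>i<dim_vec v. (cmod (v $ i))\<^sup>2)"

definition opnorm :: "complex mat \<Rightarrow> real" where
  "opnorm A = Sup {vnorm (A *\<^sub>v v) | v. v \<in> carrier_vec (dim_col A) \<and> vnorm v \<le> 1}"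

definition minv :: "complex mat \<Rightarrow> complex mat" where
  "minv A = the (mat_inverse A)"

definition stieltjes :: "real measure \<Rightarrow> complex \<Rightarrow> complex" where
  "stieltjes \<pi> z = (\<integral>t. 1 / (complex_of_real t - z) \<partial>\<pi>)"

definition stieltjes_r :: "real measure \<Rightarrow> real \<Rightarrow> real" where
  "stieltjes_r \<pi> x = (\<integral>t. 1 / (t - x) \<partial>\<pi>)"

definition mtilde :: "real \<Rightarrow> real measure \<Rightarrow> real \<Rightarrow> real" where
  "mtilde c \<pi> x = c * stieltjes_r \<pi> x - (1 - c) / x"

definition gfun :: "real \<Rightarrow> real measure \<Rightarrow> real \<Rightarrow> real" where
  "gfun c \<pi> x = x * stieltjes_r \<pi> x * mtilde c \<pi> x"

definition blk :: "(nat \<Rightarrow> nat) \<Rightarrow> nat \<Rightarrow> nat \<Rightarrow> nat" where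
  "blk j s k = (THE l. l < s \<and> (\<Sum>l'<l. j l') \<le> k \<and> k < (\<Sum>l'\<le>l. j l'))"

end

theory Submission
  imports Defs
begin

text \<open>
  In the basis of left singular vectors of \<open>X\<close> the Gram matrix of \<open>X + P\<close> is diagonal plus a form of rank
  at most \<open>2r\<close>, so an eigenvector with eigenvalue \<open>\<lambda>\<close> above the bulk is \<open>(\<lambda> - \<Gamma>\<^sup>2)\<close>-inverse applied to a
  combination of \<open>2r\<close> explicit vectors. The Haar factors make all bilinear forms in these vectors
  converge almost surely, and in the limit the coefficients of the eigenvectors satisfy
  \<open>(1 - \<omega>\<^sub>p\<^sup>2 g(\<lambda>)) d\<^sub>p = 0\<close>; orthonormality of the eigenvectors turns into orthogonality of the
  coefficient vectors \<open>d\<close>. A test-vector argument shows that the \<open>J = j\<^sub>1 + \<dots> + j\<^sub>i\<close> largest eigenvalues are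
  asymptotically at least \<open>\<rho>\<^sub>i\<close>. Hence their coefficient vectors form an orthogonal basis of the first \<open>J\<close>
  coordinates, which determines both the multiplicity of the limit \<open>\<rho>\<^sub>i\<close> and the limit of the projection.

  Almost sure convergence only uses left invariance: a fixed unit vector may be replaced by a flat vector
  with random signs, independent of everything else, and the fourth moment of a sign chaos of order two
  is of order \<open>n\<close> to the power \<open>-2\<close>, which is summable.
\<close>

section \<open>Weighted sums and finite-dimensional linear algebra\<close>

unbundle no vec_syntax

text \<open>The eigenvalues are not known to converge, and the overlaps with \<open>b1\<close> and
  \<open>b2\<close> need not converge at all. So the conclusion is treated as a difference, tested
  on subsequences along which finitely many scalars converge. Neither the stronger spikes nor an
  upper bound for the eigenvalues is treated separately: a \<open>J\<close> by \<open>J\<close>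
  orthonormal array whose entries vanish unless \<open>\<omega> p\<close> fits the eigenvalue limit
  leaves no freedom. The hypotheses shape the probabilistic part. The traces of the resolvent
  converge almost surely for each \<open>z\<close> separately, so only countably many points are
  used, \<i> times the positive integers; they determine all moments, and polynomials are dense.
  \<open>Gam\<close> is bounded only along almost every path and only from some \<open>n\<close> on,
  so moments are taken after truncation at a deterministic level. Second moments would be of order
  \<open>1 / n\<close>, which is not summable. Concentration is stated for powers of the singular
  values, not of their squares, since a left and a right source together carry an odd power.\<close>

lemma cnj_mult_cmod: "cnj x * x = of_real ((cmod x)\<^sup>2)"
  by (metis complex_norm_square mult.commute of_real_power)

lemma sum_cmod_square_eq_1:
  assumes "(\<Sum>a\<in>A. cnj (f a) * f a) = 1"
  shows "(\<Sum>a\<in>A. (cmod (f a))\<^sup>2) = 1"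
proof -
  have "complex_of_real (\<Sum>a\<in>A. (cmod (f a))\<^sup>2) = 1"
    using assms unfolding of_real_sum cnj_mult_cmod[symmetric] .
  then show ?thesis by (simp only: of_real_eq_1_iff)
qed

text \<open>The common core of Parseval, isometry and functional calculus: expand a product of sums,
  exchange the order, and let an orthonormality relation collapse two indices to one.\<close>

lemma triple_sum_delta:
  fixes c :: "nat \<Rightarrow> nat \<Rightarrow> 'a::comm_ring_1"
  assumes "\<And>k l. k < N \<Longrightarrow> l < N \<Longrightarrow> (\<Sum>a\<in>A. e a k l) = (if k = l then 1 else 0)"
  shows "(\<Sum>a\<in>A. \<Sum>k<N. \<Sum>l<N. c k l * e a k l) = (\<Sum>k<N. c k k)"
proof -
  have "(\<Sum>a\<in>A. \<Sum>k<N. \<Sum>l<N. c k l * e a k l) = (\<Sum>k<N. \<Sum>a\<in>A. \<Sum>l<N. c k l * e a k l)"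
    by (rule sum.swap)
  also have "\<dots> = (\<Sum>k<N. \<Sum>l<N. \<Sum>a\<in>A. c k l * e a k l)"
    by (rule sum.cong[OF refl], rule sum.swap)
  also have "\<dots> = (\<Sum>k<N. \<Sum>l<N. if k = l then c k l else 0)"
    unfolding sum_distrib_left[symmetric] using assms by (intro sum.cong refl) simp
  finally show ?thesis by simp
qed

text \<open>Resolvents are evaluated at eigenvalues that move with \<open>n\<close>. Since the
  weights have bounded total mass, uniform convergence of the test functions lets the moving point
  be replaced by its limit.\<close>

lemma weighted_sum_uniform_limit:
  fixes N :: "nat \<Rightarrow> nat" and t :: "nat \<Rightarrow> nat \<Rightarrow> real" and w :: "nat \<Rightarrow> nat \<Rightarrow> complex"
    and h :: "nat \<Rightarrow> real \<Rightarrow> real"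
  assumes tin: "\<forall>\<^sub>F n in sequentially. \<forall>k<N n. t n k \<in> S"
    and bd: "\<forall>\<^sub>F n in sequentially. (\<Sum>k<N n. cmod (w n k)) \<le> C"
    and ul: "uniform_limit S h h0 sequentially"
    and lim: "(\<lambda>n. \<Sum>k<N n. of_real (h0 (t n k)) * w n k) \<longlonglongrightarrow> l"
  shows "(\<lambda>n. \<Sum>k<N n. of_real (h n (t n k)) * w n k) \<longlonglongrightarrow> l"
proof -
  have "(\<lambda>n. (\<Sum>k<N n. of_real (h n (t n k)) * w n k) - (\<Sum>k<N n. of_real (h0 (t n k)) * w n k)) \<longlonglongrightarrow> 0"
  proof (rule LIMSEQ_I)
    fix e :: real assume "e > 0"
    define e' where "e' = e / (2 * (\<bar>C\<bar> + 1))"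
    have e': "e' > 0" unfolding e'_def using \<open>e > 0\<close> by simp
    have "\<forall>\<^sub>F n in sequentially. \<forall>x\<in>S. dist (h n x) (h0 x) < e'"
      using uniform_limitD[OF ul e'] .
    then have "\<forall>\<^sub>F n in sequentially. norm ((\<Sum>k<N n. of_real (h n (t n k)) * w n k)
        - (\<Sum>k<N n. of_real (h0 (t n k)) * w n k) - 0) < e"
      using tin bd
    proof eventually_elim
      case (elim n)
      have "norm ((\<Sum>k<N n. of_real (h n (t n k)) * w n k) - (\<Sum>k<N n. of_real (h0 (t n k)) * w n k))
          = norm (\<Sum>k<N n. of_real (h n (t n k) - h0 (t n k)) * w n k)"
        by (simp add: sum_subtractf algebra_simps)
      also have "\<dots> \<le> (\<Sum>k<N n. norm (of_real (h n (t n k) - h0 (t n k)) * w n k))"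
        by (rule norm_sum)
      also have "\<dots> \<le> (\<Sum>k<N n. e' * cmod (w n k))"
      proof (rule sum_mono)
        fix k assume "k \<in> {..<N n}"
        then have "\<bar>h n (t n k) - h0 (t n k)\<bar> \<le> e'"
          using elim(1,2) by (force simp: dist_real_def)
        then show "norm (of_real (h n (t n k) - h0 (t n k)) * w n k) \<le> e' * cmod (w n k)"
          unfolding norm_mult norm_of_real by (intro mult_right_mono) auto
      qed
      also have "\<dots> = e' * (\<Sum>k<N n. cmod (w n k))" by (simp add: sum_distrib_left)
      also have "\<dots> \<le> e' * (\<bar>C\<bar> + 1)" using elim(3) e' by (intro mult_left_mono) auto
      also have "\<dots> = e / 2" unfolding e'_def by (simp add: field_simps add_nonneg_eq_0_iff)
      finally show ?case using \<open>e > 0\<close> by simp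
    qed
    then show "\<exists>no. \<forall>n\<ge>no. norm ((\<Sum>k<N n. of_real (h n (t n k)) * w n k)
        - (\<Sum>k<N n. of_real (h0 (t n k)) * w n k) - 0) < e"
      unfolding eventually_sequentially by blast
  qed
  from tendsto_add[OF this lim] show ?thesis by simp
qed

text \<open>With \<open>d\<close> half of the gap \<open>x0 - T\<close>, both denominators exceed
  \<open>d\<close> once \<open>x n\<close> is within \<open>d\<close> of \<open>x0\<close>; the
  resolvent identity then bounds the difference by
  \<open>\<bar>x n - x0\<bar> / (d * d)\<close>.\<close>

lemma uniform_limit_inverse_shift:
  fixes x :: "nat \<Rightarrow> real"
  assumes x: "x \<longlonglongrightarrow> x0" and "T < x0"
  shows "uniform_limit {a..T} (\<lambda>n t. 1 / (x n - t)) (\<lambda>t. 1 / (x0 - t)) sequentially"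
proof (rule uniform_limitI)
  fix e :: real assume e: "e > 0"
  define d where "d = (x0 - T) / 2"
  have d: "d > 0" using assms unfolding d_def by simp
  have "\<forall>\<^sub>F n in sequentially. dist (x n) x0 < min d (e * d * d)"
    using tendstoD[OF x, of "min d (e * d * d)"] e d by simp
  then show "\<forall>\<^sub>F n in sequentially. \<forall>t\<in>{a..T}. dist (1 / (x n - t)) (1 / (x0 - t)) < e"
  proof (elim eventually_mono, intro ballI)
    fix n t assume elim: "dist (x n) x0 < min d (e * d * d)" "t \<in> {a..T}"
    then have 1: "\<bar>x n - x0\<bar> < d" "\<bar>x n - x0\<bar> < e * d * d" by (auto simp: dist_real_def)
    have "x0 - T = 2 * d" "t \<le> T" using elim unfolding d_def by auto
    then have 2: "x0 - t > d" "x n - t > d" using 1(1) d by linarith+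
    have "1 / (x n - t) - 1 / (x0 - t) = (x0 - x n) / ((x n - t) * (x0 - t))"
      using 2 d by (simp add: field_simps)
    then have "dist (1 / (x n - t)) (1 / (x0 - t)) = \<bar>x n - x0\<bar> / ((x n - t) * (x0 - t))"
      using 2 d unfolding dist_real_def by (simp add: abs_mult abs_minus_commute)
    also have "\<dots> < e * d * d / ((x n - t) * (x0 - t))"
      using 1 2 d by (intro divide_strict_right_mono) auto
    also have "\<dots> \<le> e * d * d / (d * d)"
      using 2 d e by (intro divide_left_mono mult_mono) auto
    finally show "dist (1 / (x n - t)) (1 / (x0 - t)) < e" using d by simp
  qed
qed

text \<open>Only boundedness is wanted, so the arithmetic mean of the two energies replaces the
  product of norms and no square roots appear.\<close>

lemma weighted_cauchy_schwarz:
  fixes a b :: "nat \<Rightarrow> complex"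
  assumes "(\<Sum>k\<in>A. (cmod (a k))\<^sup>2) \<le> Ca" "(\<Sum>k\<in>A. (cmod (b k))\<^sup>2) \<le> Cb"
  shows "(\<Sum>k\<in>A. cmod (cnj (a k) * b k)) \<le> (Ca + Cb) / 2"
proof -
  have "(\<Sum>k\<in>A. cmod (cnj (a k) * b k)) \<le> (\<Sum>k\<in>A. ((cmod (a k))\<^sup>2 + (cmod (b k))\<^sup>2) / 2)"
  proof (rule sum_mono)
    fix k
    have "0 \<le> (cmod (a k) - cmod (b k))\<^sup>2" by simp
    then show "cmod (cnj (a k) * b k) \<le> ((cmod (a k))\<^sup>2 + (cmod (b k))\<^sup>2) / 2"
      by (simp add: norm_mult power2_eq_square algebra_simps)
  qed
  also have "\<dots> = ((\<Sum>k\<in>A. (cmod (a k))\<^sup>2) + (\<Sum>k\<in>A. (cmod (b k))\<^sup>2)) / 2"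
    by (simp add: sum.distrib sum_divide_distrib[symmetric])
  finally show ?thesis using assms by simp
qed

text \<open>The one passage to the limit behind all inner products of eigenvectors, test vectors,
  sources and fixed vectors. Bilinearity pulls the converging coefficients out of the sum over
  \<open>k\<close>, so that only pairs of basic vectors remain, for which limits are known.\<close>

lemma bilinear_weighted_limit:
  fixes N :: "nat \<Rightarrow> nat" and t :: "nat \<Rightarrow> nat \<Rightarrow> real"
    and a :: "'i \<Rightarrow> nat \<Rightarrow> nat \<Rightarrow> complex" and b :: "'j \<Rightarrow> nat \<Rightarrow> nat \<Rightarrow> complex"
    and h h' :: "nat \<Rightarrow> real \<Rightarrow> real"
  assumes fin: "finite X" "finite Y"
    and tin: "\<forall>\<^sub>F n in sequentially. \<forall>k<N n. t n k \<in> {0..T}"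
    and a: "\<And>i. i \<in> X \<Longrightarrow> \<forall>\<^sub>F n in sequentially. (\<Sum>k<N n. (cmod (a i n k))\<^sup>2) \<le> C"
    and b: "\<And>j. j \<in> Y \<Longrightarrow> \<forall>\<^sub>F n in sequentially. (\<Sum>k<N n. (cmod (b j n k))\<^sup>2) \<le> C"
    and lim: "\<And>i j. i \<in> X \<Longrightarrow> j \<in> Y \<Longrightarrow>
       (\<lambda>n. \<Sum>k<N n. of_real (hl (t n k) * hl' (t n k)) * (cnj (a i n k) * b j n k)) \<longlonglongrightarrow> K i j"
    and h: "uniform_limit {0..T} h hl sequentially" "continuous_on {0..T} hl"
    and h': "uniform_limit {0..T} h' hl' sequentially" "continuous_on {0..T} hl'"
    and e: "\<And>i. i \<in> X \<Longrightarrow> (\<lambda>n. e n i) \<longlonglongrightarrow> el i"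
    and e': "\<And>j. j \<in> Y \<Longrightarrow> (\<lambda>n. e' n j) \<longlonglongrightarrow> el' j"
  shows "(\<lambda>n. \<Sum>k<N n. cnj (of_real (h n (t n k)) * (\<Sum>i\<in>X. e n i * a i n k)) *
            (of_real (h' n (t n k)) * (\<Sum>j\<in>Y. e' n j * b j n k)))
     \<longlonglongrightarrow> (\<Sum>i\<in>X. \<Sum>j\<in>Y. cnj (el i) * el' j * K i j)"
proof -
  have bdd: "bounded (hl ` {0..T})" "bounded (hl' ` {0..T})"
    using h(2) h'(2) by (auto intro!: compact_imp_bounded compact_continuous_image)
  have ul: "uniform_limit {0..T} (\<lambda>n x. h n x * h' n x) (\<lambda>x. hl x * hl' x) sequentially"
    by (rule uniform_lim_mult[OF h(1) h'(1) bdd])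
  have eq: "(\<Sum>k<N n. cnj (of_real (h n (t n k)) * (\<Sum>i\<in>X. e n i * a i n k)) *
            (of_real (h' n (t n k)) * (\<Sum>j\<in>Y. e' n j * b j n k)))
     = (\<Sum>i\<in>X. \<Sum>j\<in>Y. cnj (e n i) * e' n j *
          (\<Sum>k<N n. of_real (h n (t n k) * h' n (t n k)) * (cnj (a i n k) * b j n k)))" for n
  proof -
    have "(\<Sum>k<N n. cnj (of_real (h n (t n k)) * (\<Sum>i\<in>X. e n i * a i n k)) *
            (of_real (h' n (t n k)) * (\<Sum>j\<in>Y. e' n j * b j n k)))
      = (\<Sum>k<N n. \<Sum>i\<in>X. \<Sum>j\<in>Y. cnj (e n i) * e' n j *
          (of_real (h n (t n k) * h' n (t n k)) * (cnj (a i n k) * b j n k)))"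
      by (intro sum.cong refl) (simp add: sum_distrib_left sum_distrib_right sum_product mult_ac)
    also have "\<dots> = (\<Sum>i\<in>X. \<Sum>k<N n. \<Sum>j\<in>Y. cnj (e n i) * e' n j *
          (of_real (h n (t n k) * h' n (t n k)) * (cnj (a i n k) * b j n k)))"
      by (rule sum.swap)
    also have "\<dots> = (\<Sum>i\<in>X. \<Sum>j\<in>Y. \<Sum>k<N n. cnj (e n i) * e' n j *
          (of_real (h n (t n k) * h' n (t n k)) * (cnj (a i n k) * b j n k)))"
      by (intro sum.cong refl, rule sum.swap)
    finally show ?thesis by (simp add: sum_distrib_left)
  qed
  show ?thesis unfolding eq
  proof (intro tendsto_sum tendsto_mult tendsto_cnj e e')
    fix i j assume ij: "i \<in> X" "j \<in> Y"
    have bd: "\<forall>\<^sub>F n in sequentially. (\<Sum>k<N n. cmod (cnj (a i n k) * b j n k)) \<le> (C + C) / 2"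
      using a[OF ij(1)] b[OF ij(2)] by eventually_elim (rule weighted_cauchy_schwarz)
    show "(\<lambda>n. \<Sum>k<N n. of_real (h n (t n k) * h' n (t n k)) * (cnj (a i n k) * b j n k))
       \<longlonglongrightarrow> K i j"
      by (rule weighted_sum_uniform_limit[OF tin bd ul lim[OF ij]])
  qed
qed

text \<open>A one-sided inverse of a square matrix is two-sided. Orthonormal vectors, as many as
  there are coordinates, thus resolve the identity.\<close>

lemma orthonormal_square_complete:
  fixes x :: "nat \<Rightarrow> nat \<Rightarrow> complex"
  assumes on: "\<And>q q'. q < n \<Longrightarrow> q' < n \<Longrightarrow> (\<Sum>k<n. cnj (x q k) * x q' k) = (if q = q' then 1 else 0)"
    and "k < n" "l < n"
  shows "(\<Sum>q<n. x q k * cnj (x q l)) = (if k = l then 1 else 0)"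
proof -
  define A where "A = mat n n (\<lambda>(q, k). cnj (x q k))"
  define B where "B = mat n n (\<lambda>(k, q). x q k)"
  have A: "A \<in> carrier_mat n n" and B: "B \<in> carrier_mat n n" unfolding A_def B_def by auto
  have "A * B = 1\<^sub>m n"
    by (rule eq_matI) (auto simp: A_def B_def scalar_prod_def on atLeast0LessThan)
  then have "B * A = 1\<^sub>m n" using mat_mult_left_right_inverse[OF A B] by blast
  then have "(B * A) $$ (k, l) = (if k = l then 1 else 0)" using assms by simp
  then show ?thesis using assms by (simp add: A_def B_def scalar_prod_def atLeast0LessThan)
qed

lemma underdetermined_null_vector:
  fixes a :: "nat \<Rightarrow> nat \<Rightarrow> complex"
  assumes "0 < m"
  shows "\<exists>c. (\<Sum>p<m. (cmod (c p))\<^sup>2) = 1 \<and> (\<forall>q. q < m - 1 \<longrightarrow> (\<Sum>p<m. c p * a q p) = 0)"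
proof -
  \<comment> \<open>There are only \<open>m - 1\<close> equations; a zero row makes the matrix
    square and singular.\<close>
  define A where "A = mat m m (\<lambda>(q, p). if q = m - 1 then 0 else a q p)"
  have A: "A \<in> carrier_mat m m" unfolding A_def by simp
  have "row A (m - 1) = 0\<^sub>v m" using assms by (intro eq_vecI) (auto simp: A_def)
  then have "\<exists>j<m. \<forall>p<m. A $$ (j, p) = 0" using assms by (intro exI[of _ "m - 1"]) (auto simp: A_def)
  have "det A = 0"
  proof -
    have "A = mat\<^sub>r m m (\<lambda>i. if i = m - 1 then 0\<^sub>v m else row A i)"
      using assms by (intro eq_matI) (auto simp: A_def)
    moreover have "det (mat\<^sub>r m m (\<lambda>i. if i = m - 1 then 0\<^sub>v m else row A i)) = 0"
      using assms A by (intro det_row_0) auto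
    ultimately show ?thesis by simp
  qed
  then obtain v where v: "v \<in> carrier_vec m" "v \<noteq> 0\<^sub>v m" "A *\<^sub>v v = 0\<^sub>v m"
    using det_0_iff_vec_prod_zero[OF A] by blast
  define s where "s = (\<Sum>p<m. (cmod (v $ p))\<^sup>2)"
  have "\<exists>p<m. v $ p \<noteq> 0" using v(1,2) by (metis carrier_vecD eq_vecI index_zero_vec(1) index_zero_vec(2))
  then obtain p where p: "p < m" "v $ p \<noteq> 0" by blast
  have "s \<ge> (cmod (v $ p))\<^sup>2" unfolding s_def using p by (intro member_le_sum) auto
  then have s: "s > 0" using p by (smt (verit) zero_less_norm_iff zero_less_power)
  define c where "c = (\<lambda>p. v $ p / of_real (sqrt s))"
  have "(\<Sum>p<m. (cmod (c p))\<^sup>2) = 1"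
    using s by (simp add: c_def norm_divide power_divide sum_divide_distrib[symmetric] s_def[symmetric])
  moreover have "(\<Sum>p<m. c p * a q p) = 0" if q: "q < m - 1" for q
  proof -
    have "(A *\<^sub>v v) $ q = (\<Sum>p<m. a q p * v $ p)"
      using q v(1) by (simp add: A_def scalar_prod_def atLeast0LessThan)
    then have "(\<Sum>p<m. a q p * v $ p) = 0" using v(3) q by simp
    moreover have "(\<Sum>p<m. c p * a q p) = (\<Sum>p<m. a q p * v $ p) / of_real (sqrt s)"
      by (simp add: c_def sum_divide_distrib mult_ac)
    ultimately show ?thesis by simp
  qed
  ultimately show ?thesis by blast
qed

text \<open>Bolzano-Weierstrass, one member of the family at a time. A bound that holds only from
  \<open>m\<close> on suffices, because the sequence is first shifted by \<open>m\<close>.\<close>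

lemma finite_family_convergent_subseq:
  fixes f :: "'i \<Rightarrow> nat \<Rightarrow> complex"
  assumes "finite X" "\<And>i. i \<in> X \<Longrightarrow> \<exists>C. \<forall>\<^sub>F n in sequentially. cmod (f i n) \<le> C"
  shows "\<exists>\<sigma>::nat \<Rightarrow> nat. \<exists>l. strict_mono \<sigma> \<and> (\<forall>i\<in>X. (\<lambda>n. f i (\<sigma> n)) \<longlonglongrightarrow> l i)"
  using assms
proof (induction X)
  case empty
  then show ?case by (auto intro!: exI[of _ id] simp: strict_mono_def)
next
  case (insert i X)
  then obtain \<sigma> l where \<sigma>: "strict_mono (\<sigma>::nat\<Rightarrow>nat)" "\<forall>i\<in>X. (\<lambda>n. f i (\<sigma> n)) \<longlonglongrightarrow> l i"
    by (metis insertCI)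
  obtain C where "\<forall>\<^sub>F n in sequentially. cmod (f i n) \<le> C" using insert.prems by blast
  then obtain m where m: "\<And>n. n \<ge> m \<Longrightarrow> cmod (f i n) \<le> C" unfolding eventually_sequentially by blast
  have "bounded (range (\<lambda>n. f i (\<sigma> (n + m))))"
  proof (rule boundedI)
    fix x assume "x \<in> range (\<lambda>n. f i (\<sigma> (n + m)))"
    then obtain n where "x = f i (\<sigma> (n + m))" by blast
    moreover have "\<sigma> (n + m) \<ge> m" using seq_suble[OF \<sigma>(1), of "n + m"] by simp
    ultimately show "norm x \<le> C" using m by simp
  qed
  from bounded_imp_convergent_subsequence[OF this]
  obtain z \<tau> where \<tau>: "strict_mono (\<tau>::nat\<Rightarrow>nat)" "((\<lambda>n. f i (\<sigma> (n + m))) \<circ> \<tau>) \<longlonglongrightarrow> z"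
    by blast
  define \<tau>' where "\<tau>' = (\<lambda>n. \<tau> n + m)"
  have \<tau>': "strict_mono \<tau>'" using \<tau>(1) unfolding \<tau>'_def strict_mono_def by simp
  have "strict_mono (\<sigma> \<circ> \<tau>')" using \<sigma>(1) \<tau>' by (rule strict_mono_o)
  moreover have "(\<lambda>n. f i' ((\<sigma> \<circ> \<tau>') n)) \<longlonglongrightarrow> (l(i := z)) i'" if "i' \<in> insert i X" for i'
  proof (cases "i' = i")
    case True
    then show ?thesis using \<tau>(2) by (simp add: o_def \<tau>'_def)
  next
    case False
    then have "(\<lambda>n. f i' (\<sigma> n)) \<longlonglongrightarrow> l i'" using that \<sigma>(2) by auto
    from LIMSEQ_subseq_LIMSEQ[OF this \<tau>'] show ?thesis using False by (simp add: o_def)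
  qed
  ultimately show ?case by blast
qed

text \<open>A sequence that is at least \<open>e\<close> away from 0 infinitely often has a
  subsequence that always is; \<open>enumerate\<close> lists it, and none of its subsequences tends
  to 0.\<close>

lemma tendsto_zero_if_subseq_tendsto_zero:
  fixes F :: "nat \<Rightarrow> complex"
  assumes "\<And>\<sigma>. strict_mono \<sigma> \<Longrightarrow> \<exists>\<tau>. strict_mono (\<tau>::nat \<Rightarrow> nat) \<and> (\<lambda>n. F (\<sigma> (\<tau> n))) \<longlonglongrightarrow> 0"
  shows "F \<longlonglongrightarrow> 0"
proof (rule ccontr)
  assume "\<not> F \<longlonglongrightarrow> 0"
  then obtain e where e: "e > 0" "\<not> (\<forall>\<^sub>F n in sequentially. dist (F n) 0 < e)"
    unfolding tendsto_iff by blast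
  then have "\<exists>\<^sub>F n in sequentially. dist (F n) 0 \<ge> e" by (simp add: frequently_def not_le)
  then have inf: "infinite {n. dist (F n) 0 \<ge> e}"
    by (simp add: frequently_cofinite[symmetric] cofinite_eq_sequentially)
  have s: "strict_mono (enumerate {n. dist (F n) 0 \<ge> e})"
      "\<And>n. enumerate {n. dist (F n) 0 \<ge> e} n \<in> {n. dist (F n) 0 \<ge> e}"
    using strict_mono_enumerate[OF inf] enumerate_in_set[OF inf] by auto
  define \<sigma> where "\<sigma> = enumerate {n. dist (F n) 0 \<ge> e}"
  note s = s[folded \<sigma>_def]
  obtain \<tau> where "(\<lambda>n. F (\<sigma> (\<tau> n))) \<longlonglongrightarrow> 0" using assms[OF s(1)] by blast
  then have "\<forall>\<^sub>F n in sequentially. dist (F (\<sigma> (\<tau> n))) 0 < e" using e(1) by (rule tendstoD)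
  then obtain n where "dist (F (\<sigma> (\<tau> n))) 0 < e" by (auto simp: eventually_sequentially)
  with s(2)[of "\<tau> n"] show False by auto
qed

section \<open>Resolvent functionals of the limit law\<close>

text \<open>The easy half of the min-max principle. The operator appears only through the image
  \<open>z\<close> of \<open>y\<close> and its pairings with the eigenvectors, so that
  self-adjointness is already built into \<open>ev\<close>.\<close>

lemma rayleigh_le:
  fixes x :: "nat \<Rightarrow> nat \<Rightarrow> complex" and y z :: "nat \<Rightarrow> complex" and l :: "nat \<Rightarrow> real"
  assumes on: "\<And>q q'. q < n \<Longrightarrow> q' < n \<Longrightarrow> (\<Sum>k<n. cnj (x q k) * x q' k) = (if q = q' then 1 else 0)"
    and ev: "\<And>q. q < n \<Longrightarrow> (\<Sum>k<n. cnj (x q k) * z k) = of_real (l q) * (\<Sum>k<n. cnj (x q k) * y k)"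
    and perp: "\<And>q. q < m \<Longrightarrow> (\<Sum>k<n. cnj (x q k) * y k) = 0"
    and le: "\<And>q. m \<le> q \<Longrightarrow> q < n \<Longrightarrow> l q \<le> l m"
  shows "Re (\<Sum>k<n. cnj (y k) * z k) \<le> l m * (\<Sum>k<n. (cmod (y k))\<^sup>2)"
proof -
  define Y where "Y q = (\<Sum>k<n. cnj (x q k) * y k)" for q
  \<comment> \<open>Parseval in the basis \<open>x\<close>; completeness comes from the number of
    vectors.\<close>
  have pars: "(\<Sum>k<n. cnj (y k) * v k) = (\<Sum>q<n. cnj (Y q) * (\<Sum>k<n. cnj (x q k) * v k))" for v
  proof -
    have "(\<Sum>q<n. cnj (Y q) * (\<Sum>k<n. cnj (x q k) * v k))
        = (\<Sum>q<n. \<Sum>k<n. \<Sum>l<n. (x q k * cnj (x q l)) * (cnj (y k) * v l))"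
      unfolding Y_def cnj_sum sum_product by (simp add: mult_ac)
    also have "\<dots> = (\<Sum>q<n. \<Sum>k<n. \<Sum>l<n. (cnj (y k) * v l) * (x q k * cnj (x q l)))"
      by (simp only: mult_ac)
    also have "\<dots> = (\<Sum>k<n. cnj (y k) * v k)"
      by (rule triple_sum_delta) (rule orthonormal_square_complete[OF on])
    finally show ?thesis by simp
  qed
  have "(\<Sum>k<n. cnj (y k) * z k) = (\<Sum>q<n. of_real (l q * (cmod (Y q))\<^sup>2))"
    unfolding pars[of z] by (intro sum.cong refl) (simp add: ev Y_def[symmetric] cnj_mult_cmod mult.left_commute)
  then have "Re (\<Sum>k<n. cnj (y k) * z k) = (\<Sum>q<n. l q * (cmod (Y q))\<^sup>2)"
    by (simp only: Re_sum Re_complex_of_real)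
  also have "\<dots> \<le> (\<Sum>q<n. l m * (cmod (Y q))\<^sup>2)"
  proof (rule sum_mono)
    fix q assume q: "q \<in> {..<n}"
    show "l q * (cmod (Y q))\<^sup>2 \<le> l m * (cmod (Y q))\<^sup>2"
    proof (cases "q < m")
      case True
      then show ?thesis using perp by (simp add: Y_def)
    next
      case False
      then show ?thesis using q le by (intro mult_right_mono) auto
    qed
  qed
  also have "\<dots> = l m * (\<Sum>q<n. (cmod (Y q))\<^sup>2)" by (simp add: sum_distrib_left)
  also have "(\<Sum>q<n. (cmod (Y q))\<^sup>2) = (\<Sum>k<n. (cmod (y k))\<^sup>2)"
  proof -
    have "complex_of_real (\<Sum>k<n. (cmod (y k))\<^sup>2) = (\<Sum>k<n. cnj (y k) * y k)" by (simp add: cnj_mult_cmod)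
    also have "\<dots> = complex_of_real (\<Sum>q<n. (cmod (Y q))\<^sup>2)"
      unfolding pars[of y] by (simp add: Y_def[symmetric] cnj_mult_cmod)
    finally show ?thesis by (simp only: of_real_eq_iff)
  qed
  finally show ?thesis .
qed

lemma integrable_AE_interval:
  fixes f :: "real \<Rightarrow> real"
  assumes pi: "prob_space \<pi>" "sets \<pi> = sets borel" "AE x in \<pi>. x \<in> {a..b}"
    and f: "f \<in> borel_measurable borel" "continuous_on {a..b} f"
  shows "integrable \<pi> f"
proof -
  interpret prob_space \<pi> by (rule pi)
  have "compact (f ` {a..b})" using f(2) by (intro compact_continuous_image) auto
  then obtain C where C: "\<And>x. x \<in> {a..b} \<Longrightarrow> norm (f x) \<le> C"
    using compact_imp_bounded bounded_iff by (metis imageI)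
  have "AE x in \<pi>. norm (f x) \<le> C" using pi(3) by eventually_elim (rule C)
  moreover have "f \<in> borel_measurable \<pi>" using f(1) by (simp cong: measurable_cong_sets add: pi(2))
  ultimately show ?thesis by (rule integrable_const_bound)
qed

text \<open>\<open>T\<close> will lie strictly between the edge of the support and
  \<open>\<rho>\<close>: the squared singular values eventually fall below \<open>T\<close>, and the
  limits at which resolvents are taken exceed it.\<close>

locale limit_law =
  fixes \<pi> :: "real measure" and c T :: real
  assumes pi: "prob_space \<pi>" "sets \<pi> = sets borel" "AE x in \<pi>. 0 \<le> x \<and> x \<le> T"
    and T: "0 \<le> T" and c: "0 < c"
begin

interpretation prob_space \<pi> by (rule pi)

text \<open>The two limiting spectral measures, \<open>False\<close> for left and
  \<open>True\<close> for right sources. The factor \<open>c\<close> arises because a unit vector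
  spreads its mass evenly over the \<open>n\<close> columns of a Haar matrix, of which only
  \<open>N\<close> are kept in \<open>R\<close>.\<close>

definition ilaw :: "bool \<Rightarrow> (real \<Rightarrow> real) \<Rightarrow> real" where
  "ilaw b f = (if b then \<integral>x. c * (x * f x) \<partial>\<pi> else \<integral>x. f x \<partial>\<pi>)"

text \<open>In the notation of the paper, \<open>rA = - m\<close>, \<open>1 + rB\<close> is \<open>x\<close> times minus \<open>m\<close>-tilde, and \<open>rg = g\<close>.\<close>

definition rA where "rA x = ilaw False (\<lambda>s. 1 / (x - s))"
definition rB where "rB x = ilaw True (\<lambda>s. 1 / (x - s))"
definition rA2 where "rA2 x = ilaw False (\<lambda>s. 1 / (x - s) * (1 / (x - s)))"
definition rB2 where "rB2 x = ilaw True (\<lambda>s. 1 / (x - s) * (1 / (x - s)))"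
definition rg where "rg x = rA x * (1 + rB x)"

lemma integrable_law:
  fixes f :: "real \<Rightarrow> real"
  assumes "f \<in> borel_measurable borel" "continuous_on {0..T} f"
  shows "integrable \<pi> f"
  by (rule integrable_AE_interval[OF pi(1,2) _ assms]) (use pi(3) in \<open>simp add: atLeastAtMost_iff\<close>)

lemma integrable_shift:
  assumes "T < x" "T < y"
  shows "integrable \<pi> (\<lambda>s. 1 / (x - s))" "integrable \<pi> (\<lambda>s. c * (s * (1 / (x - s))))"
    "integrable \<pi> (\<lambda>s. 1 / (x - s) * (1 / (y - s)))"
    "integrable \<pi> (\<lambda>s. c * (s * (1 / (x - s) * (1 / (y - s)))))"
  by (rule integrable_law; use assms in \<open>auto intro!: continuous_intros\<close>)+

lemma rB_nonneg: assumes "T < x" shows "0 \<le> rB x"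
proof -
  have "AE s in \<pi>. 0 \<le> c * (s * (1 / (x - s)))"
    using pi(3) by eventually_elim (use assms c in auto)
  then show ?thesis unfolding rB_def ilaw_def if_True by (rule integral_nonneg_AE)
qed

lemma rB2_nonneg: assumes "T < x" shows "0 \<le> rB2 x"
proof -
  have "AE s in \<pi>. 0 \<le> c * (s * (1 / (x - s) * (1 / (x - s))))"
    using pi(3) by eventually_elim (use assms c in auto)
  then show ?thesis unfolding rB2_def ilaw_def if_True by (rule integral_nonneg_AE)
qed

text \<open>Since the law has bounded support, the integrands in question are bounded below by a
  positive constant; strict positivity then needs no argument about null sets.\<close>

lemma integral_pos_bound:
  fixes f :: "real \<Rightarrow> real"
  assumes f: "integrable \<pi> f" and "0 < d" "AE s in \<pi>. d \<le> f s"
  shows "0 < (\<integral>s. f s \<partial>\<pi>)"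
proof -
  have "d = (\<integral>s. d \<partial>\<pi>)" by (subst lebesgue_integral_const) (simp add: prob_space)
  also have "\<dots> \<le> (\<integral>s. f s \<partial>\<pi>)" by (rule integral_mono_AE) (use assms in auto)
  finally show ?thesis using assms by simp
qed

lemma rA_pos: assumes "T < x" shows "0 < rA x"
proof -
  have "AE s in \<pi>. 1 / x \<le> 1 / (x - s)" using pi(3)
    by eventually_elim (use assms T in \<open>auto intro!: divide_left_mono mult_pos_pos\<close>)
  then show ?thesis unfolding rA_def ilaw_def using assms T
    by (auto intro!: integral_pos_bound[where d = "1 / x"] integrable_shift)
qed

lemma rA2_pos: assumes "T < x" shows "0 < rA2 x"
proof -
  have "AE s in \<pi>. 1 / x * (1 / x) \<le> 1 / (x - s) * (1 / (x - s))" using pi(3)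
    by eventually_elim (use assms T in \<open>auto intro!: mult_mono divide_left_mono mult_pos_pos\<close>)
  then show ?thesis unfolding rA2_def ilaw_def if_False
    by (rule integral_pos_bound[OF integrable_shift(3)[OF assms assms], rotated]) (use assms T in simp)
qed

lemma rA_strict_antimono: assumes "T < x" "x < y" shows "rA y < rA x"
proof -
  have "AE s in \<pi>. (y - x) / (x * y) \<le> 1 / (x - s) - 1 / (y - s)" using pi(3)
  proof eventually_elim
    case (elim s)
    have "1 / (x - s) - 1 / (y - s) = (y - x) / ((x - s) * (y - s))"
      using elim assms by (simp add: field_simps)
    also have "\<dots> \<ge> (y - x) / (x * y)"
      using elim assms T by (intro divide_left_mono mult_mono mult_pos_pos) auto
    finally show ?case .
  qed
  then have "0 < (\<integral>s. 1 / (x - s) - 1 / (y - s) \<partial>\<pi>)"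
    by (intro integral_pos_bound[where d = "(y - x) / (x * y)"])
      (use assms T integrable_shift in auto)
  also have "\<dots> = rA x - rA y" unfolding rA_def ilaw_def
    using assms integrable_shift[of x x] integrable_shift[of y y] by simp
  finally show ?thesis by simp
qed

lemma rB_antimono: assumes "T < x" "x \<le> y" shows "rB y \<le> rB x"
  unfolding rB_def ilaw_def if_True
proof (rule integral_mono_AE)
  show "AE s in \<pi>. c * (s * (1 / (y - s))) \<le> c * (s * (1 / (x - s)))" using pi(3)
    by eventually_elim (use assms c in \<open>auto intro!: mult_left_mono divide_left_mono mult_pos_pos\<close>)
qed (use assms integrable_shift in auto)

text \<open>A strictly decreasing positive factor times a nonincreasing positive one. The resulting
  injectivity of \<open>rg\<close> ties an eigenvalue limit to a single value of
  \<open>\<omega> p\<close>.\<close>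

lemma rg_strict_antimono: assumes "T < x" "x < y" shows "rg y < rg x"
proof -
  have "rA y * (1 + rB y) \<le> rA y * (1 + rB x)"
    using assms rB_antimono[of x y] rA_pos[of y] by (intro mult_left_mono) auto
  also have "\<dots> < rA x * (1 + rB x)"
    using assms rA_strict_antimono[of x y] rB_nonneg[of x] by (intro mult_strict_right_mono) auto
  finally show ?thesis unfolding rg_def .
qed

lemma rg_pos: "T < x \<Longrightarrow> 0 < rg x"
  unfolding rg_def using rA_pos[of x] rB_nonneg[of x] by simp

end

section \<open>Finite-rank perturbations in the basis of singular vectors\<close>

text \<open>
  In the application, coordinates are taken in the basis of left singular vectors of \<open>X = L \<Gamma> R\<^sup>*\<close>:
  \<open>t\<close> is the diagonal of \<open>\<Gamma>\<^sup>2\<close>, \<open>src (False, p)\<close> is \<open>L\<^sup>* u\<^sub>p\<close> and \<open>src (True, p)\<close> is \<open>\<Gamma> R\<^sup>* v\<^sub>p\<close>, whence the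
  factor \<open>x\<close> in \<open>ilaw True\<close>; \<open>xi\<close> are the eigenvectors in these coordinates.
\<close>

locale spiked = limit_law \<pi> c T
  for \<pi> :: "real measure" and c T :: real +
  fixes N :: "nat \<Rightarrow> nat" and t :: "nat \<Rightarrow> nat \<Rightarrow> real" and r :: nat
    and src :: "bool \<times> nat \<Rightarrow> nat \<Rightarrow> nat \<Rightarrow> complex"
    and om :: "nat \<Rightarrow> nat \<Rightarrow> real" and \<omega> :: "nat \<Rightarrow> real"
    and lam :: "nat \<Rightarrow> nat \<Rightarrow> real" and xi :: "nat \<Rightarrow> nat \<Rightarrow> nat \<Rightarrow> complex"
  assumes tin: "\<forall>\<^sub>F n in sequentially. \<forall>k<N n. t n k \<in> {0..T}"
    and src_bound: "\<exists>C. \<forall>i\<in>UNIV \<times> {..<r}. \<forall>\<^sub>F n in sequentially. (\<Sum>k<N n. (cmod (src i n k))\<^sup>2) \<le> C"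
    and src_lim: "\<And>i j f. i \<in> UNIV \<times> {..<r} \<Longrightarrow> j \<in> UNIV \<times> {..<r} \<Longrightarrow> f \<in> borel_measurable borel \<Longrightarrow>
        continuous_on {0..T} f \<Longrightarrow>
        (\<lambda>n. \<Sum>k<N n. of_real (f (t n k)) * (cnj (src i n k) * src j n k))
          \<longlonglongrightarrow> (if i = j then of_real (ilaw (fst i) f) else 0)"
    and om: "\<And>p. p < r \<Longrightarrow> (\<lambda>n. om n p) \<longlonglongrightarrow> \<omega> p"
    and xi_orth: "\<forall>\<^sub>F n in sequentially. \<forall>q<N n. \<forall>q'<N n.
        (\<Sum>k<N n. cnj (xi n q k) * xi n q' k) = (if q = q' then 1 else 0)"
    and lam_mono: "\<forall>\<^sub>F n in sequentially. \<forall>q<N n. \<forall>q'<N n. q \<le> q' \<longrightarrow> lam n q' \<le> lam n q"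
    and N_large: "\<forall>\<^sub>F n in sequentially. r \<le> N n"
begin

abbreviation "Ix \<equiv> (UNIV :: bool set) \<times> {..<r}"

lemma sum_Ix: "(\<Sum>i\<in>Ix. f i) = (\<Sum>p<r. f (False, p) + f (True, p))" for f :: "bool \<times> nat \<Rightarrow> 'z::comm_monoid_add"
proof -
  have "(\<Sum>i\<in>Ix. f i) = (\<Sum>b\<in>UNIV. \<Sum>p<r. f (b, p))" by (simp add: sum.cartesian_product)
  then show ?thesis by (simp add: UNIV_bool sum.distrib)
qed

definition ip :: "nat \<Rightarrow> (nat \<Rightarrow> complex) \<Rightarrow> (nat \<Rightarrow> complex) \<Rightarrow> complex" where
  "ip n y z = (\<Sum>k<N n. cnj (y k) * z k)"

text \<open>The Gram matrix of X + P is that of X plus three products that involve P. Applied to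
  \<open>y\<close>, the product of X with the adjoint of P yields the coefficients \<open>d\<close>
  at \<open>True\<close>. Those at \<open>False\<close> collect P times the adjoint of X and P times
  its own adjoint; by orthonormality of the right singular vectors the latter contributes
  \<open>d\<close> once more, multiplied by \<open>om\<close>.\<close>

definition coef :: "nat \<Rightarrow> (nat \<Rightarrow> complex) \<Rightarrow> bool \<times> nat \<Rightarrow> complex" where
  "coef n y i = (let d = of_real (om n (snd i)) * ip n (src (False, snd i) n) y in
     if fst i then d else of_real (om n (snd i)) * (ip n (src (True, snd i) n) y + d))"

definition gram_op :: "nat \<Rightarrow> (nat \<Rightarrow> complex) \<Rightarrow> nat \<Rightarrow> complex" where
  "gram_op n y k = of_real (t n k) * y k + (\<Sum>i\<in>Ix. coef n y i * src i n k)"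

lemma cnj_ip: "cnj (ip n y z) = ip n z y"
  unfolding ip_def by (simp add: mult.commute)

text \<open>Only sources with the same \<open>p\<close> are coupled, by the real symmetric matrix
  with entries \<open>(om n p)\<^sup>2\<close> for \<open>False\<close> with \<open>False\<close>,
  \<open>om n p\<close> for the mixed pairs, and 0 for \<open>True\<close> with
  \<open>True\<close>.\<close>

lemma gram_op_hermitian: "ip n z (gram_op n y) = cnj (ip n y (gram_op n z))"
proof -
  have *: "ip n z (gram_op n y) = (\<Sum>k<N n. of_real (t n k) * (cnj (z k) * y k))
      + (\<Sum>i\<in>Ix. coef n y i * ip n z (src i n))" for y z
  proof -
    have "ip n z (gram_op n y) = (\<Sum>k<N n. of_real (t n k) * (cnj (z k) * y k))
      + (\<Sum>k<N n. \<Sum>i\<in>Ix. coef n y i * (cnj (z k) * src i n k))"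
      unfolding ip_def gram_op_def distrib_left sum.distrib sum_distrib_left by (simp add: mult_ac)
    also have "(\<Sum>k<N n. \<Sum>i\<in>Ix. coef n y i * (cnj (z k) * src i n k)) = (\<Sum>i\<in>Ix. coef n y i * ip n z (src i n))"
      unfolding ip_def sum_distrib_left by (rule sum.swap)
    finally show ?thesis .
  qed
  have "(\<Sum>i\<in>Ix. coef n y i * ip n z (src i n)) = cnj (\<Sum>i\<in>Ix. coef n z i * ip n y (src i n))"
    unfolding sum_Ix cnj_sum coef_def Let_def
    by (intro sum.cong refl) (simp add: cnj_ip algebra_simps)
  then show ?thesis unfolding *[of z y] *[of y z] by (simp add: mult_ac)
qed

text \<open>Distinct sources become orthogonal under every continuous weight, so in the limit the
  double sum over sources keeps only its diagonal.\<close>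

lemma pair_limit:
  assumes fx: "\<And>i. i \<in> Ix \<Longrightarrow> (\<lambda>n. e n i) \<longlonglongrightarrow> e0 i" "\<And>i. i \<in> Ix \<Longrightarrow> (\<lambda>n. e' n i) \<longlonglongrightarrow> e0' i"
    and x: "x \<longlonglongrightarrow> x0" "T < x0" and x': "x' \<longlonglongrightarrow> x0'" "T < x0'"
    and y: "\<forall>\<^sub>F n in sequentially. \<forall>k<N n. y n k = of_real (1 / (x n - t n k)) * (\<Sum>i\<in>Ix. e n i * src i n k)"
    and y': "\<forall>\<^sub>F n in sequentially. \<forall>k<N n. y' n k = of_real (1 / (x' n - t n k)) * (\<Sum>i\<in>Ix. e' n i * src i n k)"
  shows "(\<lambda>n. ip n (y n) (y' n)) \<longlonglongrightarrow>
    (\<Sum>i\<in>Ix. cnj (e0 i) * e0' i * of_real (ilaw (fst i) (\<lambda>s. 1 / (x0 - s) * (1 / (x0' - s)))))"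
proof -
  obtain C where C: "\<And>i. i \<in> Ix \<Longrightarrow> \<forall>\<^sub>F n in sequentially. (\<Sum>k<N n. (cmod (src i n k))\<^sup>2) \<le> C"
    using src_bound by blast
  have "(\<lambda>n. \<Sum>k<N n. cnj (of_real (1 / (x n - t n k)) * (\<Sum>i\<in>Ix. e n i * src i n k)) *
            (of_real (1 / (x' n - t n k)) * (\<Sum>j\<in>Ix. e' n j * src j n k)))
     \<longlonglongrightarrow> (\<Sum>i\<in>Ix. \<Sum>j\<in>Ix. cnj (e0 i) * e0' j *
       (if i = j then of_real (ilaw (fst i) (\<lambda>s. 1 / (x0 - s) * (1 / (x0' - s)))) else 0))"
  proof (rule bilinear_weighted_limit[where C = C and T = T and a = src and b = src
        and h = "\<lambda>n s. 1 / (x n - s)" and h' = "\<lambda>n s. 1 / (x' n - s)"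
        and hl = "\<lambda>s. 1 / (x0 - s)" and hl' = "\<lambda>s. 1 / (x0' - s)"])
    show "(\<lambda>n. \<Sum>k<N n. of_real (1 / (x0 - t n k) * (1 / (x0' - t n k))) * (cnj (src i n k) * src j n k))
       \<longlonglongrightarrow> (if i = j then of_real (ilaw (fst i) (\<lambda>s. 1 / (x0 - s) * (1 / (x0' - s)))) else 0)"
      if "i \<in> Ix" "j \<in> Ix" for i j
      by (rule src_lim[OF that, of "\<lambda>s. 1 / (x0 - s) * (1 / (x0' - s))"])
        (use x x' in \<open>auto intro!: continuous_intros\<close>)
  qed (use tin C x x' fx in \<open>auto intro!: uniform_limit_inverse_shift continuous_intros\<close>)
  also have "(\<Sum>i\<in>Ix. \<Sum>j\<in>Ix. cnj (e0 i) * e0' j *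
       (if i = j then of_real (ilaw (fst i) (\<lambda>s. 1 / (x0 - s) * (1 / (x0' - s)))) else 0))
     = (\<Sum>i\<in>Ix. cnj (e0 i) * e0' i * complex_of_real (ilaw (fst i) (\<lambda>s. 1 / (x0 - s) * (1 / (x0' - s)))))"
    by (intro sum.cong refl) (simp add: if_distrib sum.delta cong: if_cong)
  finally show ?thesis
    by (rule Lim_transform_eventually) (use y y' in eventually_elim, simp add: ip_def)
qed

lemma src_pair_limit:
  assumes i: "i \<in> Ix" and fx: "\<And>i. i \<in> Ix \<Longrightarrow> (\<lambda>n. e n i) \<longlonglongrightarrow> e0 i"
    and x: "x \<longlonglongrightarrow> x0" "T < x0"
    and y: "\<forall>\<^sub>F n in sequentially. \<forall>k<N n. y n k = of_real (1 / (x n - t n k)) * (\<Sum>i\<in>Ix. e n i * src i n k)"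
  shows "(\<lambda>n. ip n (src i n) (y n)) \<longlonglongrightarrow> e0 i * of_real (ilaw (fst i) (\<lambda>s. 1 / (x0 - s)))"
proof -
  obtain C where C: "\<And>i. i \<in> Ix \<Longrightarrow> \<forall>\<^sub>F n in sequentially. (\<Sum>k<N n. (cmod (src i n k))\<^sup>2) \<le> C"
    using src_bound by blast
  \<comment> \<open>A single source is written as a one-term combination with weight 1, so that the
    general bilinear limit applies.\<close>
  have "(\<lambda>n. \<Sum>k<N n. cnj (of_real 1 * (\<Sum>i\<in>{i}. 1 * src i n k)) *
            (of_real (1 / (x n - t n k)) * (\<Sum>j\<in>Ix. e n j * src j n k)))
     \<longlonglongrightarrow> (\<Sum>i\<in>{i}. \<Sum>j\<in>Ix. cnj 1 * e0 j *
       (if i = j then of_real (ilaw (fst i) (\<lambda>s. 1 * (1 / (x0 - s)))) else 0))"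
  proof (rule bilinear_weighted_limit[where C = C and T = T and a = src and b = src
        and h = "\<lambda>n s. 1" and h' = "\<lambda>n s. 1 / (x n - s)"
        and hl = "\<lambda>s. 1" and hl' = "\<lambda>s. 1 / (x0 - s)" and e = "\<lambda>_ _. 1"])
    show "(\<lambda>n. \<Sum>k<N n. of_real (1 * (1 / (x0 - t n k))) * (cnj (src i' n k) * src j n k))
       \<longlonglongrightarrow> (if i' = j then of_real (ilaw (fst i') (\<lambda>s. 1 * (1 / (x0 - s)))) else 0)"
      if "i' \<in> {i}" "j \<in> Ix" for i' j
      by (rule src_lim[of i' j "\<lambda>s. 1 * (1 / (x0 - s))"])
        (use x that i in \<open>auto intro!: continuous_intros\<close>)
  qed (use tin C x fx i in \<open>auto intro!: uniform_limit_inverse_shift uniform_limit_const continuous_intros\<close>)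
  also have "(\<Sum>i\<in>{i}. \<Sum>j\<in>Ix. cnj 1 * e0 j *
       (if i = j then of_real (ilaw (fst i) (\<lambda>s. 1 * (1 / (x0 - s)))) else 0))
      = e0 i * complex_of_real (ilaw (fst i) (\<lambda>s. 1 / (x0 - s)))"
    using i by (simp add: if_distrib sum.delta cong: if_cong)
  finally show ?thesis
    by (rule Lim_transform_eventually) (use y in eventually_elim, simp add: ip_def)
qed

text \<open>\<open>\<beta>\<close> stands for a deterministic vector in the basis of left singular
  vectors: it has a limiting overlap \<open>z\<close> with left sources and none with right
  ones.\<close>

lemma external_pair_limit:
  assumes \<beta>b: "\<exists>C. \<forall>\<^sub>F n in sequentially. (\<Sum>k<N n. (cmod (\<beta> n k))\<^sup>2) \<le> C"
    and \<beta>: "\<And>i f. i \<in> Ix \<Longrightarrow> f \<in> borel_measurable borel \<Longrightarrow> continuous_on {0..T} f \<Longrightarrow>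
        (\<lambda>n. \<Sum>k<N n. of_real (f (t n k)) * (cnj (\<beta> n k) * src i n k))
          \<longlonglongrightarrow> (if fst i then 0 else z (snd i) * of_real (ilaw False f))"
    and fx: "\<And>i. i \<in> Ix \<Longrightarrow> (\<lambda>n. e n i) \<longlonglongrightarrow> e0 i"
    and x: "x \<longlonglongrightarrow> x0" "T < x0"
    and y: "\<forall>\<^sub>F n in sequentially. \<forall>k<N n. y n k = of_real (1 / (x n - t n k)) * (\<Sum>i\<in>Ix. e n i * src i n k)"
  shows "(\<lambda>n. ip n (\<beta> n) (y n)) \<longlonglongrightarrow> of_real (rA x0) * (\<Sum>p<r. z p * e0 (False, p))"
proof -
  obtain C where C: "\<And>i. i \<in> Ix \<Longrightarrow> \<forall>\<^sub>F n in sequentially. (\<Sum>k<N n. (cmod (src i n k))\<^sup>2) \<le> C"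
    using src_bound by blast
  obtain C' where C': "\<forall>\<^sub>F n in sequentially. (\<Sum>k<N n. (cmod (\<beta> n k))\<^sup>2) \<le> C'" using \<beta>b by blast
  have "(\<lambda>n. \<Sum>k<N n. cnj (of_real 1 * (\<Sum>i\<in>{()}. 1 * \<beta> n k)) *
            (of_real (1 / (x n - t n k)) * (\<Sum>j\<in>Ix. e n j * src j n k)))
     \<longlonglongrightarrow> (\<Sum>i\<in>{()}. \<Sum>j\<in>Ix. cnj 1 * e0 j *
       (if fst j then 0 else z (snd j) * of_real (ilaw False (\<lambda>s. 1 * (1 / (x0 - s))))))"
  proof (rule bilinear_weighted_limit[where C = "max C C'" and T = T and hl = "\<lambda>s. 1" and a = "\<lambda>_. \<beta>" and b = src
      and h = "\<lambda>_ _. 1" and h' = "\<lambda>n s. 1 / (x n - s)" and hl' = "\<lambda>s. 1 / (x0 - s)" and e = "\<lambda>_ _. 1"])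
    show "\<forall>\<^sub>F n in sequentially. (\<Sum>k<N n. (cmod (\<beta> n k))\<^sup>2) \<le> max C C'"
      using C' by eventually_elim simp
    show "\<forall>\<^sub>F n in sequentially. (\<Sum>k<N n. (cmod (src j n k))\<^sup>2) \<le> max C C'" if "j \<in> Ix" for j
      using C[OF that] by eventually_elim simp
    show "(\<lambda>n. \<Sum>k<N n. of_real (1 * (1 / (x0 - t n k))) * (cnj (\<beta> n k) * src j n k))
       \<longlonglongrightarrow> (if fst j then 0 else z (snd j) * of_real (ilaw False (\<lambda>s. 1 * (1 / (x0 - s)))))"
      if "j \<in> Ix" for j
      by (rule \<beta>[OF that, of "\<lambda>s. 1 * (1 / (x0 - s))"]) (use x in \<open>auto intro!: continuous_intros\<close>)
  qed (use tin x fx in \<open>auto intro!: uniform_limit_inverse_shift uniform_limit_const continuous_intros\<close>)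
  also have "(\<Sum>i\<in>{()}. \<Sum>j\<in>Ix. cnj 1 * e0 j *
       (if fst j then 0 else z (snd j) * of_real (ilaw False (\<lambda>s. 1 * (1 / (x0 - s))))))
      = of_real (rA x0) * (\<Sum>p<r. z p * e0 (False, p))"
    by (simp add: sum_Ix rA_def sum_distrib_left sum_distrib_right mult_ac)
  finally show ?thesis
    by (rule Lim_transform_eventually) (use y in eventually_elim, simp add: ip_def)
qed

end

text \<open>Meant for the indices below \<open>J\<close> whose eigenvalue limit equals
  \<open>\<rho>\<close>: knowing how many there are tells which ones they are.\<close>

lemma upset_lessThan_eq:
  assumes "U \<subseteq> {..<J::nat}" "\<And>q q'. q \<in> U \<Longrightarrow> q \<le> q' \<Longrightarrow> q' < J \<Longrightarrow> q' \<in> U"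
  shows "U = {J - card U..<J}"
proof (cases "U = {}")
  case False
  have fin: "finite U" using assms(1) finite_subset by blast
  define m where "m = Min U"
  have "m \<in> U" "\<And>q. q \<in> U \<Longrightarrow> m \<le> q" using fin False unfolding m_def by auto
  have "U = {m..<J}"
  proof (rule equalityI; rule subsetI)
    fix q assume "q \<in> U"
    then show "q \<in> {m..<J}" using assms(1) \<open>\<And>q. q \<in> U \<Longrightarrow> m \<le> q\<close> by fastforce
  next
    fix q assume "q \<in> {m..<J}"
    then show "q \<in> U" using assms(2)[OF \<open>m \<in> U\<close>] by simp
  qed
  moreover from this have "card U = J - m" by simp
  moreover have "m < J" using \<open>m \<in> U\<close> assms(1) by blast
  ultimately show ?thesis by (metis diff_diff_cancel less_imp_le)
qed simp

context limit_law
begin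

text \<open>The limit of the squared norm of an eigenvector, per unit of squared norm of its coefficients \<open>d\<close>.\<close>

definition rW where "rW x = rA2 x * (1 + rB x)\<^sup>2 / rg x + rB2 x"

lemma rW_pos: "T < x \<Longrightarrow> 0 < rW x"
  unfolding rW_def using rA2_pos[of x] rB_nonneg[of x] rg_pos[of x] rB2_nonneg[of x]
  by (intro add_pos_nonneg divide_pos_pos mult_pos_pos zero_less_power) auto

lemma rg_inj: assumes "T < x" "T < y" "rg x = rg y" shows "x = y"
  using rg_strict_antimono[of x y] rg_strict_antimono[of y x] assms
  by (cases x y rule: linorder_cases) auto

end

section \<open>Lower bound for the largest eigenvalues\<close>

context spiked
begin

text \<open>
  Test vectors at \<open>\<rho>\<close>. The ratio \<open>\<omega>\<^sub>p rA(\<rho>)\<close> of the two coefficients is the one forced on an exact eigenvector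
  by the definition of \<open>coef\<close> at \<open>True\<close>; only the equation at \<open>False\<close> is then violated, with excess
  \<open>\<omega>\<^sub>p\<^sup>2 g(\<rho>) - 1 \<ge> 0\<close>.
\<close>

definition tcoef :: "real \<Rightarrow> nat \<Rightarrow> (nat \<Rightarrow> complex) \<Rightarrow> bool \<times> nat \<Rightarrow> complex" where
  "tcoef \<rho> J cc i = (if snd i < J then cc (snd i) * (if fst i then of_real (\<omega> (snd i) * rA \<rho>) else 1) else 0)"

definition tvec :: "real \<Rightarrow> nat \<Rightarrow> (nat \<Rightarrow> complex) \<Rightarrow> nat \<Rightarrow> nat \<Rightarrow> complex" where
  "tvec \<rho> J cc n k = of_real (1 / (\<rho> - t n k)) * (\<Sum>i\<in>Ix. tcoef \<rho> J cc i * src i n k)"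

text \<open>The test vector is orthogonal to the first \<open>J - 1\<close> eigenvectors, so its
  Rayleigh quotient is at most \<open>lam n (J - 1)\<close>. Its image under \<open>gram_op\<close>
  is \<open>\<rho>\<close> times itself plus a combination of sources, and the pairing of the latter
  with the vector has a nonnegative limit.\<close>

lemma top_eigenvalue_limit_ge:
  assumes \<rho>: "T < \<rho>" and J: "0 < J" "J \<le> r" and sup: "\<And>p. p < J \<Longrightarrow> 1 \<le> (\<omega> p)\<^sup>2 * rg \<rho>"
    and eig: "\<forall>\<^sub>F n in sequentially. \<forall>q<N n. \<forall>k<N n. gram_op n (xi n q) k = of_real (lam n q) * xi n q k"
    and lamx: "(\<lambda>n. lam n (J - 1)) \<longlonglongrightarrow> x"
    and cc1: "\<And>n. (\<Sum>p<J. (cmod (cc n p))\<^sup>2) = 1"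
    and cc0: "\<And>n q. q < J - 1 \<Longrightarrow> ip n (xi n q) (tvec \<rho> J (cc n) n) = 0"
    and ccl: "\<And>p. p < J \<Longrightarrow> (\<lambda>n. cc n p) \<longlonglongrightarrow> cl p"
  shows "\<rho> \<le> x"
proof -
  define y where "y n = tvec \<rho> J (cc n) n" for n
  define f where "f n = tcoef \<rho> J (cc n)" for n
  define fl where "fl = tcoef \<rho> J cl"
  have fl: "(\<lambda>n. f n i) \<longlonglongrightarrow> fl i" if "i \<in> Ix" for i
    unfolding f_def fl_def tcoef_def by (auto intro!: tendsto_intros ccl)
  have yeq: "y n k = of_real (1 / (\<rho> - t n k)) * (\<Sum>i\<in>Ix. f n i * src i n k)" for n k
    unfolding y_def f_def tvec_def ..
  have yev: "\<forall>\<^sub>F n in sequentially. \<forall>k<N n. y n k = of_real (1 / (\<rho> - t n k)) * (\<Sum>i\<in>Ix. f n i * src i n k)"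
    by (simp add: yeq)
  have s_lim: "(\<lambda>n. ip n (src i n) (y n)) \<longlonglongrightarrow> fl i * of_real (ilaw (fst i) (\<lambda>s. 1 / (\<rho> - s)))"
    if "i \<in> Ix" for i
    by (rule src_pair_limit[OF that fl tendsto_const \<rho> yev])
  have sF: "(\<lambda>n. ip n (src (False, p) n) (y n)) \<longlonglongrightarrow> fl (False, p) * of_real (rA \<rho>)"
    and sT: "(\<lambda>n. ip n (src (True, p) n) (y n)) \<longlonglongrightarrow> fl (True, p) * of_real (rB \<rho>)" if "p < r" for p
    using s_lim[of "(False, p)"] s_lim[of "(True, p)"] that by (auto simp: rA_def rB_def)
  have y2: "(\<lambda>n. ip n (y n) (y n)) \<longlonglongrightarrow>
      (\<Sum>i\<in>Ix. cnj (fl i) * fl i * of_real (ilaw (fst i) (\<lambda>s. 1 / (\<rho> - s) * (1 / (\<rho> - s)))))"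
    by (rule pair_limit[OF fl fl tendsto_const \<rho> tendsto_const \<rho> yev yev])
  define Y where "Y = (\<Sum>p<r. (cmod (fl (False, p)))\<^sup>2 * rA2 \<rho> + (cmod (fl (True, p)))\<^sup>2 * rB2 \<rho>)"
  have Yeq: "(\<Sum>i\<in>Ix. cnj (fl i) * fl i * of_real (ilaw (fst i) (\<lambda>s. 1 / (\<rho> - s) * (1 / (\<rho> - s))))) = of_real Y"
    by (simp add: sum_Ix Y_def rA2_def rB2_def cnj_mult_cmod)
  have "(\<lambda>n. \<Sum>p<J. (cmod (cc n p))\<^sup>2) \<longlonglongrightarrow> (\<Sum>p<J. (cmod (cl p))\<^sup>2)"
    by (intro tendsto_intros ccl) auto
  then have cl1: "(\<Sum>p<J. (cmod (cl p))\<^sup>2) = 1" unfolding cc1 using LIMSEQ_unique tendsto_const by blast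
  \<comment> \<open>The normalisation of \<open>cc\<close> survives in the limit, and the left
    sources alone keep the norm of the test vector away from 0.\<close>
  have "0 < rA2 \<rho> * (\<Sum>p<J. (cmod (cl p))\<^sup>2)" using cl1 rA2_pos[OF \<rho>] by simp
  also have "\<dots> = (\<Sum>p<J. (cmod (fl (False, p)))\<^sup>2 * rA2 \<rho>)"
    by (simp add: fl_def tcoef_def sum_distrib_left mult_ac)
  also have "\<dots> \<le> (\<Sum>p<r. (cmod (fl (False, p)))\<^sup>2 * rA2 \<rho>)"
    using J rA2_pos[OF \<rho>] by (intro sum_mono2) auto
  also have "\<dots> \<le> Y" unfolding Y_def using rB2_nonneg[OF \<rho>] by (intro sum_mono) auto
  finally have Ypos: "0 < Y" .
  define cl' where "cl' p = (if p < J then cl p else 0)" for p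
  have flF: "fl (False, p) = cl' p" and flT: "fl (True, p) = cl' p * of_real (\<omega> p * rA \<rho>)" for p
    unfolding fl_def tcoef_def cl'_def by auto
  have cT: "(\<lambda>n. coef n (y n) (True, p)) \<longlonglongrightarrow> of_real (\<omega> p) * (cl' p * of_real (rA \<rho>))" if "p < r" for p
    unfolding coef_def Let_def using sF[OF that] om[OF that]
    by (auto intro!: tendsto_intros simp: flF)
  have cF: "(\<lambda>n. coef n (y n) (False, p)) \<longlonglongrightarrow> of_real (\<omega> p) * (cl' p * of_real (\<omega> p * rA \<rho>) * of_real (rB \<rho>)
      + of_real (\<omega> p) * (cl' p * of_real (rA \<rho>)))" if "p < r" for p
    unfolding coef_def Let_def using sF[OF that] sT[OF that] om[OF that]
    by (auto intro!: tendsto_intros simp: flF flT)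
  define e where "e = (\<lambda>i. if fst i then of_real (\<omega> (snd i)) * (cl' (snd i) * of_real (rA \<rho>)) else
     of_real (\<omega> (snd i)) * (cl' (snd i) * of_real (\<omega> (snd i) * rA \<rho>) * of_real (rB \<rho>)
      + of_real (\<omega> (snd i)) * (cl' (snd i) * of_real (rA \<rho>))))"
  have e: "(\<lambda>n. coef n (y n) i) \<longlonglongrightarrow> e i" if "i \<in> Ix" for i
    using that cT cF by (cases i) (auto simp: e_def)
  \<comment> \<open>Multiplying \<open>y n\<close> by \<open>\<rho> - t n k\<close> in each
    coordinate returns the combination of sources with coefficients \<open>f n\<close>; so only the
    mismatch between \<open>coef\<close> and \<open>f n\<close> separates the image from
    \<open>\<rho>\<close> times \<open>y n\<close>.\<close>
  have Sy: "\<forall>\<^sub>F n in sequentially. ip n (y n) (gram_op n (y n)) =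
      of_real \<rho> * ip n (y n) (y n) + (\<Sum>i\<in>Ix. (coef n (y n) i - f n i) * cnj (ip n (src i n) (y n)))"
    using tin
  proof eventually_elim
    case (elim n)
    have g: "gram_op n (y n) k = of_real \<rho> * y n k + (\<Sum>i\<in>Ix. (coef n (y n) i - f n i) * src i n k)"
      if "k < N n" for k
    proof -
      have "\<rho> - t n k \<noteq> 0" using elim that \<rho> by force
      then have "complex_of_real (\<rho> - t n k) \<noteq> 0" by (simp only: of_real_eq_0_iff not_False_eq_True)
      then have "(of_real \<rho> - of_real (t n k)) * y n k = (\<Sum>i\<in>Ix. f n i * src i n k)"
        unfolding yeq by simp
      then show ?thesis unfolding gram_op_def
        by (simp add: left_diff_distrib sum_subtractf algebra_simps)
    qed
    have "ip n (y n) (gram_op n (y n)) = (\<Sum>k<N n. of_real \<rho> * (cnj (y n k) * y n k)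
        + (\<Sum>i\<in>Ix. (coef n (y n) i - f n i) * (cnj (y n k) * src i n k)))"
      unfolding ip_def by (intro sum.cong refl) (simp add: g distrib_left sum_distrib_left mult_ac)
    also have "\<dots> = of_real \<rho> * ip n (y n) (y n)
        + (\<Sum>k<N n. \<Sum>i\<in>Ix. (coef n (y n) i - f n i) * (cnj (y n k) * src i n k))"
      by (simp add: sum.distrib ip_def sum_distrib_left)
    also have "(\<Sum>k<N n. \<Sum>i\<in>Ix. (coef n (y n) i - f n i) * (cnj (y n k) * src i n k))
        = (\<Sum>i\<in>Ix. (coef n (y n) i - f n i) * cnj (ip n (src i n) (y n)))"
      unfolding cnj_ip unfolding ip_def sum_distrib_left by (rule sum.swap)
    finally show ?case .
  qed
  define z where "z = (\<Sum>i\<in>Ix. (e i - fl i) * cnj (fl i * of_real (ilaw (fst i) (\<lambda>s. 1 / (\<rho> - s)))))"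
  have "(\<lambda>n. of_real \<rho> * ip n (y n) (y n) + (\<Sum>i\<in>Ix. (coef n (y n) i - f n i) * cnj (ip n (src i n) (y n))))
     \<longlonglongrightarrow> of_real \<rho> * of_real Y + z"
    unfolding z_def using y2[unfolded Yeq] by (intro tendsto_intros e fl s_lim) auto
  then have "(\<lambda>n. ip n (y n) (gram_op n (y n))) \<longlonglongrightarrow> of_real \<rho> * of_real Y + z"
    by (rule Lim_transform_eventually) (use Sy in eventually_elim, simp)
  then have lim1: "(\<lambda>n. Re (ip n (y n) (gram_op n (y n)))) \<longlonglongrightarrow> \<rho> * Y + Re z"
    by (auto dest: tendsto_Re)
  have zeq: "z = of_real (\<Sum>p<r. ((\<omega> p)\<^sup>2 * rg \<rho> - 1) * rA \<rho> * (cmod (cl' p))\<^sup>2)"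
    unfolding z_def sum_Ix of_real_sum
  proof (rule sum.cong[OF refl])
    fix p
    have "(e (False, p) - fl (False, p)) * cnj (fl (False, p) * of_real (rA \<rho>))
        = of_real (((\<omega> p)\<^sup>2 * rg \<rho> - 1) * rA \<rho>) * (cnj (cl' p) * cl' p)"
      by (simp add: e_def flF rg_def power2_eq_square algebra_simps)
    also have "\<dots> = of_real (((\<omega> p)\<^sup>2 * rg \<rho> - 1) * rA \<rho> * (cmod (cl' p))\<^sup>2)"
      unfolding cnj_mult_cmod by simp
    finally have 1: "(e (False, p) - fl (False, p)) * cnj (fl (False, p) * of_real (rA \<rho>)) = \<dots>" .
    have 2: "e (True, p) - fl (True, p) = 0" by (simp add: e_def flT)
    show "(e (False, p) - fl (False, p)) * cnj (fl (False, p) * of_real (ilaw (fst (False, p)) (\<lambda>s. 1 / (\<rho> - s))))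
       + (e (True, p) - fl (True, p)) * cnj (fl (True, p) * of_real (ilaw (fst (True, p)) (\<lambda>s. 1 / (\<rho> - s))))
       = of_real (((\<omega> p)\<^sup>2 * rg \<rho> - 1) * rA \<rho> * (cmod (cl' p))\<^sup>2)"
      unfolding 2 fst_conv rA_def[symmetric] 1 by simp
  qed
  have "0 \<le> Re z" unfolding zeq Re_complex_of_real
  proof (rule sum_nonneg)
    fix p assume "p \<in> {..<r}"
    show "0 \<le> ((\<omega> p)\<^sup>2 * rg \<rho> - 1) * rA \<rho> * (cmod (cl' p))\<^sup>2"
      using sup[of p] rA_pos[OF \<rho>] by (cases "p < J") (auto simp: cl'_def)
  qed
  have ray: "\<forall>\<^sub>F n in sequentially. Re (ip n (y n) (gram_op n (y n))) \<le> lam n (J - 1) * Re (ip n (y n) (y n))"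
    using eig xi_orth lam_mono N_large
  proof eventually_elim
    case (elim n)
    have "Re (\<Sum>k<N n. cnj (y n k) * gram_op n (y n) k) \<le> lam n (J - 1) * (\<Sum>k<N n. (cmod (y n k))\<^sup>2)"
    proof (rule rayleigh_le[where x = "xi n" and l = "lam n"])
      show "(\<Sum>k<N n. cnj (xi n q k) * gram_op n (y n) k) = of_real (lam n q) * (\<Sum>k<N n. cnj (xi n q k) * y n k)"
        if "q < N n" for q
      proof -
        have "(\<Sum>k<N n. cnj (xi n q k) * gram_op n (y n) k) = cnj (ip n (y n) (gram_op n (xi n q)))"
          using gram_op_hermitian[of n "xi n q" "y n"] by (simp add: ip_def)
        also have "ip n (y n) (gram_op n (xi n q)) = of_real (lam n q) * ip n (y n) (xi n q)"
          using elim(1) that by (simp add: ip_def sum_distrib_left mult_ac)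
        finally show ?thesis by (simp add: cnj_ip) (simp add: ip_def)
      qed
      show "(\<Sum>k<N n. cnj (xi n q k) * y n k) = 0" if "q < J - 1" for q
        using cc0[OF that, of n] by (simp add: ip_def y_def)
    qed (use elim J in auto)
    moreover have "(\<Sum>k<N n. (cmod (y n k))\<^sup>2) = Re (ip n (y n) (y n))"
      by (simp add: ip_def cnj_mult_cmod)
    ultimately show ?case by (simp add: ip_def)
  qed
  have "(\<lambda>n. lam n (J - 1) * Re (ip n (y n) (y n))) \<longlonglongrightarrow> x * Re (of_real Y)"
    using y2[unfolded Yeq] by (intro tendsto_mult lamx tendsto_Re)
  then have "\<rho> * Y + Re z \<le> x * Y"
    using tendsto_le[OF sequentially_bot _ lim1 ray] by simp
  then have "\<rho> * Y \<le> x * Y" using \<open>0 \<le> Re z\<close> by simp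
  then show ?thesis using Ypos by simp
qed

end

section \<open>Limits of eigenvectors and of the spectral projection\<close>

context spiked
begin

text \<open>All limits are hypotheses here; compactness provides them later. The same set
  \<open>G\<close> indexes spikes and eigenvectors: the indices whose eigenvalues tend to
  \<open>\<rho>\<close> form a final segment below \<open>J\<close>, as \<open>G\<close> does, and
  counting shows that the two agree.\<close>

lemma eigenprojection_limit:
  assumes \<rho>: "T < \<rho>" and \<omega>i: "0 < \<omega>i" "\<omega>i\<^sup>2 * rg \<rho> = 1"
    and \<omega>pos: "\<And>p. p < r \<Longrightarrow> 0 < \<omega> p"
    and J: "0 < J" "J \<le> r" "\<And>p. p < r \<Longrightarrow> p < J \<longleftrightarrow> \<omega>i \<le> \<omega> p"
    and G: "G = {m..<J}" "\<And>p. p < r \<Longrightarrow> p \<in> G \<longleftrightarrow> \<omega> p = \<omega>i"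
    and eig: "\<forall>\<^sub>F n in sequentially. \<forall>q<N n. \<forall>k<N n. gram_op n (xi n q) k = of_real (lam n q) * xi n q k"
    and lamx: "\<And>q. q < J \<Longrightarrow> (\<lambda>n. lam n q) \<longlonglongrightarrow> x q"
    and E: "\<And>q i. q < J \<Longrightarrow> i \<in> Ix \<Longrightarrow> (\<lambda>n. coef n (xi n q) i) \<longlonglongrightarrow> E q i"
    and cc1: "\<And>n. (\<Sum>p<J. (cmod (cc n p))\<^sup>2) = 1"
    and cc0: "\<And>n q. q < J - 1 \<Longrightarrow> ip n (xi n q) (tvec \<rho> J (cc n) n) = 0"
    and ccl: "\<And>p. p < J \<Longrightarrow> (\<lambda>n. cc n p) \<longlonglongrightarrow> cl p"
    and \<beta>b: "\<And>b. \<exists>C. \<forall>\<^sub>F n in sequentially. (\<Sum>k<N n. (cmod (\<beta> b n k))\<^sup>2) \<le> C"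
    and \<beta>: "\<And>b i f. i \<in> Ix \<Longrightarrow> f \<in> borel_measurable borel \<Longrightarrow> continuous_on {0..T} f \<Longrightarrow>
        (\<lambda>n. \<Sum>k<N n. of_real (f (t n k)) * (cnj (\<beta> b n k) * src i n k))
          \<longlonglongrightarrow> (if fst i then 0 else z b (snd i) * of_real (ilaw False f))"
  shows "(\<lambda>n. \<Sum>q\<in>G. ip n (\<beta> True n) (xi n q) * ip n (xi n q) (\<beta> False n))
    \<longlonglongrightarrow> of_real ((rA \<rho>)\<^sup>2 * (1 + rB \<rho>) / (rA \<rho> * rB2 \<rho> + rA2 \<rho> * (1 + rB \<rho>)))
        * (\<Sum>p\<in>G. z True p * cnj (z False p))"
proof -
  have Jp: "p < J \<Longrightarrow> p < r" for p using J(2) by simp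
  have GJ: "G \<subseteq> {..<J}" "finite G" unfolding G(1) by auto
  have evJ: "\<forall>\<^sub>F n in sequentially. J \<le> N n" using N_large by eventually_elim (use J in simp)
  have "\<rho> \<le> x (J - 1)"
  proof (rule top_eigenvalue_limit_ge[OF \<rho> J(1,2) _ eig lamx cc1 cc0 ccl])
    fix p assume "p < J"
    then have "\<omega>i \<le> \<omega> p" using J(3) Jp by blast
    then have "\<omega>i\<^sup>2 \<le> (\<omega> p)\<^sup>2" using \<omega>i(1) by (intro power_mono) auto
    then show "1 \<le> (\<omega> p)\<^sup>2 * rg \<rho>" using \<omega>i(2) rg_pos[OF \<rho>] by (metis less_imp_le mult_right_mono)
  qed (use J(1) in simp_all)
  note lower = this
  have xmono: "x q' \<le> x q" if "q \<le> q'" "q' < J" for q q'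
  proof (rule tendsto_le[OF sequentially_bot lamx lamx])
    show "\<forall>\<^sub>F n in sequentially. lam n q' \<le> lam n q"
      using lam_mono evJ by eventually_elim (use that in force)
  qed (use that in auto)
  have x\<rho>: "\<rho> \<le> x q" if "q < J" for q
  proof -
    have "x (J - 1) \<le> x q" by (rule xmono) (use that in auto)
    with lower show ?thesis by simp
  qed
  have xT: "T < x q" if "q < J" for q using x\<rho>[OF that] \<rho> by simp
  \<comment> \<open>Above \<open>T\<close> the diagonal part of the eigenvalue equation is
    invertible, which expresses the eigenvector through its own coefficients.\<close>
  have xi_form: "\<forall>\<^sub>F n in sequentially. \<forall>k<N n. xi n q k = of_real (1 / (lam n q - t n k)) *
      (\<Sum>i\<in>Ix. coef n (xi n q) i * src i n k)" if q: "q < J" for q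
  proof -
    have "\<forall>\<^sub>F n in sequentially. T < lam n q" using order_tendstoD(1)[OF lamx[OF q] xT[OF q]] .
    then show ?thesis using tin eig evJ
    proof (eventually_elim, intro allI impI)
      fix n k
      assume *: "T < lam n q" "\<forall>k<N n. t n k \<in> {0..T}" "J \<le> N n" "k < N n"
        "\<forall>q<N n. \<forall>k<N n. gram_op n (xi n q) k = of_real (lam n q) * xi n q k"
      have "lam n q - t n k \<noteq> 0" using * by force
      then have ne: "complex_of_real (lam n q - t n k) \<noteq> 0" by (simp only: of_real_eq_0_iff not_False_eq_True)
      have "gram_op n (xi n q) k = of_real (lam n q) * xi n q k" using * q by auto
      then have "complex_of_real (lam n q - t n k) * xi n q k = (\<Sum>i\<in>Ix. coef n (xi n q) i * src i n k)"
        unfolding gram_op_def by (simp add: algebra_simps)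
      then have "of_real (1 / (lam n q - t n k)) * (complex_of_real (lam n q - t n k) * xi n q k)
        = of_real (1 / (lam n q - t n k)) * (\<Sum>i\<in>Ix. coef n (xi n q) i * src i n k)" by simp
      then show "xi n q k = of_real (1 / (lam n q - t n k)) * (\<Sum>i\<in>Ix. coef n (xi n q) i * src i n k)"
        using ne by (simp add: mult.assoc[symmetric] of_real_mult[symmetric] del: of_real_mult of_real_divide of_real_diff)
    qed
  qed
  have sF: "(\<lambda>n. ip n (src (False, p) n) (xi n q)) \<longlonglongrightarrow> E q (False, p) * of_real (rA (x q))"
    and sT: "(\<lambda>n. ip n (src (True, p) n) (xi n q)) \<longlonglongrightarrow> E q (True, p) * of_real (rB (x q))"
    if "p < r" "q < J" for p q
    using src_pair_limit[OF _ E[OF that(2)] lamx[OF that(2)] xT[OF that(2)] xi_form[OF that(2)], of "(False, p)"]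
      src_pair_limit[OF _ E[OF that(2)] lamx[OF that(2)] xT[OF that(2)] xi_form[OF that(2)], of "(True, p)"] that
    by (auto simp: rA_def rB_def)
  \<comment> \<open>The coefficients at \<open>True\<close> suffice, since \<open>D2\<close>
    recovers those at \<open>False\<close>.\<close>
  define D where "D q p = E q (True, p)" for q p
  have D1: "D q p = of_real (\<omega> p) * (E q (False, p) * of_real (rA (x q)))" if "p < r" "q < J" for p q
  proof (rule LIMSEQ_unique)
    show "(\<lambda>n. coef n (xi n q) (True, p)) \<longlonglongrightarrow> D q p" unfolding D_def using E that by auto
    show "(\<lambda>n. coef n (xi n q) (True, p)) \<longlonglongrightarrow> of_real (\<omega> p) * (E q (False, p) * of_real (rA (x q)))"
      unfolding coef_def Let_def using sF[OF that] om[OF that(1)] by (auto intro!: tendsto_intros)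
  qed
  have D2: "E q (False, p) = of_real (\<omega> p * (1 + rB (x q))) * D q p" if "p < r" "q < J" for p q
  proof (rule LIMSEQ_unique)
    show "(\<lambda>n. coef n (xi n q) (False, p)) \<longlonglongrightarrow> E q (False, p)" using E that by auto
    have "(\<lambda>n. coef n (xi n q) (False, p)) \<longlonglongrightarrow> of_real (\<omega> p) * (E q (True, p) * of_real (rB (x q))
       + of_real (\<omega> p) * (E q (False, p) * of_real (rA (x q))))"
      unfolding coef_def Let_def using sF[OF that] sT[OF that] om[OF that(1)] by (auto intro!: tendsto_intros)
    also have "of_real (\<omega> p) * (E q (True, p) * of_real (rB (x q))
       + of_real (\<omega> p) * (E q (False, p) * of_real (rA (x q)))) = of_real (\<omega> p * (1 + rB (x q))) * D q p"
      unfolding D1[OF that, symmetric] by (simp add: D_def algebra_simps)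
    finally show "(\<lambda>n. coef n (xi n q) (False, p)) \<longlonglongrightarrow> of_real (\<omega> p * (1 + rB (x q))) * D q p" .
  qed
  \<comment> \<open>Eliminating the coefficient at \<open>False\<close> between \<open>D1\<close>
    and \<open>D2\<close> leaves one scalar equation for each \<open>p\<close>.\<close>
  have D3: "(\<omega> p)\<^sup>2 * rg (x q) = 1" if "p < r" "q < J" "D q p \<noteq> 0" for p q
  proof -
    have "D q p = of_real ((\<omega> p)\<^sup>2 * rg (x q)) * D q p"
      using D1[OF that(1,2)] unfolding D2[OF that(1,2)] rg_def by (simp add: power2_eq_square mult_ac)
    then have "complex_of_real ((\<omega> p)\<^sup>2 * rg (x q)) = 1" using that(3) by (metis mult_cancel_right1)
    then show ?thesis by (simp only: of_real_eq_1_iff)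
  qed
  \<comment> \<open>Orthonormality of the eigenvectors in the limit. The weight of a term depends on
    both \<open>x q\<close> and \<open>x q'\<close>, but if \<open>D q p\<close> and
    \<open>D q' p\<close> are both nonzero, these coincide by injectivity of \<open>rg\<close>; so
    the single factor \<open>rW (x q)\<close> comes out of the sum.\<close>
  have gram: "of_real (rW (x q)) * (\<Sum>p<r. cnj (D q p) * D q' p) = (if q = q' then 1 else 0)"
    if q: "q < J" "q' < J" for q q'
  proof -
    have 1: "(\<lambda>n. ip n (xi n q) (xi n q')) \<longlonglongrightarrow>
      (\<Sum>i\<in>Ix. cnj (E q i) * E q' i * of_real (ilaw (fst i) (\<lambda>s. 1 / (x q - s) * (1 / (x q' - s)))))"
      by (rule pair_limit[OF E[OF q(1)] E[OF q(2)] lamx[OF q(1)] xT[OF q(1)] lamx[OF q(2)] xT[OF q(2)]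
            xi_form[OF q(1)] xi_form[OF q(2)]])
    have "\<forall>\<^sub>F n in sequentially. (if q = q' then 1 else 0) = ip n (xi n q) (xi n q')"
      using xi_orth evJ by eventually_elim (use q in \<open>auto simp: ip_def\<close>)
    then have "(\<lambda>n. ip n (xi n q) (xi n q')) \<longlonglongrightarrow> (if q = q' then 1 else 0)"
      by (rule Lim_transform_eventually[OF tendsto_const])
    then have "(if q = q' then 1 else 0) = (\<Sum>i\<in>Ix. cnj (E q i) * E q' i *
        of_real (ilaw (fst i) (\<lambda>s. 1 / (x q - s) * (1 / (x q' - s)))))"
      using 1 LIMSEQ_unique by blast
    also have "\<dots> = (\<Sum>p<r. of_real (rW (x q)) * (cnj (D q p) * D q' p))"
      unfolding sum_Ix
    proof (rule sum.cong[OF refl])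
      fix p assume "p \<in> {..<r}"
      then have p: "p < r" by simp
      show "cnj (E q (False, p)) * E q' (False, p) * of_real (ilaw (fst (False, p)) (\<lambda>s. 1 / (x q - s) * (1 / (x q' - s))))
         + cnj (E q (True, p)) * E q' (True, p) * of_real (ilaw (fst (True, p)) (\<lambda>s. 1 / (x q - s) * (1 / (x q' - s))))
         = of_real (rW (x q)) * (cnj (D q p) * D q' p)"
      proof (cases "D q p = 0 \<or> D q' p = 0")
        case True
        then show ?thesis using D2[OF p q(1)] D2[OF p q(2)] by (auto simp: D_def)
      next
        case False
        then have w: "(\<omega> p)\<^sup>2 * rg (x q) = 1" "(\<omega> p)\<^sup>2 * rg (x q') = 1" using D3 p q by auto
        then have "rg (x q) = rg (x q')" using \<omega>pos[OF p]
          by (metis mult_cancel_left mult_zero_left zero_neq_one)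
        then have xx: "x q' = x q" using rg_inj xT q by metis
        have "(\<omega> p)\<^sup>2 = 1 / rg (x q)" using w(1) by (metis mult_zero_right nonzero_eq_divide_eq zero_neq_one)
        then have W: "rW (x q) = (\<omega> p * (1 + rB (x q)))\<^sup>2 * rA2 (x q) + rB2 (x q)"
          unfolding rW_def by (simp add: power_mult_distrib)
        show ?thesis
          unfolding D2[OF p q(1)] D2[OF p q(2)] xx W fst_conv rA2_def[symmetric] rB2_def[symmetric] D_def[symmetric]
          by (simp add: power2_eq_square algebra_simps)
      qed
    qed
    finally show ?thesis by (simp add: sum_distrib_left)
  qed
  \<comment> \<open>A spike weaker than \<open>\<omega>i\<close> would need an eigenvalue limit at
    which \<open>rg\<close> is larger than \<open>rg \<rho>\<close>, hence a limit below
    \<open>\<rho>\<close>.\<close>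
  have D0: "D q p = 0" if "q < J" "p < r" "\<not> p < J" for q p
  proof (rule ccontr)
    assume "D q p \<noteq> 0"
    then have 1: "(\<omega> p)\<^sup>2 * rg (x q) = 1" using D3 that by blast
    have "\<omega> p < \<omega>i" using J(3) that by force
    then have "(\<omega> p)\<^sup>2 < \<omega>i\<^sup>2" using \<omega>pos[OF that(2)] by (intro power_strict_mono) auto
    moreover have "rg (x q) \<le> rg \<rho>"
      using rg_strict_antimono[OF \<rho>, of "x q"] x\<rho>[OF that(1)] by (cases "x q = \<rho>") auto
    ultimately have "(\<omega> p)\<^sup>2 * rg (x q) < \<omega>i\<^sup>2 * rg \<rho>"
      using rg_pos[OF xT[OF that(1)]] by (intro mult_less_le_imp_less) auto
    with 1 \<omega>i show False by simp
  qed
  \<comment> \<open>Rescaled to a \<open>J\<close> by \<open>J\<close> array with orthonormal rows;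
    being square, it has orthonormal columns as well.\<close>
  define d where "d q p = of_real (sqrt (rW (x q))) * D q p" for q p
  have d_on: "(\<Sum>p<J. cnj (d q p) * d q' p) = (if q = q' then 1 else 0)" if q: "q < J" "q' < J" for q q'
  proof -
    have "(\<Sum>p<J. cnj (D q p) * D q' p) = (\<Sum>p<r. cnj (D q p) * D q' p)"
      using J(2) D0[OF q(1)] by (intro sum.mono_neutral_left) auto
    then have g: "of_real (rW (x q)) * (\<Sum>p<J. cnj (D q p) * D q' p) = (if q = q' then 1 else 0)"
      using gram[OF q] by simp
    have W: "0 < rW (x q)" using rW_pos xT q by blast
    have eq: "(\<Sum>p<J. cnj (d q p) * d q' p) = of_real (sqrt (rW (x q)) * sqrt (rW (x q'))) * (\<Sum>p<J. cnj (D q p) * D q' p)"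
      unfolding d_def by (simp add: sum_distrib_left mult_ac)
    show ?thesis
    proof (cases "q = q'")
      case True
      then have "(\<Sum>p<J. cnj (d q p) * d q' p) = of_real (rW (x q)) * (\<Sum>p<J. cnj (D q p) * D q' p)"
        unfolding eq using W by simp
      then show ?thesis using g by simp
    next
      case False
      then have "(\<Sum>p<J. cnj (D q p) * D q' p) = 0" using g W by simp
      then show ?thesis unfolding eq using False by simp
    qed
  qed
  have d_compl: "(\<Sum>q<J. d q p * cnj (d q p')) = (if p = p' then 1 else 0)" if "p < J" "p' < J" for p p'
    by (rule orthonormal_square_complete[OF d_on that])
  \<comment> \<open>A column in \<open>G\<close> meets only rows with limit \<open>\<rho>\<close>;
    conversely, by \<open>dnG\<close>, such a row meets only columns in \<open>G\<close>.\<close>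
  have dG: "x q = \<rho>" if "q < J" "p \<in> G" "d q p \<noteq> 0" for q p
  proof -
    have p: "p < r" using that(2) GJ Jp by blast
    have "D q p \<noteq> 0" using that(3) unfolding d_def by auto
    then have "(\<omega> p)\<^sup>2 * rg (x q) = 1" using D3 that p by blast
    moreover have "\<omega> p = \<omega>i" using G(2) p that by blast
    ultimately have "rg (x q) = rg \<rho>" using \<omega>i by (metis mult_cancel_left mult_zero_left zero_neq_one)
    then show ?thesis using rg_inj xT that \<rho> by blast
  qed
  have dnG: "d q p = 0" if "q < J" "x q = \<rho>" "p < r" "p \<notin> G" for q p
  proof (rule ccontr)
    assume "d q p \<noteq> 0"
    then have "(\<omega> p)\<^sup>2 * rg \<rho> = 1" using D3[of p q] that unfolding d_def by auto
    then have "(\<omega> p)\<^sup>2 = \<omega>i\<^sup>2" using \<omega>i by (metis mult_cancel_right mult_zero_right zero_neq_one)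
    then have "\<omega> p = \<omega>i" using \<omega>i(1) \<omega>pos[OF that(3)] by (simp add: power2_eq_iff_nonneg)
    then show False using G(2) that by blast
  qed
  define Q where "Q = {q. q < J \<and> x q = \<rho>}"
  have QG: "Q = G"
  proof -
    \<comment> \<open>The squared moduli in the block of \<open>G\<close> columns and
      \<open>Q\<close> rows are summed in two ways, by unit columns and by unit rows.\<close>
    have "complex_of_real (card G) = (\<Sum>p\<in>G. \<Sum>q<J. d q p * cnj (d q p))"
      using d_compl GJ by (simp add: subset_iff)
    also have "\<dots> = (\<Sum>p\<in>G. \<Sum>q\<in>Q. d q p * cnj (d q p))"
      using dG by (intro sum.cong refl sum.mono_neutral_right) (auto simp: Q_def)
    also have "\<dots> = (\<Sum>q\<in>Q. \<Sum>p\<in>G. d q p * cnj (d q p))" by (rule sum.swap)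
    also have "\<dots> = (\<Sum>q\<in>Q. \<Sum>p<J. cnj (d q p) * d q p)"
    proof (rule sum.cong[OF refl])
      fix q assume q: "q \<in> Q"
      have "(\<Sum>p\<in>G. d q p * cnj (d q p)) = (\<Sum>p<J. d q p * cnj (d q p))"
        using GJ dnG q Jp by (intro sum.mono_neutral_left) (auto simp: Q_def)
      then show "(\<Sum>p\<in>G. d q p * cnj (d q p)) = (\<Sum>p<J. cnj (d q p) * d q p)" by (simp add: mult.commute)
    qed
    also have "\<dots> = complex_of_real (card Q)" using d_on by (simp add: Q_def)
    finally have "card Q = card G" by (simp only: of_real_eq_iff of_nat_eq_iff)
    \<comment> \<open>The limits \<open>x q\<close> do not increase with \<open>q\<close> and are at
      least \<open>\<rho>\<close>; once equal to \<open>\<rho>\<close> they stay so up to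
      \<open>J\<close>.\<close>
    have "Q = {J - card Q..<J}"
    proof (rule upset_lessThan_eq)
      fix q q' assume *: "q \<in> Q" "q \<le> q'" "q' < J"
      then show "q' \<in> Q" using x\<rho>[of q'] xmono[of q q'] unfolding Q_def by auto
    qed (auto simp: Q_def)
    also have "\<dots> = G" unfolding \<open>card Q = card G\<close> unfolding G(1) by auto
    finally show ?thesis .
  qed
  have xG: "x q = \<rho>" if "q \<in> G" for q using that unfolding QG[symmetric] Q_def by simp
  have \<beta>lim: "(\<lambda>n. ip n (\<beta> b n) (xi n q)) \<longlonglongrightarrow> of_real (rA \<rho> * (\<omega>i * (1 + rB \<rho>))) * (\<Sum>p\<in>G. z b p * D q p)"
    if q: "q \<in> G" for b q
  proof -
    have qJ: "q < J" using q GJ by blast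
    have "(\<lambda>n. ip n (\<beta> b n) (xi n q)) \<longlonglongrightarrow> of_real (rA (x q)) * (\<Sum>p<r. z b p * E q (False, p))"
      by (rule external_pair_limit[OF \<beta>b \<beta> E[OF qJ] lamx[OF qJ] xT[OF qJ] xi_form[OF qJ]])
    also have "(\<Sum>p<r. z b p * E q (False, p)) = (\<Sum>p\<in>G. z b p * E q (False, p))"
    proof (rule sum.mono_neutral_right)
      show "\<forall>p\<in>{..<r} - G. z b p * E q (False, p) = 0"
      proof
        fix p assume p: "p \<in> {..<r} - G"
        then have "d q p = 0" using dnG qJ xG[OF q] by auto
        then have "D q p = 0" using rW_pos[OF xT[OF qJ]] unfolding d_def by auto
        then show "z b p * E q (False, p) = 0" using D2[of p q] p qJ by simp
      qed
    qed (use GJ Jp in auto)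
    also have "\<dots> = (\<Sum>p\<in>G. of_real (\<omega>i * (1 + rB \<rho>)) * (z b p * D q p))"
    proof (rule sum.cong[OF refl])
      fix p assume p: "p \<in> G"
      then have "p < r" "\<omega> p = \<omega>i" using GJ Jp G(2) by blast+
      then show "z b p * E q (False, p) = of_real (\<omega>i * (1 + rB \<rho>)) * (z b p * D q p)"
        using D2[of p q] qJ xG[OF q] by simp
    qed
    finally show ?thesis using xG[OF q] by (simp add: sum_distrib_left mult_ac)
  qed
  define \<kappa> where "\<kappa> = rA \<rho> * (\<omega>i * (1 + rB \<rho>))"
  have W\<rho>: "0 < rW \<rho>" using rW_pos \<rho> by blast
  have "(\<lambda>n. \<Sum>q\<in>G. ip n (\<beta> True n) (xi n q) * cnj (ip n (\<beta> False n) (xi n q)))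
     \<longlonglongrightarrow> (\<Sum>q\<in>G. (of_real \<kappa> * (\<Sum>p\<in>G. z True p * D q p)) * cnj (of_real \<kappa> * (\<Sum>p\<in>G. z False p * D q p)))"
    unfolding \<kappa>_def by (intro tendsto_sum tendsto_mult tendsto_cnj \<beta>lim)
  also have "(\<Sum>q\<in>G. (of_real \<kappa> * (\<Sum>p\<in>G. z True p * D q p)) * cnj (of_real \<kappa> * (\<Sum>p\<in>G. z False p * D q p)))
     = (\<Sum>q\<in>G. of_real (\<kappa>\<^sup>2) * (\<Sum>p\<in>G. \<Sum>p'\<in>G. z True p * cnj (z False p') * (D q p * cnj (D q p'))))"
  proof (rule sum.cong[OF refl])
    fix q
    have "(\<Sum>p\<in>G. z True p * D q p) * cnj (\<Sum>p\<in>G. z False p * D q p)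
        = (\<Sum>p\<in>G. \<Sum>p'\<in>G. z True p * cnj (z False p') * (D q p * cnj (D q p')))"
      unfolding cnj_sum sum_product by (simp add: mult_ac)
    then show "(of_real \<kappa> * (\<Sum>p\<in>G. z True p * D q p)) * cnj (of_real \<kappa> * (\<Sum>p\<in>G. z False p * D q p))
        = of_real (\<kappa>\<^sup>2) * (\<Sum>p\<in>G. \<Sum>p'\<in>G. z True p * cnj (z False p') * (D q p * cnj (D q p')))"
      by (simp add: power2_eq_square mult_ac)
  qed
  also have "\<dots> = of_real (\<kappa>\<^sup>2) * (\<Sum>q\<in>G. \<Sum>p\<in>G. \<Sum>p'\<in>G. z True p * cnj (z False p') * (D q p * cnj (D q p')))"
    by (rule sum_distrib_left[symmetric])
  also have "(\<Sum>q\<in>G. \<Sum>p\<in>G. \<Sum>p'\<in>G. z True p * cnj (z False p') * (D q p * cnj (D q p')))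
     = (\<Sum>p\<in>G. \<Sum>p'\<in>G. \<Sum>q\<in>G. z True p * cnj (z False p') * (D q p * cnj (D q p')))"
    by (subst sum.swap, rule sum.cong[OF refl], rule sum.swap)
  also have "\<dots> = (\<Sum>p\<in>G. \<Sum>p'\<in>G. z True p * cnj (z False p') * (if p = p' then of_real (1 / rW \<rho>) else 0))"
  proof (intro sum.cong[OF refl])
    fix p p' assume p: "p \<in> G" "p' \<in> G"
    \<comment> \<open>Column orthonormality of \<open>d\<close>, where for columns in
      \<open>G\<close> only rows in \<open>G\<close> contribute; there \<open>d\<close> and
      \<open>D\<close> differ by the constant factor \<open>sqrt (rW \<rho>)\<close>.\<close>
    have "(\<Sum>q\<in>G. D q p * cnj (D q p')) = of_real (1 / rW \<rho>) * (\<Sum>q\<in>G. d q p * cnj (d q p'))"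
      unfolding sum_distrib_left
    proof (rule sum.cong[OF refl])
      fix q assume "q \<in> G"
      have "d q p * cnj (d q p') = of_real (sqrt (rW \<rho>) * sqrt (rW \<rho>)) * (D q p * cnj (D q p'))"
        unfolding d_def xG[OF \<open>q \<in> G\<close>] of_real_mult complex_cnj_mult complex_cnj_complex_of_real
        by (simp only: mult_ac)
      then show "D q p * cnj (D q p') = of_real (1 / rW \<rho>) * (d q p * cnj (d q p'))"
        using W\<rho> by simp
    qed
    also have "(\<Sum>q\<in>G. d q p * cnj (d q p')) = (\<Sum>q<J. d q p * cnj (d q p'))"
      using GJ dG p unfolding QG[symmetric] Q_def by (intro sum.mono_neutral_left) auto
    also have "\<dots> = (if p = p' then 1 else 0)" using d_compl GJ p by blast
    finally have "(\<Sum>q\<in>G. D q p * cnj (D q p')) = (if p = p' then of_real (1 / rW \<rho>) else 0)" by simp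
    then show "(\<Sum>q\<in>G. z True p * cnj (z False p') * (D q p * cnj (D q p')))
       = z True p * cnj (z False p') * (if p = p' then of_real (1 / rW \<rho>) else 0)"
      unfolding sum_distrib_left[symmetric] by (rule arg_cong)
  qed
  also have "\<dots> = of_real (1 / rW \<rho>) * (\<Sum>p\<in>G. z True p * cnj (z False p))"
    using GJ by (simp add: if_distrib sum.delta sum_distrib_left mult_ac cong: if_cong)
  also have "of_real (\<kappa>\<^sup>2) * (of_real (1 / rW \<rho>) * (\<Sum>p\<in>G. z True p * cnj (z False p)))
     = of_real (\<kappa>\<^sup>2 / rW \<rho>) * (\<Sum>p\<in>G. z True p * cnj (z False p))" by simp
  \<comment> \<open>The equation \<open>\<omega>i\<^sup>2 * rg \<rho> = 1\<close> removes
    \<open>\<omega>i\<close> from the constant.\<close>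
  also have "\<kappa>\<^sup>2 / rW \<rho> = (rA \<rho>)\<^sup>2 * (1 + rB \<rho>) / (rA \<rho> * rB2 \<rho> + rA2 \<rho> * (1 + rB \<rho>))"
  proof -
    have pos: "0 < rA \<rho>" "0 < 1 + rB \<rho>" "0 \<le> rB2 \<rho>" "0 < rA2 \<rho>"
      using rA_pos[OF \<rho>] rB_nonneg[OF \<rho>] rB2_nonneg[OF \<rho>] rA2_pos[OF \<rho>] by auto
    have "\<kappa>\<^sup>2 = (\<omega>i\<^sup>2 * rg \<rho>) * rg \<rho>"
      unfolding \<kappa>_def rg_def power2_eq_square by (simp only: mult_ac)
    then have "\<kappa>\<^sup>2 = rA \<rho> * (1 + rB \<rho>)" unfolding \<omega>i(2) by (simp add: rg_def)
    moreover have "rW \<rho> = (rA2 \<rho> * (1 + rB \<rho>) + rA \<rho> * rB2 \<rho>) / rA \<rho>"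
    proof -
      have "a2 * h\<^sup>2 / (a * h) + b2 = (a2 * h + a * b2) / a" if "a \<noteq> 0" "h \<noteq> 0" for a h a2 b2 :: real
        using that by (simp add: field_simps power2_eq_square)
      from this[of "rA \<rho>" "1 + rB \<rho>" "rA2 \<rho>" "rB2 \<rho>"] show ?thesis
        unfolding rW_def rg_def using pos by simp
    qed
    ultimately show ?thesis using pos by (simp add: power2_eq_square add.commute mult_ac)
  qed
  finally show ?thesis by (simp add: cnj_ip)
qed

end

section \<open>Compactness and passage to subsequences\<close>

context spiked
begin

text \<open>\<open>tvec\<close> is linear in \<open>cc\<close>, so orthogonality to the first
  \<open>J - 1\<close> eigenvectors amounts to \<open>J - 1\<close> linear conditions on
  \<open>J\<close> unknowns.\<close>

lemma tvec_null_vector: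
  assumes "0 < J" "J \<le> r"
  shows "\<exists>cc. (\<Sum>p<J. (cmod (cc p))\<^sup>2) = 1 \<and> (\<forall>q<J - 1. ip n (xi n q) (tvec \<rho> J cc n) = 0)"
proof -
  define M where "M q p = (\<Sum>k<N n. cnj (xi n q k) * (of_real (1 / (\<rho> - t n k)) *
     (src (False, p) n k + of_real (\<omega> p * rA \<rho>) * src (True, p) n k)))" for q p
  have tv: "tvec \<rho> J cc n k = (\<Sum>p<J. cc p * (of_real (1 / (\<rho> - t n k)) *
     (src (False, p) n k + of_real (\<omega> p * rA \<rho>) * src (True, p) n k)))" for cc k
  proof -
    have "(\<Sum>i\<in>Ix. tcoef \<rho> J cc i * src i n k)
      = (\<Sum>p<J. cc p * (src (False, p) n k + of_real (\<omega> p * rA \<rho>) * src (True, p) n k))"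
      unfolding sum_Ix tcoef_def using assms(2)
      by (intro sum.mono_neutral_cong_right) (auto simp: algebra_simps)
    then show ?thesis unfolding tvec_def by (simp add: sum_distrib_left mult_ac)
  qed
  have "ip n (xi n q) (tvec \<rho> J cc n) = (\<Sum>p<J. cc p * M q p)" for cc q
  proof -
    have "ip n (xi n q) (tvec \<rho> J cc n) = (\<Sum>k<N n. \<Sum>p<J. cc p * (cnj (xi n q k) * (of_real (1 / (\<rho> - t n k)) *
     (src (False, p) n k + of_real (\<omega> p * rA \<rho>) * src (True, p) n k))))"
      unfolding ip_def tv sum_distrib_left by (simp only: mult.left_commute)
    also have "\<dots> = (\<Sum>p<J. cc p * M q p)" unfolding M_def sum_distrib_left by (rule sum.swap)
    finally show ?thesis .
  qed
  then show ?thesis using underdetermined_null_vector[OF assms(1), of M] by simp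
qed

text \<open>Unit vectors paired with sources of bounded energy give bounded coefficients, and an
  eigenvalue is the Rayleigh quotient of its eigenvector, hence bounded by the same
  quantities.\<close>

lemma coef_lam_bounded:
  assumes eig: "\<forall>\<^sub>F n in sequentially. \<forall>q<N n. \<forall>k<N n. gram_op n (xi n q) k = of_real (lam n q) * xi n q k"
  shows "\<exists>C. \<forall>\<^sub>F n in sequentially. \<forall>q<N n. \<bar>lam n q\<bar> \<le> C \<and> (\<forall>i\<in>Ix. cmod (coef n (xi n q) i) \<le> C)"
proof -
  obtain C where "\<forall>i\<in>Ix. \<forall>\<^sub>F n in sequentially. (\<Sum>k<N n. (cmod (src i n k))\<^sup>2) \<le> C" using src_bound by blast
  then have C: "\<forall>\<^sub>F n in sequentially. \<forall>i\<in>Ix. (\<Sum>k<N n. (cmod (src i n k))\<^sup>2) \<le> C"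
    by (intro eventually_ball_finite) auto
  \<comment> \<open>\<open>D\<close> bounds a source against a unit vector, \<open>Om\<close> bounds
    all \<open>om n p\<close>, and \<open>K\<close> below dominates the coefficients at
    \<open>False\<close> and at \<open>True\<close>.\<close>
  define D where "D = (\<bar>C\<bar> + 1) / 2"
  define Om where "Om = (\<Sum>p<r. \<bar>\<omega> p\<bar>) + 1"
  have Om: "\<forall>\<^sub>F n in sequentially. \<forall>p\<in>{..<r}. \<bar>om n p\<bar> \<le> Om"
  proof (intro eventually_ball_finite ballI)
    fix p assume "p \<in> {..<r}"
    then have "(\<lambda>n. \<bar>om n p\<bar>) \<longlonglongrightarrow> \<bar>\<omega> p\<bar>" by (intro tendsto_rabs om) simp
    moreover have "\<bar>\<omega> p\<bar> < Om" unfolding Om_def using \<open>p \<in> {..<r}\<close>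
      by (smt (verit) abs_ge_zero finite_lessThan member_le_sum)
    ultimately have "\<forall>\<^sub>F n in sequentially. \<bar>om n p\<bar> < Om" by (rule order_tendstoD)
    then show "\<forall>\<^sub>F n in sequentially. \<bar>om n p\<bar> \<le> Om" by eventually_elim simp
  qed simp
  have Om1: "1 \<le> Om" "0 \<le> D" unfolding Om_def D_def by (auto intro!: sum_nonneg)
  define K where "K = Om * (D + Om * D)"
  have K0: "Om * D \<le> K" "0 \<le> K" unfolding K_def using Om1 mult_left_mono[of D "Om * D" Om]
    by (auto simp: distrib_left mult_le_cancel_left1 intro!: add_nonneg_nonneg mult_nonneg_nonneg)
  have "\<forall>\<^sub>F n in sequentially. \<forall>q<N n. \<bar>lam n q\<bar> \<le> K + (T + (\<Sum>i\<in>Ix. K * D)) \<and>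
     (\<forall>i\<in>Ix. cmod (coef n (xi n q) i) \<le> K + (T + (\<Sum>i\<in>Ix. K * D)))"
    using C Om xi_orth tin eig
  proof (eventually_elim, intro allI impI)
    fix n q
    assume C: "\<forall>i\<in>Ix. (\<Sum>k<N n. (cmod (src i n k))\<^sup>2) \<le> C" and Om: "\<forall>p\<in>{..<r}. \<bar>om n p\<bar> \<le> Om"
      and on: "\<forall>q<N n. \<forall>q'<N n. (\<Sum>k<N n. cnj (xi n q k) * xi n q' k) = (if q = q' then 1 else 0)"
      and ti: "\<forall>k<N n. t n k \<in> {0..T}" and q: "q < N n"
      and eig: "\<forall>q<N n. \<forall>k<N n. gram_op n (xi n q) k = of_real (lam n q) * xi n q k"
    have x1: "(\<Sum>k<N n. (cmod (xi n q k))\<^sup>2) = 1" by (rule sum_cmod_square_eq_1) (use on q in simp)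
    have s: "cmod (ip n (src i n) (xi n q)) \<le> D" if "i \<in> Ix" for i
    proof -
      have "cmod (ip n (src i n) (xi n q)) \<le> (\<Sum>k<N n. cmod (cnj (src i n k) * xi n q k))"
        unfolding ip_def by (rule norm_sum)
      also have "\<dots> \<le> (C + 1) / 2" using C that x1 by (intro weighted_cauchy_schwarz) auto
      finally show ?thesis unfolding D_def by simp
    qed
    have cK: "cmod (coef n (xi n q) i) \<le> K" if i: "i \<in> Ix" for i
    proof -
      obtain b p where bp: "i = (b, p)" "p < r" using i by auto
      have o: "\<bar>om n p\<bar> \<le> Om" using Om bp by simp
      have d: "cmod (of_real (om n p) * ip n (src (False, p) n) (xi n q)) \<le> Om * D"
        unfolding norm_mult norm_of_real using o s[of "(False, p)"] bp Om1 by (intro mult_mono) auto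
      have "cmod (of_real (om n p) * (ip n (src (True, p) n) (xi n q) + of_real (om n p) * ip n (src (False, p) n) (xi n q)))
         \<le> Om * (D + Om * D)"
        unfolding norm_mult norm_of_real
        using o s[of "(True, p)"] bp Om1 d
        by (intro mult_mono order_trans[OF norm_triangle_ineq] add_mono) auto
      then show ?thesis using d K0 by (auto simp: coef_def Let_def bp(1) K_def)
    qed
    have "of_real (lam n q) = ip n (xi n q) (gram_op n (xi n q))"
    proof -
      have "ip n (xi n q) (gram_op n (xi n q)) = of_real (lam n q) * (\<Sum>k<N n. cnj (xi n q k) * xi n q k)"
        unfolding ip_def sum_distrib_left using eig q by (intro sum.cong refl) (simp add: mult_ac)
      then show ?thesis using on q by simp
    qed
    also have "\<dots> = (\<Sum>k<N n. of_real (t n k * (cmod (xi n q k))\<^sup>2))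
       + (\<Sum>i\<in>Ix. coef n (xi n q) i * cnj (ip n (src i n) (xi n q)))"
    proof -
      have "ip n (xi n q) (gram_op n (xi n q)) = (\<Sum>k<N n. of_real (t n k) * (cnj (xi n q k) * xi n q k))
        + (\<Sum>k<N n. \<Sum>i\<in>Ix. coef n (xi n q) i * (cnj (xi n q k) * src i n k))"
        unfolding ip_def gram_op_def distrib_left sum.distrib sum_distrib_left by (simp add: mult_ac)
      also have "(\<Sum>k<N n. \<Sum>i\<in>Ix. coef n (xi n q) i * (cnj (xi n q k) * src i n k))
        = (\<Sum>i\<in>Ix. coef n (xi n q) i * cnj (ip n (src i n) (xi n q)))"
        unfolding cnj_ip unfolding ip_def sum_distrib_left by (rule sum.swap)
      finally show ?thesis by (simp add: cnj_mult_cmod)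
    qed
    finally have "complex_of_real (lam n q) = (\<Sum>k<N n. of_real (t n k * (cmod (xi n q k))\<^sup>2))
       + (\<Sum>i\<in>Ix. coef n (xi n q) i * cnj (ip n (src i n) (xi n q)))" .
    then have "cmod (complex_of_real (lam n q)) \<le> cmod (\<Sum>k<N n. complex_of_real (t n k * (cmod (xi n q k))\<^sup>2))
       + cmod (\<Sum>i\<in>Ix. coef n (xi n q) i * cnj (ip n (src i n) (xi n q)))"
      by (rule ssubst) (rule norm_triangle_ineq)
    also have "cmod (\<Sum>k<N n. complex_of_real (t n k * (cmod (xi n q k))\<^sup>2)) \<le> (\<Sum>k<N n. T * (cmod (xi n q k))\<^sup>2)"
    proof (rule sum_norm_le)
      fix k assume "k \<in> {..<N n}"
      then have "0 \<le> t n k" "t n k \<le> T" using ti by auto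
      then show "cmod (complex_of_real (t n k * (cmod (xi n q k))\<^sup>2)) \<le> T * (cmod (xi n q k))\<^sup>2"
        unfolding norm_of_real by (simp add: mult_right_mono)
    qed
    also have "\<dots> = T" unfolding sum_distrib_left[symmetric] x1 by simp
    also have "cmod (\<Sum>i\<in>Ix. coef n (xi n q) i * cnj (ip n (src i n) (xi n q))) \<le> (\<Sum>i\<in>Ix. K * D)"
    proof (rule sum_norm_le)
      fix i assume "i \<in> Ix"
      then show "cmod (coef n (xi n q) i * cnj (ip n (src i n) (xi n q))) \<le> K * D"
        unfolding norm_mult complex_mod_cnj using cK s K0 by (intro mult_mono) auto
    qed
    finally have "\<bar>lam n q\<bar> \<le> T + (\<Sum>i\<in>Ix. K * D)" by (simp only: norm_of_real add_left_mono)
    moreover have "0 \<le> T + (\<Sum>i\<in>Ix. K * D)" using T K0 Om1 by (intro add_nonneg_nonneg sum_nonneg) auto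
    ultimately show "\<bar>lam n q\<bar> \<le> K + (T + (\<Sum>i\<in>Ix. K * D)) \<and>
      (\<forall>i\<in>Ix. cmod (coef n (xi n q) i) \<le> K + (T + (\<Sum>i\<in>Ix. K * D)))"
      using cK K0 by fastforce
  qed
  then show ?thesis by blast
qed

text \<open>The overlaps \<open>z\<close> stay bounded but may oscillate with \<open>n\<close>,
  hence the form of a difference. Every subsequence has a further one along which both terms
  converge to the same limit.\<close>

lemma eigenprojection_asymptotics:
  assumes \<rho>: "T < \<rho>" and \<omega>i: "0 < \<omega>i" "\<omega>i\<^sup>2 * rg \<rho> = 1"
    and \<omega>pos: "\<And>p. p < r \<Longrightarrow> 0 < \<omega> p"
    and J: "0 < J" "J \<le> r" "\<And>p. p < r \<Longrightarrow> p < J \<longleftrightarrow> \<omega>i \<le> \<omega> p"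
    and G: "G = {m..<J}" "\<And>p. p < r \<Longrightarrow> p \<in> G \<longleftrightarrow> \<omega> p = \<omega>i"
    and eig: "\<forall>\<^sub>F n in sequentially. \<forall>q<N n. \<forall>k<N n. gram_op n (xi n q) k = of_real (lam n q) * xi n q k"
    and \<beta>b: "\<And>b. \<exists>C. \<forall>\<^sub>F n in sequentially. (\<Sum>k<N n. (cmod (\<beta> b n k))\<^sup>2) \<le> C"
    and zb: "\<And>b p. p < r \<Longrightarrow> \<exists>C. \<forall>\<^sub>F n in sequentially. cmod (z b n p) \<le> C"
    and \<beta>: "\<And>b i f. i \<in> Ix \<Longrightarrow> f \<in> borel_measurable borel \<Longrightarrow> continuous_on {0..T} f \<Longrightarrow>
        (\<lambda>n. (\<Sum>k<N n. of_real (f (t n k)) * (cnj (\<beta> b n k) * src i n k))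
          - (if fst i then 0 else z b n (snd i) * of_real (ilaw False f))) \<longlonglongrightarrow> 0"
  shows "(\<lambda>n. (\<Sum>q\<in>G. ip n (\<beta> True n) (xi n q) * ip n (xi n q) (\<beta> False n))
    - of_real ((rA \<rho>)\<^sup>2 * (1 + rB \<rho>) / (rA \<rho> * rB2 \<rho> + rA2 \<rho> * (1 + rB \<rho>)))
        * (\<Sum>p\<in>G. z True n p * cnj (z False n p))) \<longlonglongrightarrow> 0" (is "?F \<longlonglongrightarrow> 0")
proof (rule tendsto_zero_if_subseq_tendsto_zero)
  fix \<sigma> :: "nat \<Rightarrow> nat" assume \<sigma>: "strict_mono \<sigma>"
  \<comment> \<open>Test coefficients are fixed for every \<open>n\<close> before any extraction, so
    that they can be made to converge together with the rest.\<close>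
  have "\<forall>n. \<exists>cc. (\<Sum>p<J. (cmod (cc p))\<^sup>2) = 1 \<and> (\<forall>q<J - 1. ip n (xi n q) (tvec \<rho> J cc n) = 0)"
    using tvec_null_vector[OF J(1,2)] by blast
  then obtain cc where cc: "\<And>n. (\<Sum>p<J. (cmod (cc n p))\<^sup>2) = 1"
      "\<And>n q. q < J - 1 \<Longrightarrow> ip n (xi n q) (tvec \<rho> J (cc n) n) = 0" by metis
  \<comment> \<open>One finite family for the whole extraction: the tag \<open>a\<close> selects
    eigenvalues, eigenvector coefficients, test coefficients or overlaps. Components that a tag does
    not read are padding.\<close>
  define f :: "nat \<times> nat \<times> bool \<times> nat \<Rightarrow> nat \<Rightarrow> complex" where
    "f = (\<lambda>(a, q, i) n. if a = 0 then of_real (lam n q) else if a = 1 then coef n (xi n q) i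
       else if a = 2 then (if q < J then cc n q else 0) else z (fst i) n q)"
  define X where "X = {..<4::nat} \<times> {..<r} \<times> Ix"
  obtain C where C: "\<forall>\<^sub>F n in sequentially. \<forall>q<N n. \<bar>lam n q\<bar> \<le> C \<and> (\<forall>i\<in>Ix. cmod (coef n (xi n q) i) \<le> C)"
    using coef_lam_bounded[OF eig] by blast
  have "\<exists>\<tau>::nat \<Rightarrow> nat. \<exists>l. strict_mono \<tau> \<and> (\<forall>x\<in>X. (\<lambda>n. f x (\<sigma> (\<tau> n))) \<longlonglongrightarrow> l x)"
  proof (rule finite_family_convergent_subseq[where f = "\<lambda>x n. f x (\<sigma> n)"])
    show "finite X" unfolding X_def by simp
    fix x assume "x \<in> X"
    then obtain a q i where x: "x = (a, q, i)" "a < 4" "q < r" "i \<in> Ix" unfolding X_def by auto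
    consider "a = 0" | "a = 1" | "a = 2" | "a = 3" using x(2) by linarith
    then have "\<exists>C. \<forall>\<^sub>F n in sequentially. cmod (f x n) \<le> C"
    proof cases
      case 1
      have "\<forall>\<^sub>F n in sequentially. cmod (f x n) \<le> C"
        using C N_large by eventually_elim (use 1 x in \<open>auto simp: f_def\<close>)
      then show ?thesis by blast
    next
      case 2
      have "\<forall>\<^sub>F n in sequentially. cmod (f x n) \<le> C"
        using C N_large
      proof eventually_elim
        case (elim n)
        then have "q < N n" using x by simp
        then have "cmod (coef n (xi n q) i) \<le> C" using elim x by blast
        then show ?case using 2 x by (simp add: f_def)
      qed
      then show ?thesis by blast
    next
      case 3
      have "cmod (f x n) \<le> 1" for n
      proof (cases "q < J")
        case True
        have "(cmod (cc n q))\<^sup>2 \<le> 1" unfolding cc(1)[of n, symmetric] using True by (intro member_le_sum) auto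
        then show ?thesis using 3 x True by (simp add: f_def power2_le_imp_le abs_square_le_1)
      qed (use 3 x in \<open>simp add: f_def\<close>)
      then show ?thesis by (intro exI[of _ 1] always_eventually) blast
    next
      case 4
      then show ?thesis using zb[OF x(3), of "fst i"] x by (simp add: f_def)
    qed
    then obtain C where "\<forall>\<^sub>F n in sequentially. cmod (f x n) \<le> C" by blast
    from eventually_subseq[OF \<sigma> this] show "\<exists>C. \<forall>\<^sub>F n in sequentially. cmod (f x (\<sigma> n)) \<le> C" by blast
  qed
  then obtain \<tau> :: "nat \<Rightarrow> nat" and l where \<tau>: "strict_mono \<tau>"
    and l: "\<And>x. x \<in> X \<Longrightarrow> (\<lambda>n. f x (\<sigma> (\<tau> n))) \<longlonglongrightarrow> l x" by blast
  define s where "s = \<sigma> \<circ> \<tau>"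
  have s: "strict_mono s" unfolding s_def using \<sigma> \<tau> by (rule strict_mono_o)
  have l': "(\<lambda>n. f x (s n)) \<longlonglongrightarrow> l x" if "x \<in> X" for x using l[OF that] by (simp add: s_def)
  note ev = eventually_subseq[OF s]
  have lim: "h \<longlonglongrightarrow> L \<Longrightarrow> (\<lambda>n. h (s n)) \<longlonglongrightarrow> L" for h :: "nat \<Rightarrow> 'x::topological_space" and L
    using LIMSEQ_subseq_LIMSEQ[OF _ s] by (simp add: o_def)
  \<comment> \<open>The assumptions of the locale pass to subsequences, so its limit lemma is
    available along \<open>s\<close>.\<close>
  interpret S: spiked \<pi> c T "\<lambda>n. N (s n)" "\<lambda>n. t (s n)" r "\<lambda>i n. src i (s n)" "\<lambda>n. om (s n)" \<omega>
      "\<lambda>n. lam (s n)" "\<lambda>n. xi (s n)"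
  proof (unfold_locales, goal_cases)
    case 1 show ?case using ev[OF tin] .
  next
    case 2 show ?case using src_bound ev by meson
  next
    case (3 i j f) then show ?case using lim[OF src_lim[OF 3]] by simp
  next
    case (4 p) then show ?case using lim[OF om[OF 4]] by simp
  next
    case 5 show ?case using ev[OF xi_orth] .
  next
    case 6 show ?case using ev[OF lam_mono] .
  next
    case 7 show ?case using ev[OF N_large] .
  qed
  have ip: "S.ip n = ip (s n)" for n by (intro ext) (simp add: ip_def S.ip_def)
  have coef: "S.coef n = coef (s n)" for n by (intro ext) (simp add: coef_def S.coef_def ip Let_def)
  have gram: "S.gram_op n = gram_op (s n)" for n by (intro ext) (simp add: gram_op_def S.gram_op_def coef)
  have tvec: "S.tvec \<rho> J h n = tvec \<rho> J h (s n)" for h n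
    by (intro ext) (simp add: tvec_def S.tvec_def tcoef_def S.tcoef_def)
  have i0: "(True, 0) \<in> Ix" using J by simp
  have zl: "(\<lambda>n. z b (s n) p) \<longlonglongrightarrow> l (3, p, (b, 0))" if "p < r" for b p
    using l'[of "(3, p, (b, 0))"] that J by (simp add: X_def f_def)
  have main: "(\<lambda>n. \<Sum>q\<in>G. S.ip n (\<beta> True (s n)) (xi (s n) q) * S.ip n (xi (s n) q) (\<beta> False (s n)))
    \<longlonglongrightarrow> of_real ((rA \<rho>)\<^sup>2 * (1 + rB \<rho>) / (rA \<rho> * rB2 \<rho> + rA2 \<rho> * (1 + rB \<rho>)))
        * (\<Sum>p\<in>G. l (3, p, (True, 0)) * cnj (l (3, p, (False, 0))))"
  proof (rule S.eigenprojection_limit[OF \<rho> \<omega>i \<omega>pos J G, where x = "\<lambda>q. Re (l (0, q, (True, 0)))"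
        and E = "\<lambda>q i. l (1, q, i)" and cc = "\<lambda>n. cc (s n)" and cl = "\<lambda>p. l (2, p, (True, 0))"
        and z = "\<lambda>b p. l (3, p, (b, 0))" and \<beta> = "\<lambda>b n. \<beta> b (s n)"])
    show "\<forall>\<^sub>F n in sequentially. \<forall>q<N (s n). \<forall>k<N (s n). S.gram_op n (xi (s n) q) k = of_real (lam (s n) q) * xi (s n) q k"
      unfolding gram by (rule ev[OF eig])
    show "(\<lambda>n. lam (s n) q) \<longlonglongrightarrow> Re (l (0, q, (True, 0)))" if "q < J" for q
      using tendsto_Re[OF l'[of "(0, q, (True, 0))"]] that J by (simp add: X_def f_def)
    show "(\<lambda>n. S.coef n (xi (s n) q) i) \<longlonglongrightarrow> l (1, q, i)" if "q < J" "i \<in> Ix" for q i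
      using l'[of "(1, q, i)"] that J by (simp add: X_def f_def coef)
    show "(\<Sum>p<J. (cmod (cc (s n) p))\<^sup>2) = 1" for n by (rule cc)
    show "S.ip n (xi (s n) q) (S.tvec \<rho> J (cc (s n)) n) = 0" if "q < J - 1" for n q
      unfolding ip tvec by (rule cc(2)[OF that])
    show "(\<lambda>n. cc (s n) p) \<longlonglongrightarrow> l (2, p, (True, 0))" if "p < J" for p
      using l'[of "(2, p, (True, 0))"] that J by (simp add: X_def f_def)
    show "\<exists>C. \<forall>\<^sub>F n in sequentially. (\<Sum>k<N (s n). (cmod (\<beta> b (s n) k))\<^sup>2) \<le> C" for b
      using \<beta>b[of b] ev by blast
    show "(\<lambda>n. \<Sum>k<N (s n). of_real (f (t (s n) k)) * (cnj (\<beta> b (s n) k) * src i (s n) k))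
          \<longlonglongrightarrow> (if fst i then 0 else l (3, snd i, (b, 0)) * of_real (ilaw False f))"
      if "i \<in> Ix" "f \<in> borel_measurable borel" "continuous_on {0..T} f" for b i f
    proof -
      have "(\<lambda>n. (if fst i then 0 else z b (s n) (snd i) * of_real (ilaw False f)))
         \<longlonglongrightarrow> (if fst i then 0 else l (3, snd i, (b, 0)) * of_real (ilaw False f))"
        using that(1) zl[of "snd i" b] by (auto intro!: tendsto_intros)
      from tendsto_add[OF lim[OF \<beta>[OF that, of b]] this] show ?thesis by simp
    qed
  qed
  have "(\<lambda>n. of_real ((rA \<rho>)\<^sup>2 * (1 + rB \<rho>) / (rA \<rho> * rB2 \<rho> + rA2 \<rho> * (1 + rB \<rho>)))
        * (\<Sum>p\<in>G. z True (s n) p * cnj (z False (s n) p)))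
     \<longlonglongrightarrow> of_real ((rA \<rho>)\<^sup>2 * (1 + rB \<rho>) / (rA \<rho> * rB2 \<rho> + rA2 \<rho> * (1 + rB \<rho>)))
        * (\<Sum>p\<in>G. l (3, p, (True, 0)) * cnj (l (3, p, (False, 0))))"
    using G(1) J(2) by (intro tendsto_mult tendsto_const tendsto_sum tendsto_cnj zl) auto
  from tendsto_diff[OF main this] have "(\<lambda>n. ?F (s n)) \<longlonglongrightarrow> 0" by (simp add: ip)
  then show "\<exists>\<tau>. strict_mono (\<tau>::nat \<Rightarrow> nat) \<and> (\<lambda>n. ?F (\<sigma> (\<tau> n))) \<longlonglongrightarrow> 0"
    using \<tau> by (auto simp: s_def)
qed

end

section \<open>Random signs\<close>

text \<open>A sign vector is encoded by the set of its negative entries. Expectations become sums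
  over \<open>Pow {..<n}\<close>, left unnormalised, which accounts for the factors
  \<open>2 ^ n\<close> below.\<close>

definition eps :: "nat set \<Rightarrow> nat \<Rightarrow> real" where
  "eps A a = (if a \<in> A then - 1 else 1)"

text \<open>Conditioning on the last sign.\<close>

lemma sum_Pow_Suc:
  "(\<Sum>A\<in>Pow {..<Suc n}. F A) = (\<Sum>A\<in>Pow {..<n}. F A + F (insert n A))" for F :: "nat set \<Rightarrow> real"
proof -
  have "Pow {..<Suc n} = Pow {..<n} \<union> insert n ` Pow {..<n}" by (simp add: lessThan_Suc Pow_insert)
  moreover have "Pow {..<n} \<inter> insert n ` Pow {..<n} = {}" by auto
  moreover have "inj_on (insert n) (Pow {..<n})"
    by (rule inj_onI) (metis PowD insert_ident lessThan_iff less_irrefl subsetD)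
  ultimately show ?thesis
    by (simp add: sum.union_disjoint sum.reindex sum.distrib del: Pow_insert)
qed

lemma eps_Pow:
  assumes "A \<in> Pow {..<n}"
  shows "a < n \<Longrightarrow> eps (insert n A) a = eps A a" "eps A n = 1" "eps (insert n A) n = - 1"
proof -
  have "n \<notin> A" using assms by blast
  then show "a < n \<Longrightarrow> eps (insert n A) a = eps A a" "eps A n = 1" "eps (insert n A) n = - 1"
    by (simp_all add: eps_def)
qed

text \<open>Khinchin's inequality for the fourth moment. A new sign replaces the linear form
  \<open>l\<close> by \<open>l + x\<close> and \<open>l - x\<close>; in the sum of their even powers
  the odd terms cancel.\<close>

lemma sign_sum_moments:
  fixes x :: "nat \<Rightarrow> real"
  shows "(\<Sum>A\<in>Pow {..<n}. (\<Sum>a<n. x a * eps A a)\<^sup>2) = 2 ^ n * (\<Sum>a<n. (x a)\<^sup>2)"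
    and "(\<Sum>A\<in>Pow {..<n}. (\<Sum>a<n. x a * eps A a) ^ 4) \<le> 3 * 2 ^ n * (\<Sum>a<n. (x a)\<^sup>2)\<^sup>2"
proof (induction n)
  case 0
  { case 1 show ?case by simp next case 2 show ?case by simp }
next
  case (Suc n)
  define l where "l A = (\<Sum>a<n. x a * eps A a)" for A
  have l: "(\<Sum>a<Suc n. x a * eps A a) = l A + x n" "(\<Sum>a<Suc n. x a * eps (insert n A) a) = l A - x n"
    if "A \<in> Pow {..<n}" for A
    using eps_Pow[OF that] by (simp_all add: l_def)
  have c: "(\<Sum>A\<in>Pow {..<n}. k) = 2 ^ n * k" for k :: real by (simp add: card_Pow)
  {
    case 1
    have "(\<Sum>A\<in>Pow {..<Suc n}. (\<Sum>a<Suc n. x a * eps A a)\<^sup>2) = (\<Sum>A\<in>Pow {..<n}. 2 * (l A)\<^sup>2 + 2 * (x n)\<^sup>2)"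
      unfolding sum_Pow_Suc
      by (intro sum.cong refl, subst l(1), assumption, subst l(2), assumption)
        (simp add: power2_eq_square algebra_simps)
    also have "\<dots> = 2 ^ Suc n * (\<Sum>a<Suc n. (x a)\<^sup>2)"
      using Suc.IH(1) unfolding sum.distrib c by (simp add: l_def sum_distrib_left[symmetric] algebra_simps)
    finally show ?case .
  next
    case 2
    define s where "s = (\<Sum>a<n. (x a)\<^sup>2)"
    have "(\<Sum>A\<in>Pow {..<Suc n}. (\<Sum>a<Suc n. x a * eps A a) ^ 4)
        = (\<Sum>A\<in>Pow {..<n}. 2 * (l A) ^ 4 + 12 * (x n)\<^sup>2 * (l A)\<^sup>2 + 2 * (x n) ^ 4)"
      unfolding sum_Pow_Suc
      by (intro sum.cong refl, subst l(1), assumption, subst l(2), assumption)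
        (simp add: power2_eq_square power4_eq_xxxx algebra_simps)
    also have "\<dots> = 2 * (\<Sum>A\<in>Pow {..<n}. (l A) ^ 4) + 12 * (x n)\<^sup>2 * (\<Sum>A\<in>Pow {..<n}. (l A)\<^sup>2) + 2 ^ n * (2 * (x n) ^ 4)"
      unfolding sum.distrib sum_distrib_left[symmetric] c by (simp only: mult_ac)
    also have "\<dots> \<le> 2 * (3 * 2 ^ n * s\<^sup>2) + 12 * (x n)\<^sup>2 * (2 ^ n * s) + 2 ^ n * (2 * (x n) ^ 4)"
      using Suc.IH by (simp add: l_def s_def)
    also have "\<dots> \<le> 3 * 2 ^ Suc n * (s + (x n)\<^sup>2)\<^sup>2"
    proof -
      have "3 * 2 ^ Suc n * (s + (x n)\<^sup>2)\<^sup>2 - (2 * (3 * 2 ^ n * s\<^sup>2) + 12 * (x n)\<^sup>2 * (2 ^ n * s) + 2 ^ n * (2 * (x n) ^ 4))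
        = 2 ^ n * (4 * x n ^ 4)"
        by (simp add: power2_eq_square power4_eq_xxxx algebra_simps)
      moreover have "0 \<le> 2 ^ n * (4 * x n ^ 4)" by simp
      ultimately show ?thesis by linarith
    qed
    finally show ?case by (simp add: s_def)
  }
qed

text \<open>The last sign multiplies a linear form \<open>l\<close>, so the chaos turns into
  \<open>Q + l\<close> and \<open>Q - l\<close>, and the mixed moment is split by Cauchy-Schwarz.
  The constant 27 is the least \<open>C\<close> for which this induction closes: the cross term
  requires \<open>12 * sqrt (3 * C) \<le> 4 * C\<close>.\<close>

lemma sign_chaos_fourth_moment:
  fixes C :: "nat \<Rightarrow> nat \<Rightarrow> real"
  shows "(\<Sum>A\<in>Pow {..<n}. (\<Sum>a<n. \<Sum>b<a. C a b * eps A a * eps A b) ^ 4)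
     \<le> 27 * 2 ^ n * (\<Sum>a<n. \<Sum>b<a. (C a b)\<^sup>2)\<^sup>2"
proof (induction n)
  case (Suc n)
  define Q where "Q A = (\<Sum>a<n. \<Sum>b<a. C a b * eps A a * eps A b)" for A
  define l where "l A = (\<Sum>b<n. C n b * eps A b)" for A
  define s where "s = (\<Sum>a<n. \<Sum>b<a. (C a b)\<^sup>2)"
  define t where "t = (\<Sum>b<n. (C n b)\<^sup>2)"
  have st: "0 \<le> s" "0 \<le> t" unfolding s_def t_def by (auto intro!: sum_nonneg)
  have Q1: "(\<Sum>a<Suc n. \<Sum>b<a. C a b * eps A a * eps A b) = Q A + l A" if "A \<in> Pow {..<n}" for A
    using eps_Pow[OF that] by (simp add: Q_def l_def)
  have Q2: "(\<Sum>a<Suc n. \<Sum>b<a. C a b * eps (insert n A) a * eps (insert n A) b) = Q A - l A" if "A \<in> Pow {..<n}" for A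
    using eps_Pow[OF that] by (simp add: Q_def l_def sum_negf)
  have l4: "(\<Sum>A\<in>Pow {..<n}. (l A) ^ 4) \<le> 3 * 2 ^ n * t\<^sup>2"
    unfolding l_def t_def by (rule sign_sum_moments)
  have Q4: "(\<Sum>A\<in>Pow {..<n}. (Q A) ^ 4) \<le> 27 * 2 ^ n * s\<^sup>2"
    using Suc.IH unfolding Q_def s_def .
  have "(\<Sum>A\<in>Pow {..<n}. (Q A)\<^sup>2 * (l A)\<^sup>2)\<^sup>2 \<le> (\<Sum>A\<in>Pow {..<n}. ((Q A)\<^sup>2)\<^sup>2) * (\<Sum>A\<in>Pow {..<n}. ((l A)\<^sup>2)\<^sup>2)"
    by (rule Cauchy_Schwarz_ineq_sum)
  also have "\<dots> = (\<Sum>A\<in>Pow {..<n}. (Q A) ^ 4) * (\<Sum>A\<in>Pow {..<n}. (l A) ^ 4)"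
    by (simp add: power_mult[symmetric])
  also have "\<dots> \<le> (27 * 2 ^ n * s\<^sup>2) * (3 * 2 ^ n * t\<^sup>2)"
    by (intro mult_mono Q4 l4 sum_nonneg) auto
  also have "\<dots> = (9 * 2 ^ n * s * t)\<^sup>2" by (simp add: power2_eq_square)
  finally have Ql: "(\<Sum>A\<in>Pow {..<n}. (Q A)\<^sup>2 * (l A)\<^sup>2) \<le> 9 * 2 ^ n * s * t"
    by (rule power2_le_imp_le) (use st in simp)
  have "(\<Sum>A\<in>Pow {..<Suc n}. (\<Sum>a<Suc n. \<Sum>b<a. C a b * eps A a * eps A b) ^ 4)
      = (\<Sum>A\<in>Pow {..<n}. 2 * (Q A) ^ 4 + 12 * ((Q A)\<^sup>2 * (l A)\<^sup>2) + 2 * (l A) ^ 4)"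
    unfolding sum_Pow_Suc
    by (intro sum.cong refl, subst Q1, assumption, subst Q2, assumption)
      (simp add: power2_eq_square power4_eq_xxxx algebra_simps)
  also have "\<dots> = 2 * (\<Sum>A\<in>Pow {..<n}. (Q A) ^ 4) + 12 * (\<Sum>A\<in>Pow {..<n}. (Q A)\<^sup>2 * (l A)\<^sup>2) + 2 * (\<Sum>A\<in>Pow {..<n}. (l A) ^ 4)"
    unfolding sum.distrib sum_distrib_left[symmetric] ..
  also have "\<dots> \<le> 2 * (27 * 2 ^ n * s\<^sup>2) + 12 * (9 * 2 ^ n * s * t) + 2 * (3 * 2 ^ n * t\<^sup>2)"
    using Q4 Ql l4 by (intro add_mono mult_left_mono) auto
  also have "\<dots> \<le> 27 * 2 ^ Suc n * (s + t)\<^sup>2"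
  proof -
    have "27 * 2 ^ Suc n * (s + t)\<^sup>2 - (2 * (27 * 2 ^ n * s\<^sup>2) + 12 * (9 * 2 ^ n * s * t) + 2 * (3 * 2 ^ n * t\<^sup>2))
       = 2 ^ n * (48 * t\<^sup>2)" by (simp add: power2_eq_square algebra_simps)
    moreover have "0 \<le> 2 ^ n * (48 * t\<^sup>2)" by simp
    ultimately show ?thesis by linarith
  qed
  finally show ?case by (simp add: s_def t_def)
qed simp

text \<open>Real and imaginary parts are bounded separately, each contributing twice the constant 3
  of the real case.\<close>

lemma complex_sign_sum_fourth_moment:
  fixes h :: "nat \<Rightarrow> complex"
  shows "(\<Sum>A\<in>Pow {..<n}. (cmod (\<Sum>a<n. h a * of_real (eps A a))) ^ 4) \<le> 12 * 2 ^ n * (\<Sum>a<n. (cmod (h a))\<^sup>2)\<^sup>2"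
proof -
  define X where "X A = (\<Sum>a<n. Re (h a) * eps A a)" for A
  define Y where "Y A = (\<Sum>a<n. Im (h a) * eps A a)" for A
  have 1: "(cmod (\<Sum>a<n. h a * of_real (eps A a))) ^ 4 \<le> 2 * (X A) ^ 4 + 2 * (Y A) ^ 4" for A
  proof -
    have "(cmod (\<Sum>a<n. h a * of_real (eps A a)))\<^sup>2 = (X A)\<^sup>2 + (Y A)\<^sup>2"
      unfolding cmod_power2 X_def Y_def by simp
    then have "(cmod (\<Sum>a<n. h a * of_real (eps A a))) ^ 4 = ((X A)\<^sup>2 + (Y A)\<^sup>2)\<^sup>2"
      by (metis mult_2_right numeral_Bit0 power_even_eq power2_eq_square power4_eq_xxxx mult.assoc)
    also have "\<dots> \<le> 2 * (X A) ^ 4 + 2 * (Y A) ^ 4"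
    proof -
      have "0 \<le> ((X A)\<^sup>2 - (Y A)\<^sup>2)\<^sup>2" by simp
      then show ?thesis by (simp add: power2_eq_square power4_eq_xxxx algebra_simps)
    qed
    finally show ?thesis .
  qed
  have le: "(\<Sum>a<n. (Re (h a))\<^sup>2) \<le> (\<Sum>a<n. (cmod (h a))\<^sup>2)" "(\<Sum>a<n. (Im (h a))\<^sup>2) \<le> (\<Sum>a<n. (cmod (h a))\<^sup>2)"
    by (intro sum_mono, simp add: cmod_power2)+
  have "(\<Sum>A\<in>Pow {..<n}. (cmod (\<Sum>a<n. h a * of_real (eps A a))) ^ 4)
     \<le> (\<Sum>A\<in>Pow {..<n}. 2 * (X A) ^ 4 + 2 * (Y A) ^ 4)" by (intro sum_mono 1)
  also have "\<dots> = 2 * (\<Sum>A\<in>Pow {..<n}. (X A) ^ 4) + 2 * (\<Sum>A\<in>Pow {..<n}. (Y A) ^ 4)"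
    unfolding sum.distrib sum_distrib_left[symmetric] ..
  also have "\<dots> \<le> 2 * (3 * 2 ^ n * (\<Sum>a<n. (Re (h a))\<^sup>2)\<^sup>2) + 2 * (3 * 2 ^ n * (\<Sum>a<n. (Im (h a))\<^sup>2)\<^sup>2)"
    unfolding X_def Y_def by (intro add_mono mult_left_mono sign_sum_moments) auto
  also have "\<dots> \<le> 2 * (3 * 2 ^ n * (\<Sum>a<n. (cmod (h a))\<^sup>2)\<^sup>2) + 2 * (3 * 2 ^ n * (\<Sum>a<n. (cmod (h a))\<^sup>2)\<^sup>2)"
    by (intro add_mono mult_left_mono power_mono le sum_nonneg) auto
  finally show ?thesis by simp
qed

section \<open>Unitary matrices that send one vector to another\<close>

lemma mat_adjoint_index:
  fixes A :: "complex mat"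
  assumes "A \<in> carrier_mat a b" "i < b" "j < a"
  shows "mat_adjoint A $$ (i, j) = cnj (A $$ (j, i))"
  using assms by (simp add: mat_adjoint_def mat_of_rows_def col_def)

lemma mat_adjoint_carrier:
  fixes A :: "complex mat"
  assumes "A \<in> carrier_mat a b"
  shows "mat_adjoint A \<in> carrier_mat b a"
  using assms by (intro carrier_matI) (auto simp: mat_adjoint_def)

text \<open>A complex variant of the Householder reflection. The usual real factor works only if the
  inner product of \<open>p\<close> and \<open>f\<close> is real; with the complex factor
  \<open>\<gamma>\<close> the adjoint of \<open>U\<close> sends \<open>p\<close> to \<open>f\<close>
  for every pair of equal norm.\<close>

lemma householder:
  fixes p f :: "nat \<Rightarrow> complex"
  assumes "(\<Sum>a<d. (cmod (p a))\<^sup>2) = (\<Sum>a<d. (cmod (f a))\<^sup>2)"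
  shows "\<exists>U. unitary_mat d U \<and> (\<forall>b<d. (\<Sum>a<d. cnj (U $$ (a, b)) * p a) = f b)"
proof -
  define S where "S = (\<Sum>a<d. (cmod (p a))\<^sup>2)"
  define \<kappa> where "\<kappa> = (\<Sum>a<d. cnj (f a) * p a)"
  define w where "w a = p a - f a" for a
  define W where "W = (\<Sum>a<d. (cmod (w a))\<^sup>2)"
  \<comment> \<open>If \<open>\<kappa>\<close> equals \<open>S\<close>, then \<open>p\<close> and
    \<open>f\<close> agree; division by zero makes \<open>\<gamma>\<close> zero and the matrix the
    identity.\<close>
  define \<gamma> where "\<gamma> = 1 / (of_real S - \<kappa>)"
  have W: "W = 2 * S - 2 * Re \<kappa>"
  proof -
    have "(cmod (w a))\<^sup>2 = (cmod (p a))\<^sup>2 + (cmod (f a))\<^sup>2 - 2 * Re (cnj (f a) * p a)" for a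
      unfolding w_def cmod_power2 by (simp add: power2_eq_square algebra_simps)
    then show ?thesis
      using assms by (simp add: W_def S_def \<kappa>_def sum.distrib sum_subtractf sum_distrib_left)
  qed
  \<comment> \<open>Exactly the condition under which the identity minus \<open>\<gamma>\<close>
    times the rank one matrix of \<open>w\<close> is unitary.\<close>
  have \<gamma>W: "\<gamma> + cnj \<gamma> = \<gamma> * cnj \<gamma> * of_real W"
  proof (cases "\<kappa> = of_real S")
    case False
    define e where "e = of_real S - \<kappa>"
    have e: "e \<noteq> 0" using False unfolding e_def by simp
    have "e + cnj e = of_real W" unfolding e_def W by (simp add: complex_eq_iff)
    moreover have "\<gamma> + cnj \<gamma> = \<gamma> * cnj \<gamma> * (e + cnj e)"
      unfolding \<gamma>_def e_def[symmetric] using e by (simp add: field_simps)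
    ultimately show ?thesis by simp
  qed (simp add: \<gamma>_def)
  have pw: "\<gamma> * w b * (of_real S - \<kappa>) = w b" if "b < d" for b
  proof (cases "\<kappa> = of_real S")
    case True
    then have "W = 0" using W by simp
    then have "w b = 0" unfolding W_def using that by (simp add: sum_nonneg_eq_0_iff)
    then show ?thesis by simp
  qed (simp add: \<gamma>_def)
  define H where "H b a = (if a = b then 1 else 0) - \<gamma> * w b * cnj (w a)" for a b
  define U where "U = mat d d (\<lambda>(a, b). cnj (H b a))"
  have U: "U \<in> carrier_mat d d" unfolding U_def by simp
  have HH: "(\<Sum>c<d. cnj (H c a) * H c b) = (if a = b then 1 else 0)" if ab: "a < d" "b < d" for a b
  proof -
    have "(\<Sum>c<d. cnj (H c a) * H c b) = (\<Sum>c<d. (if a = c then 1 else 0) * (if b = c then 1 else 0)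
      - (if a = c then 1 else 0) * (\<gamma> * w c * cnj (w b)) - (if b = c then 1 else 0) * (cnj \<gamma> * cnj (w c) * w a)
      + \<gamma> * cnj \<gamma> * w a * cnj (w b) * (cnj (w c) * w c))"
      unfolding H_def by (intro sum.cong refl) (simp add: algebra_simps)
    also have "\<dots> = (if a = b then 1 else 0) - \<gamma> * w a * cnj (w b) - cnj \<gamma> * cnj (w b) * w a
       + \<gamma> * cnj \<gamma> * w a * cnj (w b) * of_real W"
    proof -
      have "(\<Sum>c<d. (if a = c then 1 else 0) * g c) = g a" "(\<Sum>c<d. (if b = c then 1 else 0) * g c) = g b" for g :: "nat \<Rightarrow> complex"
        using ab by (auto simp: if_distrib[of "\<lambda>x. x * _"] sum.delta' cong: if_cong)
      moreover have "(\<Sum>c<d. cnj (w c) * w c) = of_real W" unfolding W_def cnj_mult_cmod by simp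
      ultimately show ?thesis
        by (simp add: sum.distrib sum_subtractf sum_distrib_left[symmetric] eq_commute[of b a])
    qed
    also have "\<dots> = (if a = b then 1 else 0) - w a * cnj (w b) * (\<gamma> + cnj \<gamma> - \<gamma> * cnj \<gamma> * of_real W)"
      by (simp add: algebra_simps)
    finally show ?thesis using \<gamma>W by simp
  qed
  have "U * mat_adjoint U = 1\<^sub>m d"
  proof (rule eq_matI)
    fix a b assume "a < dim_row (1\<^sub>m d :: complex mat)" "b < dim_col (1\<^sub>m d :: complex mat)"
    then have ab: "a < d" "b < d" by auto
    have "(U * mat_adjoint U) $$ (a, b) = (\<Sum>c<d. U $$ (a, c) * mat_adjoint U $$ (c, b))"
      using ab U mat_adjoint_carrier[OF U] by (simp add: scalar_prod_def atLeast0LessThan)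
    also have "\<dots> = (\<Sum>c<d. cnj (H c a) * H c b)"
      using ab mat_adjoint_index[OF U] by (intro sum.cong refl) (simp add: U_def)
    finally show "(U * mat_adjoint U) $$ (a, b) = 1\<^sub>m d $$ (a, b)" using HH[OF ab] ab by simp
  qed (use U mat_adjoint_carrier[OF U] in auto)
  then have "unitary_mat d U"
    unfolding unitary_mat_def using U mat_mult_left_right_inverse[OF U mat_adjoint_carrier[OF U]] by simp
  moreover have "(\<Sum>a<d. cnj (U $$ (a, b)) * p a) = f b" if b: "b < d" for b
  proof -
    have "(\<Sum>a<d. cnj (U $$ (a, b)) * p a) = (\<Sum>a<d. (if b = a then 1 else 0) * p a - \<gamma> * w b * (cnj (w a) * p a))"
      using b by (intro sum.cong refl) (simp add: U_def H_def algebra_simps)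
    also have "\<dots> = p b - \<gamma> * w b * (\<Sum>a<d. cnj (w a) * p a)"
      using b by (simp add: sum_subtractf sum_distrib_left if_distrib[of "\<lambda>x. x * _"] sum.delta' cong: if_cong)
    also have "(\<Sum>a<d. cnj (w a) * p a) = of_real S - \<kappa>"
      unfolding w_def S_def \<kappa>_def of_real_sum cnj_mult_cmod[symmetric] by (simp add: left_diff_distrib sum_subtractf)
    finally show ?thesis unfolding pw[OF b] by (simp add: w_def)
  qed
  ultimately show ?thesis by blast
qed

section \<open>Quadratic forms at flat vectors\<close>

definition hat :: "nat \<Rightarrow> complex mat \<Rightarrow> (nat \<Rightarrow> complex) \<Rightarrow> nat \<Rightarrow> complex" where
  "hat d B p k = (\<Sum>a<d. cnj (B $$ (a, k)) * p a)"

definition isometric :: "nat \<Rightarrow> nat \<Rightarrow> complex mat \<Rightarrow> bool" where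
  "isometric d N B \<longleftrightarrow>
     (\<forall>k<N. \<forall>l<N. (\<Sum>a<d. cnj (B $$ (a, k)) * B $$ (a, l)) = (if k = l then 1 else 0))"

lemma isometric_norm:
  assumes "isometric d N B"
  shows "(\<Sum>a<d. (cmod (\<Sum>k<N. B $$ (a, k) * x k))\<^sup>2) = (\<Sum>k<N. (cmod (x k))\<^sup>2)"
proof -
  have "complex_of_real (\<Sum>a<d. (cmod (\<Sum>k<N. B $$ (a, k) * x k))\<^sup>2)
      = (\<Sum>a<d. \<Sum>k<N. \<Sum>l<N. cnj (x k) * x l * (cnj (B $$ (a, k)) * B $$ (a, l)))"
    unfolding of_real_sum cnj_mult_cmod[symmetric] cnj_sum sum_product by (simp add: mult_ac)
  also have "\<dots> = (\<Sum>k<N. cnj (x k) * x k)"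
    by (rule triple_sum_delta) (use assms in \<open>simp add: isometric_def\<close>)
  also have "\<dots> = complex_of_real (\<Sum>k<N. (cmod (x k))\<^sup>2)"
    unfolding of_real_sum cnj_mult_cmod[symmetric] ..
  finally show ?thesis by (simp only: of_real_eq_iff)
qed

lemma symmetric_double_sum:
  fixes h :: "nat \<Rightarrow> nat \<Rightarrow> real"
  assumes "\<And>a b. h a b = h b a"
  shows "(\<Sum>a<d. \<Sum>b<d. h a b) = (\<Sum>a<d. h a a) + 2 * (\<Sum>a<d. \<Sum>b<a. h a b)"
proof (induction d)
  case (Suc d)
  have "(\<Sum>a<Suc d. \<Sum>b<Suc d. h a b) = (\<Sum>a<d. \<Sum>b<d. h a b) + (\<Sum>a<d. h a d) + (\<Sum>b<d. h d b) + h d d"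
    by (simp add: sum.distrib)
  moreover have "(\<Sum>a<d. h a d) = (\<Sum>b<d. h d b)" using assms by simp
  ultimately show ?case using Suc.IH by simp
qed simp

text \<open>All entries have the same modulus, so the diagonal part of a quadratic form in this
  vector equals \<open>S / d\<close> times the trace for every choice of signs; only a chaos of
  order two fluctuates.\<close>

definition flat_signs :: "nat \<Rightarrow> real \<Rightarrow> nat set \<Rightarrow> nat \<Rightarrow> complex" where
  "flat_signs d S A a = of_real (sqrt (S / d) * eps A a)"

lemma flat_signs_norm:
  assumes "0 < d" "0 \<le> S"
  shows "(\<Sum>a<d. (cmod (flat_signs d S A a))\<^sup>2) = S"
proof -
  have "(cmod (flat_signs d S A a))\<^sup>2 = S / d" for a
    using assms by (simp add: flat_signs_def norm_mult power_mult_distrib eps_def)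
  then show ?thesis using assms by simp
qed

text \<open>The matrix of the form is \<open>B\<close> times the diagonal \<open>D\<close> times the
  adjoint of \<open>B\<close>, with squared Frobenius norm at most \<open>d * Dm\<^sup>2\<close>.
  Each pair of off-diagonal entries counts twice, so the chaos bound is 27 times the square of
  \<open>4 * d * Dm\<^sup>2\<close>, against the prefactor \<open>(S / d) ^ 4\<close>.\<close>

lemma quadratic_form_flat_moment:
  assumes B: "isometric d N B" and D: "\<And>k. k < N \<Longrightarrow> \<bar>D k\<bar> \<le> Dm" and "N \<le> d" "0 < d" "0 \<le> S"
  shows "(\<Sum>A\<in>Pow {..<d}. ((\<Sum>k<N. D k * (cmod (hat d B (flat_signs d S A) k))\<^sup>2) - S / d * (\<Sum>k<N. D k)) ^ 4)
     \<le> 2 ^ d * (432 * S ^ 4 * Dm ^ 4 / (real d)\<^sup>2)"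
proof -
  define H where "H a b = (\<Sum>k<N. of_real (D k) * (B $$ (a, k) * cnj (B $$ (b, k))))" for a b
  define h where "h a b = Re (H a b)" for a b
  have hsym: "h a b = h b a" for a b unfolding h_def H_def by (simp add: mult_ac)
  have col: "(\<Sum>a<d. (cmod (B $$ (a, k)))\<^sup>2) = 1" if "k < N" for k
    by (rule sum_cmod_square_eq_1) (use B that in \<open>simp add: isometric_def\<close>)
  have diag: "(\<Sum>a<d. h a a) = (\<Sum>k<N. D k)"
  proof -
    have "(\<Sum>a<d. h a a) = (\<Sum>a<d. \<Sum>k<N. D k * (cmod (B $$ (a, k)))\<^sup>2)"
      unfolding h_def H_def by (simp add: complex_mult_cnj cmod_power2)
    also have "\<dots> = (\<Sum>k<N. \<Sum>a<d. D k * (cmod (B $$ (a, k)))\<^sup>2)" by (rule sum.swap)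
    also have "\<dots> = (\<Sum>k<N. D k)" unfolding sum_distrib_left[symmetric] using col by simp
    finally show ?thesis .
  qed
  \<comment> \<open>Isometry in the first index, then unit columns in the second.\<close>
  have frob: "(\<Sum>a<d. \<Sum>b<d. (cmod (H a b))\<^sup>2) \<le> d * Dm\<^sup>2"
  proof -
    have "(\<Sum>a<d. \<Sum>b<d. (cmod (H a b))\<^sup>2) = (\<Sum>b<d. \<Sum>a<d. (cmod (H a b))\<^sup>2)" by (rule sum.swap)
    also have "\<dots> = (\<Sum>b<d. \<Sum>k<N. (cmod (of_real (D k) * cnj (B $$ (b, k))))\<^sup>2)"
    proof (rule sum.cong[OF refl])
      fix b
      have "(\<Sum>a<d. (cmod (H a b))\<^sup>2) = (\<Sum>a<d. (cmod (\<Sum>k<N. B $$ (a, k) * (of_real (D k) * cnj (B $$ (b, k)))))\<^sup>2)"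
        unfolding H_def by (simp add: mult_ac)
      also have "\<dots> = (\<Sum>k<N. (cmod (of_real (D k) * cnj (B $$ (b, k))))\<^sup>2)" by (rule isometric_norm[OF B])
      finally show "(\<Sum>a<d. (cmod (H a b))\<^sup>2) = (\<Sum>k<N. (cmod (of_real (D k) * cnj (B $$ (b, k))))\<^sup>2)" .
    qed
    also have "\<dots> = (\<Sum>b<d. \<Sum>k<N. (D k)\<^sup>2 * (cmod (B $$ (b, k)))\<^sup>2)"
      by (simp add: norm_mult power_mult_distrib)
    also have "\<dots> = (\<Sum>k<N. \<Sum>b<d. (D k)\<^sup>2 * (cmod (B $$ (b, k)))\<^sup>2)" by (rule sum.swap)
    also have "\<dots> = (\<Sum>k<N. (D k)\<^sup>2)" unfolding sum_distrib_left[symmetric] using col by simp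
    also have "\<dots> \<le> (\<Sum>k<N. Dm\<^sup>2)"
      using D by (intro sum_mono) (metis abs_ge_zero lessThan_iff power2_abs power_mono)
    also have "\<dots> \<le> d * Dm\<^sup>2" using assms(3) by (simp add: mult_right_mono)
    finally show ?thesis .
  qed
  have expand: "(\<Sum>k<N. D k * (cmod (hat d B (flat_signs d S A) k))\<^sup>2) - S / d * (\<Sum>k<N. D k)
     = S / d * (\<Sum>a<d. \<Sum>b<a. (2 * h a b) * eps A a * eps A b)" for A
  proof -
    define f where "f a = sqrt (S / d) * eps A a" for a
    have f2: "f a * f b = S / d * (eps A a * eps A b)" for a b
    proof -
      have "sqrt (S / d) * sqrt (S / d) = S / d" using assms by simp
      moreover have "f a * f b = sqrt (S / d) * sqrt (S / d) * (eps A a * eps A b)"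
        by (simp only: f_def mult_ac)
      ultimately show ?thesis by (simp only:)
    qed
    have hk: "complex_of_real ((cmod (hat d B (flat_signs d S A) k))\<^sup>2)
       = (\<Sum>a<d. \<Sum>b<d. of_real (f a * f b) * (B $$ (a, k) * cnj (B $$ (b, k))))" for k
      unfolding cnj_mult_cmod[symmetric] hat_def flat_signs_def f_def[symmetric] cnj_sum sum_product
      by (simp add: mult_ac)
    have "complex_of_real (\<Sum>k<N. D k * (cmod (hat d B (flat_signs d S A) k))\<^sup>2)
       = (\<Sum>k<N. \<Sum>a<d. \<Sum>b<d. of_real (f a * f b) * (of_real (D k) * (B $$ (a, k) * cnj (B $$ (b, k)))))"
      unfolding of_real_sum of_real_mult[of "D _"] hk sum_distrib_left by (simp only: mult_ac)
    also have "\<dots> = (\<Sum>a<d. \<Sum>k<N. \<Sum>b<d. of_real (f a * f b) * (of_real (D k) * (B $$ (a, k) * cnj (B $$ (b, k)))))"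
      by (rule sum.swap)
    also have "\<dots> = (\<Sum>a<d. \<Sum>b<d. of_real (f a * f b) * H a b)"
      unfolding H_def sum_distrib_left by (rule sum.cong[OF refl], rule sum.swap)
    finally have "(\<Sum>k<N. D k * (cmod (hat d B (flat_signs d S A) k))\<^sup>2) = Re (\<Sum>a<d. \<Sum>b<d. of_real (f a * f b) * H a b)"
      by (metis Re_complex_of_real)
    also have "\<dots> = (\<Sum>a<d. \<Sum>b<d. S / d * (eps A a * eps A b * h a b))"
      by (simp add: f2 h_def mult_ac)
    also have "\<dots> = S / d * (\<Sum>a<d. \<Sum>b<d. eps A a * eps A b * h a b)"
      by (simp add: sum_distrib_left)
    also have "(\<Sum>a<d. \<Sum>b<d. eps A a * eps A b * h a b) = (\<Sum>a<d. eps A a * eps A a * h a a)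
       + 2 * (\<Sum>a<d. \<Sum>b<a. eps A a * eps A b * h a b)"
      by (rule symmetric_double_sum) (simp add: hsym mult_ac)
    also have "(\<Sum>a<d. eps A a * eps A a * h a a) = (\<Sum>k<N. D k)"
      unfolding diag[symmetric] by (intro sum.cong refl) (simp add: eps_def)
    finally show ?thesis by (simp add: algebra_simps sum_distrib_left)
  qed
  have low: "(\<Sum>a<d. \<Sum>b<a. (2 * h a b)\<^sup>2) \<le> 4 * (d * Dm\<^sup>2)"
  proof -
    have "(\<Sum>a<d. \<Sum>b<a. (2 * h a b)\<^sup>2) \<le> (\<Sum>a<d. \<Sum>b<d. (2 * h a b)\<^sup>2)"
      by (intro sum_mono sum_mono2) auto
    also have "\<dots> \<le> (\<Sum>a<d. \<Sum>b<d. 4 * (cmod (H a b))\<^sup>2)"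
      by (intro sum_mono) (simp add: h_def power_mult_distrib cmod_power2)
    also have "\<dots> = 4 * (\<Sum>a<d. \<Sum>b<d. (cmod (H a b))\<^sup>2)" by (simp add: sum_distrib_left)
    finally show ?thesis using frob by simp
  qed
  have "(\<Sum>A\<in>Pow {..<d}. ((\<Sum>k<N. D k * (cmod (hat d B (flat_signs d S A) k))\<^sup>2) - S / d * (\<Sum>k<N. D k)) ^ 4)
      = (S / d) ^ 4 * (\<Sum>A\<in>Pow {..<d}. (\<Sum>a<d. \<Sum>b<a. (2 * h a b) * eps A a * eps A b) ^ 4)"
    unfolding expand power_mult_distrib by (rule sum_distrib_left[symmetric])
  also have "\<dots> \<le> (S / d) ^ 4 * (27 * 2 ^ d * (4 * (d * Dm\<^sup>2))\<^sup>2)"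
    using low by (intro mult_left_mono order_trans[OF sign_chaos_fourth_moment] power_mono sum_nonneg) auto
  also have "\<dots> = 2 ^ d * (432 * S ^ 4 * Dm ^ 4 / (real d)\<^sup>2)"
    using assms(4) by (simp add: field_simps power2_eq_square power4_eq_xxxx)
  finally show ?thesis .
qed

text \<open>As \<open>v\<close> is fixed while the signs vary, the form is linear in the signs; its
  coefficient vector has energy at most \<open>Dm\<^sup>2 * V\<close> by isometry.\<close>

lemma bilinear_form_flat_moment:
  assumes B: "isometric d N B" and D: "\<And>k. k < N \<Longrightarrow> \<bar>D k\<bar> \<le> Dm" and "0 < d" "0 \<le> S"
    and v: "(\<Sum>k<N. (cmod (v k))\<^sup>2) \<le> V"
  shows "(\<Sum>A\<in>Pow {..<d}. (cmod (\<Sum>k<N. of_real (D k) * (cnj (hat d B (flat_signs d S A) k) * v k))) ^ 4)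
     \<le> 2 ^ d * (12 * S\<^sup>2 * Dm ^ 4 * V\<^sup>2 / (real d)\<^sup>2)"
proof -
  define h where "h a = (\<Sum>k<N. B $$ (a, k) * (of_real (D k) * v k))" for a
  have eq: "(\<Sum>k<N. of_real (D k) * (cnj (hat d B (flat_signs d S A) k) * v k))
     = of_real (sqrt (S / d)) * (\<Sum>a<d. h a * of_real (eps A a))" for A
  proof -
    have "(\<Sum>k<N. of_real (D k) * (cnj (hat d B (flat_signs d S A) k) * v k))
       = (\<Sum>k<N. \<Sum>a<d. of_real (sqrt (S / d)) * (B $$ (a, k) * (of_real (D k) * v k) * of_real (eps A a)))"
      unfolding hat_def flat_signs_def cnj_sum sum_distrib_left sum_distrib_right by (simp add: mult_ac)
    also have "\<dots> = (\<Sum>a<d. \<Sum>k<N. of_real (sqrt (S / d)) * (B $$ (a, k) * (of_real (D k) * v k) * of_real (eps A a)))"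
      by (rule sum.swap)
    finally show ?thesis unfolding h_def by (simp add: sum_distrib_left sum_distrib_right)
  qed
  have "(\<Sum>a<d. (cmod (h a))\<^sup>2) = (\<Sum>k<N. (cmod (of_real (D k) * v k))\<^sup>2)"
    unfolding h_def by (rule isometric_norm[OF B])
  also have "\<dots> \<le> (\<Sum>k<N. Dm\<^sup>2 * (cmod (v k))\<^sup>2)"
  proof (rule sum_mono)
    fix k assume "k \<in> {..<N}"
    then have "(D k)\<^sup>2 \<le> Dm\<^sup>2" using D[of k] by (metis abs_ge_zero lessThan_iff power2_abs power_mono)
    then show "(cmod (of_real (D k) * v k))\<^sup>2 \<le> Dm\<^sup>2 * (cmod (v k))\<^sup>2"
      by (simp add: norm_mult power_mult_distrib mult_right_mono)
  qed
  also have "\<dots> \<le> Dm\<^sup>2 * V" unfolding sum_distrib_left[symmetric] using v by (intro mult_left_mono) auto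
  finally have hb: "(\<Sum>a<d. (cmod (h a))\<^sup>2) \<le> Dm\<^sup>2 * V" .
  have s4: "sqrt (S / d) ^ 4 = (S / d)\<^sup>2" using assms(3,4)
    by (simp add: power4_eq_xxxx power2_eq_square mult.assoc[symmetric]) (simp add: mult.assoc)
  have "(\<Sum>A\<in>Pow {..<d}. (cmod (\<Sum>k<N. of_real (D k) * (cnj (hat d B (flat_signs d S A) k) * v k))) ^ 4)
      = (S / d)\<^sup>2 * (\<Sum>A\<in>Pow {..<d}. (cmod (\<Sum>a<d. h a * of_real (eps A a))) ^ 4)"
    unfolding sum_distrib_left[of "(S / d)\<^sup>2"]
  proof (rule sum.cong[OF refl])
    fix A
    have "cmod (of_real (sqrt (S / d)) * (\<Sum>a<d. h a * of_real (eps A a)))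
        = sqrt (S / d) * cmod (\<Sum>a<d. h a * of_real (eps A a))"
      using assms(3,4) by (simp add: norm_mult)
    then show "(cmod (\<Sum>k<N. of_real (D k) * (cnj (hat d B (flat_signs d S A) k) * v k))) ^ 4
        = (S / d)\<^sup>2 * (cmod (\<Sum>a<d. h a * of_real (eps A a))) ^ 4"
      unfolding eq by (simp only: power_mult_distrib s4)
  qed
  also have "\<dots> \<le> (S / d)\<^sup>2 * (12 * 2 ^ d * (Dm\<^sup>2 * V)\<^sup>2)"
    using hb by (intro mult_left_mono order_trans[OF complex_sign_sum_fourth_moment] power_mono sum_nonneg) auto
  also have "\<dots> = 2 ^ d * (12 * S\<^sup>2 * Dm ^ 4 * V\<^sup>2 / (real d)\<^sup>2)"
    using assms(3) by (simp add: field_simps power2_eq_square power4_eq_xxxx)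
  finally show ?thesis .
qed

text \<open>Moves a unitary from the random matrix to the deterministic vector, which is how left
  invariance is exploited.\<close>

lemma hat_unitary_mult:
  assumes "U \<in> carrier_mat d d" "B \<in> carrier_mat d N" "k < N"
  shows "hat d (U * B) p k = hat d B (\<lambda>b. \<Sum>a<d. cnj (U $$ (a, b)) * p a) k"
proof -
  have "hat d (U * B) p k = (\<Sum>a<d. \<Sum>b<d. cnj (B $$ (b, k)) * (cnj (U $$ (a, b)) * p a))"
    unfolding hat_def using assms
    by (intro sum.cong refl) (simp add: scalar_prod_def atLeast0LessThan cnj_sum sum_distrib_left sum_distrib_right mult_ac)
  also have "\<dots> = (\<Sum>b<d. \<Sum>a<d. cnj (B $$ (b, k)) * (cnj (U $$ (a, b)) * p a))" by (rule sum.swap)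
  finally show ?thesis unfolding hat_def sum_distrib_left .
qed

section \<open>Left-invariant random matrices\<close>

lemma measurable_entry:
  assumes "i < nr" "k < nc"
  shows "(\<lambda>A. A $$ (i, k)) \<in> borel_measurable (mat_space nr nc)"
proof -
  let ?f = "\<lambda>A::complex mat. \<lambda>ij\<in>{..<nr}\<times>{..<nc}. A $$ ij"
  have "?f \<in> mat_space nr nc \<rightarrow>\<^sub>M PiM ({..<nr}\<times>{..<nc}) (\<lambda>_. borel)"
    unfolding mat_space_def by (rule measurable_vimage_algebra1) (auto simp: space_PiM)
  from measurable_compose[OF this measurable_component_singleton[of "(i, k)"]] assms
  show ?thesis by simp
qed

lemma space_mat_space: "space (mat_space nr nc) = carrier_mat nr nc"
  unfolding mat_space_def by simp

lemma measurable_mat_space: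
  assumes "\<And>w. w \<in> space M \<Longrightarrow> f w \<in> carrier_mat nr nc"
    and "\<And>i k. i < nr \<Longrightarrow> k < nc \<Longrightarrow> (\<lambda>w. f w $$ (i, k)) \<in> borel_measurable M"
  shows "f \<in> M \<rightarrow>\<^sub>M mat_space nr nc"
  unfolding mat_space_def
proof (rule measurable_vimage_algebra2)
  show "(\<lambda>w. \<lambda>ij\<in>{..<nr}\<times>{..<nc}. f w $$ ij) \<in> M \<rightarrow>\<^sub>M PiM ({..<nr}\<times>{..<nc}) (\<lambda>_. borel)"
    by (rule measurable_restrict) (use assms(2) in auto)
qed (use assms(1) in auto)

lemma measurable_unitary_mult:
  assumes "U \<in> carrier_mat d d"
  shows "(\<lambda>A. U * A) \<in> mat_space d N \<rightarrow>\<^sub>M mat_space d N"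
proof (rule measurable_mat_space)
  fix i k assume ik: "i < d" "k < N"
  have "(\<lambda>A. \<Sum>a<d. U $$ (i, a) * A $$ (a, k)) \<in> borel_measurable (mat_space d N)"
    using measurable_entry ik by (intro borel_measurable_sum borel_measurable_times) auto
  then show "(\<lambda>A. (U * A) $$ (i, k)) \<in> borel_measurable (mat_space d N)"
    by (rule measurable_cong[THEN iffD1, rotated])
      (use assms ik in \<open>auto simp: space_mat_space scalar_prod_def atLeast0LessThan\<close>)
qed (use assms in \<open>auto simp: space_mat_space\<close>)

text \<open>Together with isometry this is all that the moment bounds use about Haar matrices, and
  both properties pass to submatrices made of columns.\<close>

definition left_invariant :: "'w measure \<Rightarrow> nat \<Rightarrow> nat \<Rightarrow> ('w \<Rightarrow> complex mat) \<Rightarrow> bool" where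
  "left_invariant M d N B \<longleftrightarrow> B \<in> M \<rightarrow>\<^sub>M mat_space d N \<and>
     (\<forall>U. unitary_mat d U \<longrightarrow> distr M (mat_space d N) (\<lambda>w. U * B w) = distr M (mat_space d N) B)"

text \<open>The library's \<open>indep_var\<close> forces both variables to have the same type.\<close>

definition indep_pair :: "'w measure \<Rightarrow> 'a measure \<Rightarrow> ('w \<Rightarrow> 'a) \<Rightarrow> 'b measure \<Rightarrow> ('w \<Rightarrow> 'b) \<Rightarrow> bool" where
  "indep_pair M A X S Y \<longleftrightarrow> X \<in> M \<rightarrow>\<^sub>M A \<and> Y \<in> M \<rightarrow>\<^sub>M S \<and>
     distr M A X \<Otimes>\<^sub>M distr M S Y = distr M (A \<Otimes>\<^sub>M S) (\<lambda>w. (X w, Y w))"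

lemma indep_pair_of_indep_var:
  assumes "prob_space M" "prob_space.indep_var M A X S Y"
  shows "indep_pair M A X S Y"
  using assms prob_space.indep_var_distribution_eq[OF assms(1), of A X S Y] unfolding indep_pair_def by simp

lemma indep_pair_compose:
  assumes M: "prob_space M" and ind: "indep_pair M A X S Y" and f: "f \<in> A \<rightarrow>\<^sub>M A'"
  shows "indep_pair M A' (\<lambda>w. f (X w)) S Y"
proof -
  interpret prob_space M by (rule M)
  have X: "X \<in> M \<rightarrow>\<^sub>M A" and Y: "Y \<in> M \<rightarrow>\<^sub>M S"
    and eq: "distr M A X \<Otimes>\<^sub>M distr M S Y = distr M (A \<Otimes>\<^sub>M S) (\<lambda>w. (X w, Y w))"
    using ind unfolding indep_pair_def by auto
  have fX: "(\<lambda>w. f (X w)) \<in> M \<rightarrow>\<^sub>M A'" using measurable_compose[OF X f] .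
  \<comment> \<open>\<open>pair_measure_distr\<close> pushes both factors forward, so the second one
    is pushed by the identity.\<close>
  have ps: "prob_space (distr (distr M S Y) S (\<lambda>y. y))"
    by (rule prob_space.prob_space_distr[OF prob_space_distr[OF Y]]) simp
  have dY: "distr (distr M S Y) S (\<lambda>y. y) = distr M S Y"
    by (subst distr_distr[OF _ Y]) (simp_all add: comp_def)
  have dX: "distr (distr M A X) A' f = distr M A' (\<lambda>w. f (X w))"
    unfolding distr_distr[OF f X] comp_def ..
  have "distr (distr M A X) A' f \<Otimes>\<^sub>M distr (distr M S Y) S (\<lambda>y. y)
      = distr (distr M A X \<Otimes>\<^sub>M distr M S Y) (A' \<Otimes>\<^sub>M S) (\<lambda>(x, y). (f x, y))"
    using f ps by (intro pair_measure_distr) (auto intro: prob_space_imp_sigma_finite)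
  also have "\<dots> = distr M (A' \<Otimes>\<^sub>M S) (\<lambda>w. (f (X w), Y w))"
  proof -
    have "(\<lambda>(x, y). (f x, y)) \<in> A \<Otimes>\<^sub>M S \<rightarrow>\<^sub>M A' \<Otimes>\<^sub>M S"
      unfolding split_beta' using measurable_compose[OF measurable_fst f] by (intro measurable_Pair) auto
    from distr_distr[OF this measurable_Pair[OF X Y]] show ?thesis unfolding eq by (simp only: comp_def prod.case)
  qed
  finally show ?thesis unfolding indep_pair_def dX dY using fX Y by blast
qed

text \<open>Independence lifts invariance of the law of \<open>B\<close> to the joint law with
  \<open>Y\<close>, since both pairs have the same product law.\<close>

lemma nn_integral_left_invariant:
  assumes M: "prob_space M" and inv: "left_invariant M d N B" and U: "unitary_mat d U"
    and ind: "indep_pair M (mat_space d N) B S Y"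
    and F: "F \<in> borel_measurable (mat_space d N \<Otimes>\<^sub>M S)"
  shows "(\<integral>\<^sup>+w. F (U * B w, Y w) \<partial>M) = (\<integral>\<^sup>+w. F (B w, Y w) \<partial>M)"
proof -
  have Uc: "U \<in> carrier_mat d d" using U unfolding unitary_mat_def by simp
  have ind': "indep_pair M (mat_space d N) (\<lambda>w. U * B w) S Y"
    by (rule indep_pair_compose[OF M ind measurable_unitary_mult[OF Uc]])
  have B: "B \<in> M \<rightarrow>\<^sub>M mat_space d N" and Y: "Y \<in> M \<rightarrow>\<^sub>M S" and UB: "(\<lambda>w. U * B w) \<in> M \<rightarrow>\<^sub>M mat_space d N"
    using ind ind' unfolding indep_pair_def by auto
  have "distr M (mat_space d N \<Otimes>\<^sub>M S) (\<lambda>w. (U * B w, Y w)) = distr M (mat_space d N \<Otimes>\<^sub>M S) (\<lambda>w. (B w, Y w))"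
    using ind ind' inv U unfolding indep_pair_def left_invariant_def by metis
  then have "(\<integral>\<^sup>+x. F x \<partial>distr M (mat_space d N \<Otimes>\<^sub>M S) (\<lambda>w. (U * B w, Y w)))
     = (\<integral>\<^sup>+x. F x \<partial>distr M (mat_space d N \<Otimes>\<^sub>M S) (\<lambda>w. (B w, Y w)))" by simp
  then show ?thesis using B UB Y F by (simp add: nn_integral_distr)
qed

text \<open>The signs need no probability space of their own: each of the finitely many
  \<open>U A\<close> leaves the integral unchanged, so it suffices to bound their average at almost
  every point.\<close>

lemma nn_integral_le_sign_average:
  assumes M: "prob_space M" and inv: "left_invariant M d N B"
    and ind: "indep_pair M (mat_space d N) B S Y"
    and F: "F \<in> borel_measurable (mat_space d N \<Otimes>\<^sub>M S)"
    and U: "\<And>A. unitary_mat d (U A)"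
    and le: "AE w in M. (\<Sum>A\<in>Pow {..<d}. F (U A * B w, Y w)) \<le> ennreal (2 ^ d * c)" and "0 \<le> c"
  shows "(\<integral>\<^sup>+w. F (B w, Y w) \<partial>M) \<le> ennreal c"
proof -
  interpret prob_space M by (rule M)
  have B: "B \<in> M \<rightarrow>\<^sub>M mat_space d N" using inv unfolding left_invariant_def by simp
  have Y: "Y \<in> M \<rightarrow>\<^sub>M S" using ind unfolding indep_pair_def by blast
  have m: "(\<lambda>w. F (U A * B w, Y w)) \<in> borel_measurable M" for A
  proof -
    have "U A \<in> carrier_mat d d" using U[of A] unfolding unitary_mat_def by simp
    then have "(\<lambda>w. U A * B w) \<in> M \<rightarrow>\<^sub>M mat_space d N"
      using measurable_compose[OF B measurable_unitary_mult] by blast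
    then show ?thesis using measurable_compose[OF measurable_Pair[OF _ Y] F] by blast
  qed
  have "(2 ^ d) * (\<integral>\<^sup>+w. F (B w, Y w) \<partial>M) = (\<Sum>A\<in>Pow {..<d}. \<integral>\<^sup>+w. F (U A * B w, Y w) \<partial>M)"
    using nn_integral_left_invariant[OF M inv U ind F] by (simp add: card_Pow)
  also have "\<dots> = (\<integral>\<^sup>+w. (\<Sum>A\<in>Pow {..<d}. F (U A * B w, Y w)) \<partial>M)"
    by (rule nn_integral_sum[symmetric]) (rule m)
  also have "\<dots> \<le> (\<integral>\<^sup>+w. ennreal (2 ^ d * c) \<partial>M)" by (rule nn_integral_mono_AE[OF le])
  also have "\<dots> = ennreal (2 ^ d * c)" by (simp add: emeasure_space_1)
  also have "\<dots> = 2 ^ d * ennreal c" by (simp add: ennreal_mult' ennreal_power[symmetric])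
  finally show ?thesis
    by (subst (asm) ennreal_mult_le_mult_iff) (auto simp: ennreal_top_eq_mult_iff power_eq_top_ennreal)
qed

lemma borel_measurable_cnj:
  assumes "f \<in> borel_measurable M"
  shows "(\<lambda>x. cnj (f x)) \<in> borel_measurable M"
  by (rule borel_measurable_continuous_on[OF _ assms]) (intro continuous_intros)

lemma measurable_hat:
  assumes "k < N"
  shows "(\<lambda>B. hat d B p k) \<in> borel_measurable (mat_space d N)"
  unfolding hat_def using measurable_entry assms
  by (intro borel_measurable_sum borel_measurable_times borel_measurable_cnj) auto

text \<open>All flat vectors have the norm of \<open>p\<close>, so for every sign pattern a
  Householder matrix turns \<open>p\<close> into the flat vector.\<close>

lemma flat_unitaries:
  fixes p :: "nat \<Rightarrow> complex"
  assumes "0 < d"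
  obtains U where "\<And>A. unitary_mat d (U A)"
    "\<And>A B N k. B \<in> carrier_mat d N \<Longrightarrow> k < N \<Longrightarrow>
       hat d (U A * B) p k = hat d B (flat_signs d (\<Sum>a<d. (cmod (p a))\<^sup>2) A) k"
proof -
  define S where "S = (\<Sum>a<d. (cmod (p a))\<^sup>2)"
  have S: "0 \<le> S" unfolding S_def by (intro sum_nonneg) auto
  have "\<forall>A. \<exists>U. unitary_mat d U \<and> (\<forall>b<d. (\<Sum>a<d. cnj (U $$ (a, b)) * p a) = flat_signs d S A b)"
    by (intro allI householder) (simp add: flat_signs_norm[OF assms S] S_def[symmetric])
  then obtain U where U: "\<And>A. unitary_mat d (U A)"
    "\<And>A b. b < d \<Longrightarrow> (\<Sum>a<d. cnj (U A $$ (a, b)) * p a) = flat_signs d S A b" by metis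
  have "hat d (U A * B) p k = hat d B (flat_signs d S A) k" if "B \<in> carrier_mat d N" "k < N" for A B N k
  proof -
    have "U A \<in> carrier_mat d d" using U(1)[of A] unfolding unitary_mat_def by simp
    from hat_unitary_mult[OF this that]
    have "hat d (U A * B) p k = hat d B (\<lambda>b. \<Sum>a<d. cnj (U A $$ (a, b)) * p a) k" .
    also have "\<dots> = hat d B (flat_signs d S A) k" unfolding hat_def[of d B] using U(2) by simp
    finally show ?thesis .
  qed
  with U(1) that show thesis unfolding S_def by blast
qed

text \<open>Truncation by this indicator keeps the moments finite. It depends on \<open>Y\<close>
  alone and is therefore unaffected when \<open>B\<close> is replaced by
  \<open>U * B\<close>.\<close>

lemma measurable_truncation:
  fixes D :: "'x \<Rightarrow> nat \<Rightarrow> real"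
  assumes "\<And>k. k < N \<Longrightarrow> (\<lambda>x. D x k) \<in> borel_measurable M"
  shows "(\<lambda>x. of_bool (\<forall>k<N. \<bar>D x k\<bar> \<le> K) :: real) \<in> borel_measurable M"
proof -
  have "Measurable.pred M (\<lambda>x. \<bar>D x k\<bar> \<le> K)" if "k < N" for k
    using assms[OF that] by measurable
  then have "Measurable.pred M (\<lambda>x. \<forall>k\<in>{..<N}. \<bar>D x k\<bar> \<le> K)"
    by (intro pred_intros_finite) auto
  then have pr: "Measurable.pred M (\<lambda>x. \<forall>k<N. \<bar>D x k\<bar> \<le> K)"
    unfolding Ball_def lessThan_iff .
  show ?thesis by (rule measurable_compose[OF pr, where g = of_bool]) simp
qed

lemma measurable_quadratic_form:
  assumes D: "\<And>k. k < N \<Longrightarrow> (\<lambda>y. D y k) \<in> borel_measurable S"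
  shows "(\<lambda>(A, y). of_bool (\<forall>k<N. \<bar>D y k\<bar> \<le> Dm) *
      ((\<Sum>k<N. D y k * (cmod (hat d A p k))\<^sup>2) - P * (\<Sum>k<N. D y k)) ^ 4 :: real)
    \<in> borel_measurable (mat_space d N \<Otimes>\<^sub>M S)"
proof -
  have h: "(\<lambda>x. hat d (fst x) p k) \<in> borel_measurable (mat_space d N \<Otimes>\<^sub>M S)" if "k < N" for k
    using measurable_compose[OF measurable_fst measurable_hat[OF that]] .
  have D': "(\<lambda>x. D (snd x) k) \<in> borel_measurable (mat_space d N \<Otimes>\<^sub>M S)" if "k < N" for k
    using measurable_compose[OF measurable_snd D[OF that]] .
  show ?thesis unfolding split_beta'
    using h D' by (intro borel_measurable_times measurable_truncation borel_measurable_power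
        borel_measurable_diff borel_measurable_sum borel_measurable_const measurable_compose[OF _ borel_measurable_norm]) auto
qed

lemma measurable_bilinear_form:
  assumes D: "\<And>k. k < N \<Longrightarrow> (\<lambda>y. D y k) \<in> borel_measurable S"
    and v: "\<And>k. k < N \<Longrightarrow> (\<lambda>y. v y k) \<in> borel_measurable S"
  shows "(\<lambda>(A, y). of_bool (\<forall>k<N. \<bar>D y k\<bar> \<le> Dm) *
      (cmod (\<Sum>k<N. of_real (D y k) * (cnj (hat d A p k) * v y k))) ^ 4 :: real)
    \<in> borel_measurable (mat_space d N \<Otimes>\<^sub>M S)"
proof -
  have h: "(\<lambda>x. hat d (fst x) p k) \<in> borel_measurable (mat_space d N \<Otimes>\<^sub>M S)" if "k < N" for k
    using measurable_compose[OF measurable_fst measurable_hat[OF that]] .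
  have D': "(\<lambda>x. D (snd x) k) \<in> borel_measurable (mat_space d N \<Otimes>\<^sub>M S)" if "k < N" for k
    using measurable_compose[OF measurable_snd D[OF that]] .
  have v': "(\<lambda>x. v (snd x) k) \<in> borel_measurable (mat_space d N \<Otimes>\<^sub>M S)" if "k < N" for k
    using measurable_compose[OF measurable_snd v[OF that]] .
  show ?thesis unfolding split_beta'
    using h D' v' by (intro borel_measurable_times measurable_truncation borel_measurable_power
        borel_measurable_sum measurable_compose[OF _ borel_measurable_norm]
        measurable_compose[OF _ borel_measurable_of_real] borel_measurable_cnj) auto
qed

text \<open>Where the truncation fails the integrand is zero; elsewhere the sign average is the
  deterministic bound for flat vectors, because \<open>Y\<close> is the same for all
  \<open>U A * B\<close>.\<close>

lemma quadratic_form_moment: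
  assumes M: "prob_space M" and inv: "left_invariant M d N B"
    and ind: "indep_pair M (mat_space d N) B S Y"
    and iso: "AE w in M. isometric d N (B w)"
    and D: "\<And>k. k < N \<Longrightarrow> (\<lambda>y. D y k) \<in> borel_measurable S"
    and d: "N \<le> d" "0 < d"
  shows "(\<integral>\<^sup>+w. ennreal (of_bool (\<forall>k<N. \<bar>D (Y w) k\<bar> \<le> Dm) *
      ((\<Sum>k<N. D (Y w) k * (cmod (hat d (B w) p k))\<^sup>2) - (\<Sum>a<d. (cmod (p a))\<^sup>2) / d * (\<Sum>k<N. D (Y w) k)) ^ 4) \<partial>M)
    \<le> ennreal (432 * (\<Sum>a<d. (cmod (p a))\<^sup>2) ^ 4 * Dm ^ 4 / (real d)\<^sup>2)"
proof -
  define P where "P = (\<Sum>a<d. (cmod (p a))\<^sup>2)"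
  have P: "0 \<le> P" unfolding P_def by (intro sum_nonneg) auto
  obtain U where U: "\<And>A. unitary_mat d (U A)"
    "\<And>A B N k. B \<in> carrier_mat d N \<Longrightarrow> k < N \<Longrightarrow> hat d (U A * B) p k = hat d B (flat_signs d P A) k"
    using flat_unitaries[OF d(2), of p] unfolding P_def by metis
  define F where "F = (\<lambda>x. ennreal ((\<lambda>(A, y). of_bool (\<forall>k<N. \<bar>D y k\<bar> \<le> Dm) *
      ((\<Sum>k<N. D y k * (cmod (hat d A p k))\<^sup>2) - P / d * (\<Sum>k<N. D y k)) ^ 4) x))"
  have F: "F \<in> borel_measurable (mat_space d N \<Otimes>\<^sub>M S)"
    unfolding F_def by (rule measurable_compose[OF measurable_quadratic_form[OF D] measurable_ennreal])
  have "(\<integral>\<^sup>+w. F (B w, Y w) \<partial>M) \<le> ennreal (432 * P ^ 4 * Dm ^ 4 / (real d)\<^sup>2)"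
  proof (rule nn_integral_le_sign_average[OF M inv ind F U(1)])
    have B: "B \<in> M \<rightarrow>\<^sub>M mat_space d N" using inv unfolding left_invariant_def by simp
    have "AE w in M. B w \<in> carrier_mat d N"
      using measurable_space[OF B] by (intro AE_I2) (simp add: space_mat_space)
    then show "AE w in M. (\<Sum>A\<in>Pow {..<d}. F (U A * B w, Y w)) \<le> ennreal (2 ^ d * (432 * P ^ 4 * Dm ^ 4 / (real d)\<^sup>2))"
      using iso
    proof eventually_elim
      case (elim w)
      show ?case
      proof (cases "\<forall>k<N. \<bar>D (Y w) k\<bar> \<le> Dm")
        case True
        have "(\<Sum>A\<in>Pow {..<d}. F (U A * B w, Y w)) = ennreal (\<Sum>A\<in>Pow {..<d}.
           ((\<Sum>k<N. D (Y w) k * (cmod (hat d (B w) (flat_signs d P A) k))\<^sup>2) - P / d * (\<Sum>k<N. D (Y w) k)) ^ 4)"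
          unfolding F_def using True U(2)[OF elim(1)] by (simp add: sum_ennreal)
        also have "\<dots> \<le> ennreal (2 ^ d * (432 * P ^ 4 * Dm ^ 4 / (real d)\<^sup>2))"
          using True elim d P by (intro ennreal_leI quadratic_form_flat_moment) auto
        finally show ?thesis .
      qed (auto simp: F_def)
    qed
  qed (use P in auto)
  then show ?thesis unfolding F_def P_def by simp
qed

text \<open>As for the quadratic form. The vector \<open>v\<close> may be random as long as it is a
  function of \<open>Y\<close>, since the unitaries do not move it.\<close>

lemma bilinear_form_moment:
  assumes M: "prob_space M" and inv: "left_invariant M d N B"
    and ind: "indep_pair M (mat_space d N) B S Y"
    and iso: "AE w in M. isometric d N (B w)"
    and D: "\<And>k. k < N \<Longrightarrow> (\<lambda>y. D y k) \<in> borel_measurable S"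
    and v: "\<And>k. k < N \<Longrightarrow> (\<lambda>y. v y k) \<in> borel_measurable S"
    and vV: "AE w in M. (\<Sum>k<N. (cmod (v (Y w) k))\<^sup>2) \<le> V"
    and d: "0 < d"
  shows "(\<integral>\<^sup>+w. ennreal (of_bool (\<forall>k<N. \<bar>D (Y w) k\<bar> \<le> Dm) *
      (cmod (\<Sum>k<N. of_real (D (Y w) k) * (cnj (hat d (B w) p k) * v (Y w) k))) ^ 4) \<partial>M)
    \<le> ennreal (12 * (\<Sum>a<d. (cmod (p a))\<^sup>2)\<^sup>2 * Dm ^ 4 * V\<^sup>2 / (real d)\<^sup>2)"
proof -
  define P where "P = (\<Sum>a<d. (cmod (p a))\<^sup>2)"
  have P: "0 \<le> P" unfolding P_def by (intro sum_nonneg) auto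
  obtain U where U: "\<And>A. unitary_mat d (U A)"
    "\<And>A B N k. B \<in> carrier_mat d N \<Longrightarrow> k < N \<Longrightarrow> hat d (U A * B) p k = hat d B (flat_signs d P A) k"
    using flat_unitaries[OF d, of p] unfolding P_def by metis
  define F where "F = (\<lambda>x. ennreal ((\<lambda>(A, y). of_bool (\<forall>k<N. \<bar>D y k\<bar> \<le> Dm) *
      (cmod (\<Sum>k<N. of_real (D y k) * (cnj (hat d A p k) * v y k))) ^ 4) x))"
  have F: "F \<in> borel_measurable (mat_space d N \<Otimes>\<^sub>M S)"
    unfolding F_def by (rule measurable_compose[OF measurable_bilinear_form[OF D v] measurable_ennreal])
  have "(\<integral>\<^sup>+w. F (B w, Y w) \<partial>M) \<le> ennreal (12 * P\<^sup>2 * Dm ^ 4 * V\<^sup>2 / (real d)\<^sup>2)"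
  proof (rule nn_integral_le_sign_average[OF M inv ind F U(1)])
    have B: "B \<in> M \<rightarrow>\<^sub>M mat_space d N" using inv unfolding left_invariant_def by simp
    have "AE w in M. B w \<in> carrier_mat d N"
      using measurable_space[OF B] by (intro AE_I2) (simp add: space_mat_space)
    then show "AE w in M. (\<Sum>A\<in>Pow {..<d}. F (U A * B w, Y w)) \<le> ennreal (2 ^ d * (12 * P\<^sup>2 * Dm ^ 4 * V\<^sup>2 / (real d)\<^sup>2))"
      using iso vV
    proof eventually_elim
      case (elim w)
      show ?case
      proof (cases "\<forall>k<N. \<bar>D (Y w) k\<bar> \<le> Dm")
        case True
        have "(\<Sum>A\<in>Pow {..<d}. F (U A * B w, Y w)) = ennreal (\<Sum>A\<in>Pow {..<d}.
           (cmod (\<Sum>k<N. of_real (D (Y w) k) * (cnj (hat d (B w) (flat_signs d P A) k) * v (Y w) k))) ^ 4)"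
          unfolding F_def using True U(2)[OF elim(1)] by (simp add: sum_ennreal)
        also have "\<dots> \<le> ennreal (2 ^ d * (12 * P\<^sup>2 * Dm ^ 4 * V\<^sup>2 / (real d)\<^sup>2))"
          using True elim d P by (intro ennreal_leI bilinear_form_flat_moment) auto
        finally show ?thesis .
      qed (auto simp: F_def)
    qed
  qed (use P in auto)
  then show ?thesis unfolding F_def P_def by simp
qed

text \<open>A tail of the series of the \<open>X n\<close> has finite expectation, so it converges
  almost surely and its terms tend to 0.\<close>

lemma AE_tendsto_zero_of_summable_moments:
  fixes X :: "nat \<Rightarrow> 'w \<Rightarrow> real"
  assumes X: "\<And>n. X n \<in> borel_measurable M" "\<And>n w. 0 \<le> X n w"
    and le: "\<forall>\<^sub>F n in sequentially. (\<integral>\<^sup>+w. ennreal (X n w) \<partial>M) \<le> ennreal (C / (real n)\<^sup>2)"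
  shows "AE w in M. (\<lambda>n. X n w) \<longlonglongrightarrow> 0"
proof -
  obtain m where m: "\<And>n. n \<ge> m \<Longrightarrow> (\<integral>\<^sup>+w. ennreal (X n w) \<partial>M) \<le> ennreal (C / (real n)\<^sup>2)"
    using le unfolding eventually_sequentially by blast
  have "(\<integral>\<^sup>+w. (\<Sum>n. ennreal (X (n + Suc m) w)) \<partial>M) = (\<Sum>n. \<integral>\<^sup>+w. ennreal (X (n + Suc m) w) \<partial>M)"
    by (rule nn_integral_suminf) (use X in auto)
  also have "\<dots> \<le> (\<Sum>n. ennreal (\<bar>C\<bar> / (real (n + Suc m))\<^sup>2))"
    by (intro suminf_le order_trans[OF m] ennreal_leI divide_right_mono) auto
  also have "\<dots> < \<infinity>"
  proof -
    have "summable (\<lambda>n. \<bar>C\<bar> * (1 / real n ^ 2))"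
      using inverse_power_summable[of 2, where 'a = real] by (intro summable_mult) (simp add: inverse_eq_divide)
    then have "summable (\<lambda>n. \<bar>C\<bar> / (real n)\<^sup>2)" by simp
    then have "summable (\<lambda>n. \<bar>C\<bar> / (real (n + Suc m))\<^sup>2)" by (rule summable_ignore_initial_segment)
    then show ?thesis using suminf_ennreal2 by (simp add: ennreal_less_top)
  qed
  finally have "AE w in M. (\<Sum>n. ennreal (X (n + Suc m) w)) \<noteq> \<infinity>"
    using X by (intro nn_integral_PInf_AE) auto
  then show ?thesis
  proof eventually_elim
    case (elim w)
    then have "summable (\<lambda>n. X (n + Suc m) w)" using X(2) by (intro summable_suminf_not_top) auto
    then have "(\<lambda>n. X (n + Suc m) w) \<longlonglongrightarrow> 0" by (rule summable_LIMSEQ_zero)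
    then show ?case by (rule LIMSEQ_offset)
  qed
qed

section \<open>Almost sure concentration\<close>

lemma le_divide_square_of_linear_growth:
  assumes "0 < \<delta>" "\<delta> * real n \<le> real d" "0 < n" "0 \<le> c"
  shows "c / (real d)\<^sup>2 \<le> c / \<delta>\<^sup>2 / (real n)\<^sup>2"
proof -
  have "(\<delta> * real n)\<^sup>2 \<le> (real d)\<^sup>2" using assms by (intro power_mono) auto
  moreover have \<delta>n: "0 < \<delta> * real n" using assms by simp
  moreover have "0 < real d" using \<delta>n assms(2) by linarith
  ultimately have "c / (real d)\<^sup>2 \<le> c / (\<delta> * real n)\<^sup>2"
    using assms by (intro divide_left_mono mult_pos_pos zero_less_power) auto
  then show ?thesis by (simp add: power_mult_distrib)
qed

lemma linear_growth_of_ratio: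
  assumes "(\<lambda>n. real (N n) / real n) \<longlonglongrightarrow> c" "0 < c"
  shows "\<forall>\<^sub>F n in sequentially. c / 2 * real n \<le> real (N n)"
    and "\<forall>\<^sub>F n in sequentially. m \<le> N n"
proof -
  have "\<forall>\<^sub>F n in sequentially. c / 2 < real (N n) / real n"
    using assms(2) by (intro order_tendstoD(1)[OF assms(1)]) auto
  then show lin: "\<forall>\<^sub>F n in sequentially. c / 2 * real n \<le> real (N n)"
    using eventually_gt_at_top[of 0] by eventually_elim (simp add: field_simps)
  obtain n0 :: nat where n0: "real m / (c / 2) \<le> real n0" using real_arch_simple by blast
  show "\<forall>\<^sub>F n in sequentially. m \<le> N n" using lin eventually_ge_at_top[of n0]
  proof eventually_elim
    case (elim n)
    have "real m \<le> c / 2 * real n0" using n0 assms(2) by (simp add: field_simps)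
    also have "\<dots> \<le> c / 2 * real n" using elim(2) assms(2) by (intro mult_left_mono) auto
    finally show ?case using elim(1) by linarith
  qed
qed

text \<open>The bound may depend on the point, but natural truncation levels suffice: outside one
  null set all levels work, and at a given point a level above its bound makes the indicator
  eventually equal to 1.\<close>

lemma AE_ex_nat_bound:
  fixes a :: "nat \<Rightarrow> nat \<Rightarrow> 'w \<Rightarrow> real" and X :: "nat \<Rightarrow> 'w \<Rightarrow> real"
  assumes K: "AE w in M. \<exists>K. \<forall>\<^sub>F n in sequentially. \<forall>k<N n. \<bar>a n k w\<bar> \<le> K"
    and X: "\<And>K::nat. AE w in M. (\<lambda>n. of_bool (\<forall>k<N n. \<bar>a n k w ^ m\<bar> \<le> real K ^ m) * X n w ^ 4) \<longlonglongrightarrow> 0"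
  shows "AE w in M. (\<lambda>n. X n w) \<longlonglongrightarrow> 0"
proof -
  have "AE w in M. \<forall>K::nat. (\<lambda>n. of_bool (\<forall>k<N n. \<bar>a n k w ^ m\<bar> \<le> real K ^ m) * X n w ^ 4) \<longlonglongrightarrow> 0"
    using X by (simp add: AE_all_countable)
  then show ?thesis using K
  proof eventually_elim
    case (elim w)
    then obtain K where K: "\<forall>\<^sub>F n in sequentially. \<forall>k<N n. \<bar>a n k w\<bar> \<le> K" by blast
    obtain K' :: nat where K': "K \<le> real K'" using real_arch_simple by blast
    have "\<forall>\<^sub>F n in sequentially. of_bool (\<forall>k<N n. \<bar>a n k w ^ m\<bar> \<le> real K' ^ m) * X n w ^ 4 = X n w ^ 4"
      using K
    proof eventually_elim
      case (elim n)
      have "\<bar>a n k w ^ m\<bar> \<le> real K' ^ m" if "k < N n" for k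
        using elim[rule_format, OF that] K' unfolding power_abs by (intro power_mono) auto
      then show ?case by simp
    qed
    then have "(\<lambda>n. X n w ^ 4) \<longlonglongrightarrow> 0"
      using elim(1)[rule_format, of K'] by (rule Lim_transform_eventually[rotated])
    \<comment> \<open>Two square roots undo the fourth power.\<close>
    then have "(\<lambda>n. sqrt (sqrt (X n w ^ 4))) \<longlonglongrightarrow> sqrt (sqrt 0)" by (intro tendsto_real_sqrt)
    moreover have "sqrt (sqrt (x ^ 4)) = \<bar>x\<bar>" for x :: real
    proof -
      have "x ^ 4 = (x\<^sup>2)\<^sup>2" by simp
      then show ?thesis by (simp only: real_sqrt_abs abs_power2)
    qed
    ultimately have "(\<lambda>n. \<bar>X n w\<bar>) \<longlonglongrightarrow> 0" by simp
    then show ?case by (simp only: tendsto_rabs_zero_iff)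
  qed
qed

text \<open>Linear growth of \<open>d n\<close> turns the moment bound of order
  \<open>1 / (d n)\<^sup>2\<close> into a summable one; \<open>K\<close> then removes the
  truncation.\<close>

lemma quadratic_form_concentration:
  fixes \<gamma> :: "nat \<Rightarrow> 'y \<Rightarrow> nat \<Rightarrow> real"
  assumes M: "prob_space M" and inv: "\<And>n. left_invariant M (d n) (N n) (B n)"
    and ind: "\<And>n. indep_pair M (mat_space (d n) (N n)) (B n) (S n) (Y n)"
    and iso: "\<And>n. AE w in M. isometric (d n) (N n) (B n w)"
    and \<gamma>: "\<And>n k. k < N n \<Longrightarrow> (\<lambda>y. \<gamma> n y k) \<in> borel_measurable (S n)"
    and dN: "\<And>n. N n \<le> d n" and d: "0 < \<delta>" "\<forall>\<^sub>F n in sequentially. \<delta> * real n \<le> real (d n)"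
    and K: "AE w in M. \<exists>K. \<forall>\<^sub>F n in sequentially. \<forall>k<N n. \<bar>\<gamma> n (Y n w) k\<bar> \<le> K"
    and p: "\<forall>\<^sub>F n in sequentially. (\<Sum>a<d n. (cmod (p n a))\<^sup>2) \<le> C"
  shows "AE w in M. (\<lambda>n. (\<Sum>k<N n. \<gamma> n (Y n w) k ^ m * (cmod (hat (d n) (B n w) (p n) k))\<^sup>2)
     - (\<Sum>a<d n. (cmod (p n a))\<^sup>2) / d n * (\<Sum>k<N n. \<gamma> n (Y n w) k ^ m)) \<longlonglongrightarrow> 0"
proof (rule AE_ex_nat_bound[OF K, where m = m])
  fix K :: nat
  define P where "P n = (\<Sum>a<d n. (cmod (p n a))\<^sup>2)" for n
  interpret prob_space M by (rule M)
  have D: "(\<lambda>y. \<gamma> n y k ^ m) \<in> borel_measurable (S n)" if "k < N n" for n k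
    using \<gamma>[OF that] by simp
  show "AE w in M. (\<lambda>n. of_bool (\<forall>k<N n. \<bar>\<gamma> n (Y n w) k ^ m\<bar> \<le> real K ^ m) *
      ((\<Sum>k<N n. \<gamma> n (Y n w) k ^ m * (cmod (hat (d n) (B n w) (p n) k))\<^sup>2)
     - P n / d n * (\<Sum>k<N n. \<gamma> n (Y n w) k ^ m)) ^ 4) \<longlonglongrightarrow> 0"
  proof (rule AE_tendsto_zero_of_summable_moments[where C = "432 * C ^ 4 * (real K ^ m) ^ 4 / \<delta>\<^sup>2"])
    fix n
    have B: "B n \<in> M \<rightarrow>\<^sub>M mat_space (d n) (N n)" using inv[of n] unfolding left_invariant_def by simp
    have Y: "Y n \<in> M \<rightarrow>\<^sub>M S n" using ind unfolding indep_pair_def by blast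
    show "(\<lambda>w. of_bool (\<forall>k<N n. \<bar>\<gamma> n (Y n w) k ^ m\<bar> \<le> real K ^ m) *
      ((\<Sum>k<N n. \<gamma> n (Y n w) k ^ m * (cmod (hat (d n) (B n w) (p n) k))\<^sup>2)
     - P n / d n * (\<Sum>k<N n. \<gamma> n (Y n w) k ^ m)) ^ 4) \<in> borel_measurable M"
      using measurable_compose[OF measurable_Pair[OF B Y]
          measurable_quadratic_form[where D = "\<lambda>y k. \<gamma> n y k ^ m" and N = "N n" and S = "S n"
            and Dm = "real K ^ m" and d = "d n" and p = "p n" and P = "P n / d n", OF D]] by (simp only: prod.case)
  next
    show "\<forall>\<^sub>F n in sequentially. (\<integral>\<^sup>+w. ennreal (of_bool (\<forall>k<N n. \<bar>\<gamma> n (Y n w) k ^ m\<bar> \<le> real K ^ m) *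
      ((\<Sum>k<N n. \<gamma> n (Y n w) k ^ m * (cmod (hat (d n) (B n w) (p n) k))\<^sup>2)
     - P n / d n * (\<Sum>k<N n. \<gamma> n (Y n w) k ^ m)) ^ 4) \<partial>M) \<le> ennreal (432 * C ^ 4 * (real K ^ m) ^ 4 / \<delta>\<^sup>2 / (real n)\<^sup>2)"
      using d(2) p eventually_gt_at_top[of 0]
    proof eventually_elim
      case (elim n)
      have dp: "0 < d n" using less_le_trans[OF mult_pos_pos[of \<delta> "real n"] elim(1)] elim(3) d(1) by simp
      have P: "0 \<le> P n" "P n \<le> C" using elim unfolding P_def by (auto intro: sum_nonneg)
      have "(\<integral>\<^sup>+w. ennreal (of_bool (\<forall>k<N n. \<bar>\<gamma> n (Y n w) k ^ m\<bar> \<le> real K ^ m) *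
      ((\<Sum>k<N n. \<gamma> n (Y n w) k ^ m * (cmod (hat (d n) (B n w) (p n) k))\<^sup>2)
     - P n / d n * (\<Sum>k<N n. \<gamma> n (Y n w) k ^ m)) ^ 4) \<partial>M) \<le> ennreal (432 * P n ^ 4 * (real K ^ m) ^ 4 / (real (d n))\<^sup>2)"
        unfolding P_def by (rule quadratic_form_moment[where D = "\<lambda>y k. \<gamma> n y k ^ m", OF M inv ind iso D dN dp])
      also have "\<dots> \<le> ennreal (432 * C ^ 4 * (real K ^ m) ^ 4 / (real (d n))\<^sup>2)"
        using P by (intro ennreal_leI divide_right_mono mult_mono power_mono) auto
      also have "\<dots> \<le> ennreal (432 * C ^ 4 * (real K ^ m) ^ 4 / \<delta>\<^sup>2 / (real n)\<^sup>2)"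
        using elim d P by (intro ennreal_leI le_divide_square_of_linear_growth) auto
      finally show ?case .
    qed
  qed (auto simp: zero_le_even_power)
qed

text \<open>Polarisation: the quadratic case is applied to \<open>p + u * q\<close> for the four
  fourth roots of unity \<open>u\<close>, with energies at most \<open>4 * C\<close>.\<close>

lemma sesquilinear_form_concentration:
  fixes \<gamma> :: "nat \<Rightarrow> 'y \<Rightarrow> nat \<Rightarrow> real"
  assumes M: "prob_space M" and inv: "\<And>n. left_invariant M (d n) (N n) (B n)"
    and ind: "\<And>n. indep_pair M (mat_space (d n) (N n)) (B n) (S n) (Y n)"
    and iso: "\<And>n. AE w in M. isometric (d n) (N n) (B n w)"
    and \<gamma>: "\<And>n k. k < N n \<Longrightarrow> (\<lambda>y. \<gamma> n y k) \<in> borel_measurable (S n)"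
    and dN: "\<And>n. N n \<le> d n" and d: "0 < \<delta>" "\<forall>\<^sub>F n in sequentially. \<delta> * real n \<le> real (d n)"
    and K: "AE w in M. \<exists>K. \<forall>\<^sub>F n in sequentially. \<forall>k<N n. \<bar>\<gamma> n (Y n w) k\<bar> \<le> K"
    and p: "\<forall>\<^sub>F n in sequentially. (\<Sum>a<d n. (cmod (p n a))\<^sup>2) \<le> C"
    and q: "\<forall>\<^sub>F n in sequentially. (\<Sum>a<d n. (cmod (q n a))\<^sup>2) \<le> C"
  shows "AE w in M. (\<lambda>n. (\<Sum>k<N n. of_real (\<gamma> n (Y n w) k ^ m) *
        (cnj (hat (d n) (B n w) (p n) k) * hat (d n) (B n w) (q n) k))
     - (\<Sum>a<d n. cnj (p n a) * q n a) * of_real ((\<Sum>k<N n. \<gamma> n (Y n w) k ^ m) / d n)) \<longlonglongrightarrow> 0"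
proof -
  define E where "E p' n w = (\<Sum>k<N n. \<gamma> n (Y n w) k ^ m * (cmod (hat (d n) (B n w) p' k))\<^sup>2)
     - (\<Sum>a<d n. (cmod (p' a))\<^sup>2) / d n * (\<Sum>k<N n. \<gamma> n (Y n w) k ^ m)" for p' n w
  define s where "s u n a = p n a + u * q n a" for u n a
  have bound: "\<forall>\<^sub>F n in sequentially. (\<Sum>a<d n. (cmod (s u n a))\<^sup>2) \<le> 4 * C" if "cmod u = 1" for u
    using p q
  proof eventually_elim
    case (elim n)
    have "(\<Sum>a<d n. (cmod (s u n a))\<^sup>2) \<le> (\<Sum>a<d n. 2 * (cmod (p n a))\<^sup>2 + 2 * (cmod (q n a))\<^sup>2)"
    proof (rule sum_mono)
      fix a
      have "(cmod (s u n a))\<^sup>2 \<le> (cmod (p n a) + cmod (q n a))\<^sup>2"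
        unfolding s_def using norm_triangle_ineq[of "p n a" "u * q n a"] that
        by (intro power_mono) (auto simp: norm_mult)
      moreover have "0 \<le> (cmod (p n a) - cmod (q n a))\<^sup>2" by simp
      ultimately show "(cmod (s u n a))\<^sup>2 \<le> 2 * (cmod (p n a))\<^sup>2 + 2 * (cmod (q n a))\<^sup>2"
        by (simp add: power2_eq_square algebra_simps)
    qed
    also have "\<dots> \<le> 4 * C" using elim by (simp add: sum.distrib sum_distrib_left[symmetric])
    finally show ?case .
  qed
  have lim: "AE w in M. (\<lambda>n. E (s u n) n w) \<longlonglongrightarrow> 0" if "cmod u = 1" for u
    unfolding E_def by (rule quadratic_form_concentration[OF M inv ind iso \<gamma> dN d K bound[OF that]])
  have pol1: "cnj x * y = (of_real ((cmod (x + 1 * y))\<^sup>2) - of_real ((cmod (x + (- 1) * y))\<^sup>2)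
     - \<i> * of_real ((cmod (x + \<i> * y))\<^sup>2) + \<i> * of_real ((cmod (x + (- \<i>) * y))\<^sup>2)) / 4" for x y :: complex
    unfolding cnj_mult_cmod[symmetric] by (simp add: algebra_simps)
  have hs: "hat (d n) A (s u n) k = hat (d n) A (p n) k + u * hat (d n) A (q n) k" for n A u k
    unfolding hat_def s_def by (simp add: sum.distrib sum_distrib_left algebra_simps)
  have pol: "(\<Sum>k<N n. of_real (\<gamma> n (Y n w) k ^ m) *
        (cnj (hat (d n) (B n w) (p n) k) * hat (d n) (B n w) (q n) k))
     - (\<Sum>a<d n. cnj (p n a) * q n a) * of_real ((\<Sum>k<N n. \<gamma> n (Y n w) k ^ m) / d n)
     = (of_real (E (s 1 n) n w) - of_real (E (s (- 1) n) n w)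
        - \<i> * of_real (E (s \<i> n) n w) + \<i> * of_real (E (s (- \<i>) n) n w)) / 4" for n w
  proof -
    define g where "g k = complex_of_real (\<gamma> n (Y n w) k ^ m)" for k
    define z where "z u k = complex_of_real ((cmod (hat (d n) (B n w) (s u n) k))\<^sup>2)" for u k
    define y where "y u a = complex_of_real ((cmod (s u n a))\<^sup>2)" for u a
    define h where "h = complex_of_real ((\<Sum>k<N n. \<gamma> n (Y n w) k ^ m) / d n)"
    have E: "complex_of_real (E (s u n) n w) = (\<Sum>k<N n. g k * z u k) - (\<Sum>a<d n. y u a) * h" for u
      unfolding E_def g_def z_def y_def h_def by simp
    have 1: "cnj (hat (d n) (B n w) (p n) k) * hat (d n) (B n w) (q n) k
        = (z 1 k - z (- 1) k - \<i> * z \<i> k + \<i> * z (- \<i>) k) / 4" for k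
      unfolding z_def hs by (rule pol1)
    have 2: "cnj (p n a) * q n a = (y 1 a - y (- 1) a - \<i> * y \<i> a + \<i> * y (- \<i>) a) / 4" for a
      unfolding y_def s_def by (rule pol1)
    have f1: "(\<Sum>k<N n. g k * ((z 1 k - z (- 1) k - \<i> * z \<i> k + \<i> * z (- \<i>) k) / 4))
      = ((\<Sum>k<N n. g k * z 1 k) - (\<Sum>k<N n. g k * z (- 1) k) - \<i> * (\<Sum>k<N n. g k * z \<i> k) + \<i> * (\<Sum>k<N n. g k * z (- \<i>) k)) / 4"
      by (simp add: sum_divide_distrib[symmetric] sum_subtractf sum.distrib sum_distrib_left algebra_simps)
    have f2: "(\<Sum>a<d n. (y 1 a - y (- 1) a - \<i> * y \<i> a + \<i> * y (- \<i>) a) / 4)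
      = ((\<Sum>a<d n. y 1 a) - (\<Sum>a<d n. y (- 1) a) - \<i> * (\<Sum>a<d n. y \<i> a) + \<i> * (\<Sum>a<d n. y (- \<i>) a)) / 4"
      by (simp add: sum_divide_distrib[symmetric] sum_subtractf sum.distrib sum_distrib_left)
    show ?thesis
      unfolding 1 2 E g_def[symmetric] h_def[symmetric] f1 f2 by (simp add: field_simps)
  qed
  have "AE w in M. (\<lambda>n. E (s 1 n) n w) \<longlonglongrightarrow> 0" "AE w in M. (\<lambda>n. E (s (- 1) n) n w) \<longlonglongrightarrow> 0"
    "AE w in M. (\<lambda>n. E (s \<i> n) n w) \<longlonglongrightarrow> 0" "AE w in M. (\<lambda>n. E (s (- \<i>) n) n w) \<longlonglongrightarrow> 0"
    by (intro lim, simp)+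
  then show ?thesis
  proof eventually_elim
    case (elim w)
    have "(\<lambda>n. (of_real (E (s 1 n) n w) - of_real (E (s (- 1) n) n w)
        - \<i> * of_real (E (s \<i> n) n w) + \<i> * of_real (E (s (- \<i>) n) n w)) / 4)
        \<longlonglongrightarrow> (complex_of_real 0 - of_real 0 - \<i> * of_real 0 + \<i> * of_real 0) / 4"
      by (intro tendsto_intros elim) simp
    then show ?case unfolding pol by simp
  qed
qed

text \<open>Meant for a left source against a right one, which is a function of \<open>Y\<close>.
  Odd \<open>m\<close> matter here, because a right source carries one factor of the singular
  value.\<close>

lemma bilinear_form_concentration:
  fixes \<gamma> :: "nat \<Rightarrow> 'y \<Rightarrow> nat \<Rightarrow> real"
  assumes M: "prob_space M" and inv: "\<And>n. left_invariant M (d n) (N n) (B n)"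
    and ind: "\<And>n. indep_pair M (mat_space (d n) (N n)) (B n) (S n) (Y n)"
    and iso: "\<And>n. AE w in M. isometric (d n) (N n) (B n w)"
    and \<gamma>: "\<And>n k. k < N n \<Longrightarrow> (\<lambda>y. \<gamma> n y k) \<in> borel_measurable (S n)"
    and v: "\<And>n k. k < N n \<Longrightarrow> (\<lambda>y. v n y k) \<in> borel_measurable (S n)"
    and d: "0 < \<delta>" "\<forall>\<^sub>F n in sequentially. \<delta> * real n \<le> real (d n)"
    and K: "AE w in M. \<exists>K. \<forall>\<^sub>F n in sequentially. \<forall>k<N n. \<bar>\<gamma> n (Y n w) k\<bar> \<le> K"
    and p: "\<forall>\<^sub>F n in sequentially. (\<Sum>a<d n. (cmod (p n a))\<^sup>2) \<le> C"
    and vV: "\<forall>\<^sub>F n in sequentially. AE w in M. (\<Sum>k<N n. (cmod (v n (Y n w) k))\<^sup>2) \<le> V"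
  shows "AE w in M. (\<lambda>n. \<Sum>k<N n. of_real (\<gamma> n (Y n w) k ^ m) *
        (cnj (hat (d n) (B n w) (p n) k) * v n (Y n w) k)) \<longlonglongrightarrow> 0"
proof -
  have "AE w in M. (\<lambda>n. cmod (\<Sum>k<N n. of_real (\<gamma> n (Y n w) k ^ m) *
        (cnj (hat (d n) (B n w) (p n) k) * v n (Y n w) k))) \<longlonglongrightarrow> 0"
  proof (rule AE_ex_nat_bound[OF K, where m = m])
    fix K :: nat
    define P where "P n = (\<Sum>a<d n. (cmod (p n a))\<^sup>2)" for n
    interpret prob_space M by (rule M)
    have D: "(\<lambda>y. \<gamma> n y k ^ m) \<in> borel_measurable (S n)" if "k < N n" for n k
      using \<gamma>[OF that] by simp
    show "AE w in M. (\<lambda>n. of_bool (\<forall>k<N n. \<bar>\<gamma> n (Y n w) k ^ m\<bar> \<le> real K ^ m) *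
        (cmod (\<Sum>k<N n. of_real (\<gamma> n (Y n w) k ^ m) *
          (cnj (hat (d n) (B n w) (p n) k) * v n (Y n w) k))) ^ 4) \<longlonglongrightarrow> 0"
    proof (rule AE_tendsto_zero_of_summable_moments[where C = "12 * C\<^sup>2 * (real K ^ m) ^ 4 * V\<^sup>2 / \<delta>\<^sup>2"])
      fix n
      have B: "B n \<in> M \<rightarrow>\<^sub>M mat_space (d n) (N n)" using inv[of n] unfolding left_invariant_def by simp
      have Y: "Y n \<in> M \<rightarrow>\<^sub>M S n" using ind unfolding indep_pair_def by blast
      show "(\<lambda>w. of_bool (\<forall>k<N n. \<bar>\<gamma> n (Y n w) k ^ m\<bar> \<le> real K ^ m) *
        (cmod (\<Sum>k<N n. of_real (\<gamma> n (Y n w) k ^ m) *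
          (cnj (hat (d n) (B n w) (p n) k) * v n (Y n w) k))) ^ 4) \<in> borel_measurable M"
        using measurable_compose[OF measurable_Pair[OF B Y]
            measurable_bilinear_form[where D = "\<lambda>y k. \<gamma> n y k ^ m" and v = "v n" and N = "N n" and S = "S n"
              and Dm = "real K ^ m" and d = "d n" and p = "p n", OF D v]] by (simp only: prod.case)
    next
      show "\<forall>\<^sub>F n in sequentially. (\<integral>\<^sup>+w. ennreal (of_bool (\<forall>k<N n. \<bar>\<gamma> n (Y n w) k ^ m\<bar> \<le> real K ^ m) *
        (cmod (\<Sum>k<N n. of_real (\<gamma> n (Y n w) k ^ m) *
          (cnj (hat (d n) (B n w) (p n) k) * v n (Y n w) k))) ^ 4) \<partial>M)
        \<le> ennreal (12 * C\<^sup>2 * (real K ^ m) ^ 4 * V\<^sup>2 / \<delta>\<^sup>2 / (real n)\<^sup>2)"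
        using d(2) p vV eventually_gt_at_top[of 0]
      proof eventually_elim
        case (elim n)
        have dp: "0 < d n" using less_le_trans[OF mult_pos_pos[of \<delta> "real n"] elim(1)] elim(4) d(1) by simp
        have P: "0 \<le> P n" "P n \<le> C" using elim unfolding P_def by (auto intro: sum_nonneg)
        have "(\<integral>\<^sup>+w. ennreal (of_bool (\<forall>k<N n. \<bar>\<gamma> n (Y n w) k ^ m\<bar> \<le> real K ^ m) *
          (cmod (\<Sum>k<N n. of_real (\<gamma> n (Y n w) k ^ m) *
            (cnj (hat (d n) (B n w) (p n) k) * v n (Y n w) k))) ^ 4) \<partial>M)
          \<le> ennreal (12 * (P n)\<^sup>2 * (real K ^ m) ^ 4 * V\<^sup>2 / (real (d n))\<^sup>2)"
          unfolding P_def by (rule bilinear_form_moment[where D = "\<lambda>y k. \<gamma> n y k ^ m" and v = "v n", OF M inv ind iso D v elim(3) dp])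
        also have "\<dots> \<le> ennreal (12 * C\<^sup>2 * (real K ^ m) ^ 4 * V\<^sup>2 / (real (d n))\<^sup>2)"
          using P by (intro ennreal_leI divide_right_mono mult_right_mono mult_left_mono power_mono) auto
        also have "\<dots> \<le> ennreal (12 * C\<^sup>2 * (real K ^ m) ^ 4 * V\<^sup>2 / \<delta>\<^sup>2 / (real n)\<^sup>2)"
          using elim d P by (intro ennreal_leI le_divide_square_of_linear_growth) auto
        finally show ?case .
      qed
    qed auto
  qed
  then show ?thesis by (simp only: tendsto_norm_zero_iff)
qed

section \<open>Moments and continuous test functions\<close>

text \<open>Weierstrass approximation on the interval, with an error that the bounds on the weights
  and on \<open>\<zeta> n\<close> control uniformly in \<open>n\<close>. The factor
  \<open>\<zeta> n\<close> need not converge, hence the form of a difference.\<close>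

lemma weighted_sum_limit_of_moments:
  fixes N :: "nat \<Rightarrow> nat" and t :: "nat \<Rightarrow> nat \<Rightarrow> real" and w :: "nat \<Rightarrow> nat \<Rightarrow> complex" and f :: "real \<Rightarrow> real"
  assumes pi: "prob_space \<pi>" "sets \<pi> = sets borel" "AE x in \<pi>. x \<in> {a..b}"
    and tin: "\<forall>\<^sub>F n in sequentially. \<forall>k<N n. t n k \<in> {a..b}"
    and w: "\<forall>\<^sub>F n in sequentially. (\<Sum>k<N n. cmod (w n k)) \<le> C"
    and \<zeta>: "\<forall>\<^sub>F n in sequentially. cmod (\<zeta> n) \<le> C"
    and mom: "\<And>m. (\<lambda>n. (\<Sum>k<N n. of_real (t n k ^ m) * w n k) - \<zeta> n * of_real (\<integral>x. x ^ m \<partial>\<pi>)) \<longlonglongrightarrow> 0"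
    and f: "f \<in> borel_measurable borel" "continuous_on {a..b} f"
  shows "(\<lambda>n. (\<Sum>k<N n. of_real (f (t n k)) * w n k) - \<zeta> n * of_real (\<integral>x. f x \<partial>\<pi>)) \<longlonglongrightarrow> 0"
proof -
  interpret prob_space \<pi> by (rule pi)
  note int = integrable_AE_interval[OF pi]
  show ?thesis
  proof (rule LIMSEQ_I)
    fix e :: real assume e: "0 < e"
    \<comment> \<open>The approximation error enters twice, in the sum and in the integral, each
      time with at most \<open>e / 4\<close>; the polynomial part takes the remaining
      \<open>e / 2\<close>.\<close>
    define e' where "e' = e / (4 * (\<bar>C\<bar> + 1))"
    have e': "0 < e'" using e unfolding e'_def by simp
    have e'C: "e' * \<bar>C\<bar> \<le> e / 4"
    proof -
      have "e' * \<bar>C\<bar> \<le> e' * (\<bar>C\<bar> + 1)" using e' by (intro mult_left_mono) auto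
      also have "\<dots> = e / 4" unfolding e'_def by (simp add: field_simps add_nonneg_eq_0_iff)
      finally show ?thesis .
    qed
    obtain g where g: "real_polynomial_function g" "\<And>x. x \<in> {a..b} \<Longrightarrow> \<bar>f x - g x\<bar> < e'"
      using Stone_Weierstrass_real_polynomial_function[OF compact_Icc f(2) e'] by blast
    obtain c n0 where gs: "g = (\<lambda>x. \<Sum>i\<le>n0. c i * x ^ i)"
      using g(1) unfolding real_polynomial_function_iff_sum by blast
    have gc: "continuous_on {a..b} g" unfolding gs by (intro continuous_intros)
    have gm: "g \<in> borel_measurable borel" unfolding gs by measurable
    have gint: "(\<integral>x. g x \<partial>\<pi>) = (\<Sum>i\<le>n0. c i * (\<integral>x. x ^ i \<partial>\<pi>))"
      unfolding gs by (subst Bochner_Integration.integral_sum) (auto intro!: int continuous_intros integrable_mult_right)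
    have glim: "(\<lambda>n. (\<Sum>k<N n. of_real (g (t n k)) * w n k) - \<zeta> n * of_real (\<integral>x. g x \<partial>\<pi>)) \<longlonglongrightarrow> 0"
    proof -
      have "(\<lambda>n. \<Sum>i\<le>n0. of_real (c i) * ((\<Sum>k<N n. of_real (t n k ^ i) * w n k) - \<zeta> n * of_real (\<integral>x. x ^ i \<partial>\<pi>)))
        \<longlonglongrightarrow> (\<Sum>i\<le>n0. of_real (c i) * 0)"
        by (intro tendsto_sum tendsto_mult tendsto_const mom)
      moreover have "(\<Sum>i\<le>n0. of_real (c i) * ((\<Sum>k<N n. of_real (t n k ^ i) * w n k) - \<zeta> n * of_real (\<integral>x. x ^ i \<partial>\<pi>)))
         = (\<Sum>k<N n. of_real (g (t n k)) * w n k) - \<zeta> n * of_real (\<integral>x. g x \<partial>\<pi>)" for n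
      proof -
        have "(\<Sum>k<N n. of_real (g (t n k)) * w n k) = (\<Sum>k<N n. \<Sum>i\<le>n0. of_real (c i) * (of_real (t n k ^ i) * w n k))"
          unfolding gs by (simp add: sum_distrib_right sum_distrib_left mult_ac)
        also have "\<dots> = (\<Sum>i\<le>n0. of_real (c i) * (\<Sum>k<N n. of_real (t n k ^ i) * w n k))"
          unfolding sum_distrib_left by (rule sum.swap)
        finally show ?thesis unfolding gint
          by (simp add: right_diff_distrib sum_subtractf sum_distrib_left mult_ac)
      qed
      ultimately show ?thesis by simp
    qed
    have "\<bar>(\<integral>x. f x \<partial>\<pi>) - (\<integral>x. g x \<partial>\<pi>)\<bar> \<le> e'"
    proof -
      have "\<bar>\<integral>x. f x - g x \<partial>\<pi>\<bar> \<le> (\<integral>x. \<bar>f x - g x\<bar> \<partial>\<pi>)" by (rule integral_abs_bound)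
      also have "\<dots> \<le> (\<integral>x. e' \<partial>\<pi>)"
      proof (rule integral_mono_AE)
        show "AE x in \<pi>. \<bar>f x - g x\<bar> \<le> e'" using pi(3) by eventually_elim (use g(2) less_imp_le in blast)
        show "integrable \<pi> (\<lambda>x. \<bar>f x - g x\<bar>)"
          using int[OF f] int[OF gm gc] by (intro integrable_abs Bochner_Integration.integrable_diff)
      qed simp
      also have "\<dots> = e'" by (simp add: prob_space)
      finally show ?thesis using int[OF f] int[OF gm gc] by simp
    qed
    note fg = this
    have "\<forall>\<^sub>F n in sequentially. norm ((\<Sum>k<N n. of_real (g (t n k)) * w n k) - \<zeta> n * of_real (\<integral>x. g x \<partial>\<pi>)) < e / 2"
      using tendstoD[OF glim, of "e / 2"] e by (simp add: dist_norm)
    then have "\<forall>\<^sub>F n in sequentially. norm ((\<Sum>k<N n. of_real (f (t n k)) * w n k) - \<zeta> n * of_real (\<integral>x. f x \<partial>\<pi>) - 0) < e"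
      using tin w \<zeta>
    proof eventually_elim
      case (elim n)
      define F where "F = (\<Sum>k<N n. of_real (f (t n k)) * w n k)"
      define G where "G = (\<Sum>k<N n. of_real (g (t n k)) * w n k)"
      have "norm (F - G) = norm (\<Sum>k<N n. of_real (f (t n k) - g (t n k)) * w n k)"
        unfolding F_def G_def by (simp add: sum_subtractf algebra_simps)
      also have "\<dots> \<le> (\<Sum>k<N n. e' * cmod (w n k))"
      proof (rule sum_norm_le)
        fix k assume "k \<in> {..<N n}"
        then have "\<bar>f (t n k) - g (t n k)\<bar> \<le> e'" using elim(2) g(2) by (meson lessThan_iff less_imp_le)
        then show "norm (of_real (f (t n k) - g (t n k)) * w n k) \<le> e' * cmod (w n k)"
          unfolding norm_mult norm_of_real by (intro mult_right_mono) auto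
      qed
      also have "\<dots> \<le> e' * \<bar>C\<bar>" unfolding sum_distrib_left[symmetric] using elim(3) e' by (intro mult_left_mono) auto
      finally have 1: "norm (F - G) \<le> e / 4" using e'C by simp
      have "norm (\<zeta> n * of_real (\<integral>x. f x \<partial>\<pi>) - \<zeta> n * of_real (\<integral>x. g x \<partial>\<pi>)) = cmod (\<zeta> n) * \<bar>(\<integral>x. f x \<partial>\<pi>) - (\<integral>x. g x \<partial>\<pi>)\<bar>"
        by (metis norm_mult norm_of_real of_real_diff right_diff_distrib)
      also have "\<dots> \<le> \<bar>C\<bar> * e'" using elim(4) fg by (intro mult_mono) auto
      finally have 2: "norm (\<zeta> n * of_real (\<integral>x. f x \<partial>\<pi>) - \<zeta> n * of_real (\<integral>x. g x \<partial>\<pi>)) \<le> e / 4"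
        using e'C by (simp add: mult.commute)
      have "norm (F - \<zeta> n * of_real (\<integral>x. f x \<partial>\<pi>)) \<le> norm (F - G)
          + norm (G - \<zeta> n * of_real (\<integral>x. g x \<partial>\<pi>))
          + norm (\<zeta> n * of_real (\<integral>x. f x \<partial>\<pi>) - \<zeta> n * of_real (\<integral>x. g x \<partial>\<pi>))"
        by norm
      also have "\<dots> < e / 4 + e / 2 + e / 4" using 1 2 elim(1) unfolding G_def by linarith
      finally show ?case unfolding F_def by simp
    qed
    then show "\<exists>no. \<forall>n\<ge>no. norm ((\<Sum>k<N n. of_real (f (t n k)) * w n k) - \<zeta> n * of_real (\<integral>x. f x \<partial>\<pi>) - 0) < e"
      unfolding eventually_sequentially by blast
  qed
qed

text \<open>The quotient is \<open>1 / (1 - s)\<close> with \<open>s\<close> purely imaginary, so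
  the denominator has modulus at least 1 and the geometric remainder is bounded without assuming
  \<open>K < y\<close>.\<close>

lemma stieltjes_geometric_remainder:
  assumes "0 < y" "\<bar>x\<bar> \<le> K"
  shows "cmod ((- (\<i> * of_real y)) / (of_real x - \<i> * of_real y) - (\<Sum>l\<le>k. (of_real x / (\<i> * of_real y)) ^ l))
    \<le> (K / y) ^ Suc k"
proof -
  define s where "s = complex_of_real x / (\<i> * of_real y)"
  have y: "\<i> * complex_of_real y \<noteq> 0" using assms(1) by simp
  have "Re s = 0" unfolding s_def by (simp add: Re_divide)
  then have "1 \<le> cmod (1 - s)" using abs_Re_le_cmod[of "1 - s"] by simp
  then have s1: "1 - s \<noteq> 0" "s \<noteq> 1" by auto
  have "(- (\<i> * of_real y)) / (of_real x - \<i> * of_real y) = 1 / (1 - s)"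
  proof -
    have "of_real x - \<i> * of_real y = - (\<i> * of_real y) * (1 - s)"
      using y unfolding s_def by (simp add: right_diff_distrib)
    then show ?thesis using y by simp
  qed
  moreover have "(\<Sum>l\<le>k. s ^ l) = (1 - s ^ Suc k) / (1 - s)"
    unfolding lessThan_Suc_atMost[symmetric] using sum_gp_strict[of s "Suc k"] s1 by simp
  ultimately have "(- (\<i> * of_real y)) / (of_real x - \<i> * of_real y) - (\<Sum>l\<le>k. s ^ l) = s ^ Suc k / (1 - s)"
    using s1 by (simp add: diff_divide_distrib[symmetric])
  then have "cmod ((- (\<i> * of_real y)) / (of_real x - \<i> * of_real y) - (\<Sum>l\<le>k. s ^ l)) = cmod s ^ Suc k / cmod (1 - s)"
    by (simp only: norm_divide norm_power)
  also have "\<dots> \<le> cmod s ^ Suc k" using \<open>1 \<le> cmod (1 - s)\<close>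
    divide_left_mono[of 1 "cmod (1 - s)" "cmod s ^ Suc k"] s1 by simp
  also have "\<dots> \<le> (K / y) ^ Suc k"
    using assms by (intro power_mono) (auto simp: s_def norm_divide norm_mult divide_right_mono)
  finally show ?thesis unfolding s_def .
qed

text \<open>Expansion of the transform at \<i> times a large natural number \<open>y\<close>. The
  moments below \<open>m\<close> converge by induction and the transforms by hypothesis; after
  multiplication by \<open>y ^ m\<close> the remainder is of order \<open>1 / y\<close>.\<close>

lemma moments_of_stieltjes:
  fixes N :: "nat \<Rightarrow> nat" and t :: "nat \<Rightarrow> nat \<Rightarrow> real"
  assumes pi: "prob_space \<pi>" "sets \<pi> = sets borel" "AE x in \<pi>. \<bar>x\<bar> \<le> K"
    and tin: "\<forall>\<^sub>F n in sequentially. \<forall>k<N n. \<bar>t n k\<bar> \<le> K"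
    and lim: "\<And>y::nat. 0 < y \<Longrightarrow> (\<lambda>n. (\<Sum>k<N n. 1 / (of_real (t n k) - \<i> * of_nat y)) / of_nat (N n))
        \<longlonglongrightarrow> (\<integral>x. 1 / (of_real x - \<i> * of_nat y) \<partial>\<pi>)"
    and N: "\<forall>\<^sub>F n in sequentially. 0 < N n"
  shows "(\<lambda>n. (\<Sum>k<N n. t n k ^ m) / N n) \<longlonglongrightarrow> (\<integral>x. x ^ m \<partial>\<pi>)"
proof (induction m rule: less_induct)
  case (less m)
  interpret prob_space \<pi> by (rule pi)
  define \<mu> where "\<mu> l = (\<integral>x. x ^ l \<partial>\<pi>)" for l
  define \<mu>n where "\<mu>n l n = (\<Sum>k<N n. t n k ^ l) / N n" for l n
  have pm: "h \<in> borel_measurable borel \<Longrightarrow> h \<in> borel_measurable \<pi>" for h :: "real \<Rightarrow> 'z::topological_space"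
    by (simp cong: measurable_cong_sets add: pi(2))
  have "\<exists>x. \<bar>x\<bar> \<le> K"
  proof (rule ccontr)
    assume "\<not> (\<exists>x. \<bar>x\<bar> \<le> K)"
    then have "AE x in \<pi>. False" using pi(3) by simp
    then show False by simp
  qed
  then have K0: "0 \<le> K" using abs_ge_zero order_trans by blast
  have intp: "integrable \<pi> (\<lambda>x. x ^ l)" for l
  proof (rule integrable_const_bound)
    show "AE x in \<pi>. norm (x ^ l) \<le> K ^ l" using pi(3)
      by eventually_elim (simp add: power_abs power_mono)
  qed (intro pm, measurable)
  define R where "R y x = (- (\<i> * complex_of_real y)) / (of_real x - \<i> * of_real y)
      - (\<Sum>l\<le>m. (of_real x / (\<i> * of_real y)) ^ l)" for y x
  show ?case unfolding \<mu>_def[symmetric] \<mu>n_def[symmetric]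
  proof (rule LIMSEQ_I)
    fix e :: real assume e: "0 < e"
    \<comment> \<open>The two remainders contribute \<open>2 * K ^ Suc m / y\<close> in total, which
      is at most \<open>e / 2\<close> for this choice.\<close>
    obtain y0 :: nat where y0: "y0 > 4 * K ^ Suc m / e" using reals_Archimedean2 by blast
    define y where "y = Suc y0"
    have y: "0 < y" "4 * K ^ Suc m / e < real y" using y0 unfolding y_def by auto
    have Ky: "K ^ Suc m / real y \<le> e / 4" using y e K0 by (simp add: field_simps)
    define z where "z = \<i> * complex_of_real (real y)"
    have z: "z \<noteq> 0" "cmod z = real y" using y unfolding z_def by (auto simp: norm_mult)
    define \<alpha> where "\<alpha> n = (\<Sum>k<N n. 1 / (of_real (t n k) - z)) / of_nat (N n)" for n
    define \<alpha>' where "\<alpha>' = (\<integral>x. 1 / (of_real x - z) \<partial>\<pi>)"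
    have \<alpha>: "\<alpha> \<longlonglongrightarrow> \<alpha>'" using lim[OF y(1)] unfolding \<alpha>_def \<alpha>'_def z_def by simp
    have Rb: "cmod (R (real y) x) \<le> (K / y) ^ Suc m" if "\<bar>x\<bar> \<le> K" for x
      unfolding R_def using stieltjes_geometric_remainder[of "real y" x K m] y that by simp
    have Rdec: "- z * (1 / (of_real x - z)) = (\<Sum>l\<le>m. of_real (x ^ l) / z ^ l) + R (real y) x" for x
      unfolding R_def z_def by (simp add: power_divide)
    have Rn: "- z * \<alpha> n = (\<Sum>l\<le>m. of_real (\<mu>n l n) / z ^ l) + (\<Sum>k<N n. R (real y) (t n k)) / of_nat (N n)" for n
    proof -
      have "- z * \<alpha> n = (\<Sum>k<N n. - z * (1 / (of_real (t n k) - z))) / of_nat (N n)"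
        unfolding \<alpha>_def by (simp add: sum_distrib_left sum_negf)
      also have "\<dots> = (\<Sum>k<N n. \<Sum>l\<le>m. of_real (t n k ^ l) / z ^ l) / of_nat (N n) + (\<Sum>k<N n. R (real y) (t n k)) / of_nat (N n)"
        unfolding Rdec by (simp add: sum.distrib add_divide_distrib)
      also have "(\<Sum>k<N n. \<Sum>l\<le>m. complex_of_real (t n k ^ l) / z ^ l) = (\<Sum>l\<le>m. \<Sum>k<N n. of_real (t n k ^ l) / z ^ l)"
        by (rule sum.swap)
      also have "\<dots> / of_nat (N n) = (\<Sum>l\<le>m. of_real (\<mu>n l n) / z ^ l)"
        unfolding \<mu>n_def by (simp add: sum_divide_distrib mult.commute)
      finally show ?thesis .
    qed
    have Rmeas: "R (real y) \<in> borel_measurable \<pi>"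
      unfolding R_def by (intro pm borel_measurable_diff borel_measurable_divide borel_measurable_sum
          borel_measurable_power borel_measurable_const borel_measurable_uminus
          borel_measurable_of_real)
    have Rint: "integrable \<pi> (R (real y))"
      by (rule integrable_const_bound[OF _ Rmeas]) (use pi(3) in eventually_elim, rule Rb)
    have R\<pi>: "- z * \<alpha>' = (\<Sum>l\<le>m. of_real (\<mu> l) / z ^ l) + (\<integral>x. R (real y) x \<partial>\<pi>)"
    proof -
      have i1: "integrable \<pi> (\<lambda>x. complex_of_real (x ^ l) / z ^ l)" for l
        using intp[of l] by (intro integrable_divide integrable_of_real)
      have "- z * \<alpha>' = (\<integral>x. - z * (1 / (of_real x - z)) \<partial>\<pi>)"
        unfolding \<alpha>'_def by (rule integral_mult_right_zero[symmetric])
      also have "\<dots> = (\<integral>x. (\<Sum>l\<le>m. of_real (x ^ l) / z ^ l) + R (real y) x \<partial>\<pi>)" unfolding Rdec ..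
      also have "\<dots> = (\<integral>x. (\<Sum>l\<le>m. of_real (x ^ l) / z ^ l) \<partial>\<pi>) + (\<integral>x. R (real y) x \<partial>\<pi>)"
        by (intro Bochner_Integration.integral_add Bochner_Integration.integrable_sum i1 Rint)
      also have "(\<integral>x. (\<Sum>l\<le>m. of_real (x ^ l) / z ^ l) \<partial>\<pi>) = (\<Sum>l\<le>m. (\<integral>x. complex_of_real (x ^ l) / z ^ l \<partial>\<pi>))"
        by (intro Bochner_Integration.integral_sum i1)
      also have "\<dots> = (\<Sum>l\<le>m. of_real (\<mu> l) / z ^ l)"
        unfolding \<mu>_def by (simp only: integral_divide_zero integral_complex_of_real)
      finally show ?thesis .
    qed
    \<comment> \<open>Collects, for fixed \<open>y\<close>, all of the error except the two
      remainders; it tends to 0 with \<open>n\<close>.\<close>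
    define \<Delta> where "\<Delta> n = cmod (- z * \<alpha> n - (- z * \<alpha>')) * real y ^ m + (\<Sum>l<m. \<bar>\<mu>n l n - \<mu> l\<bar> / real y ^ l) * real y ^ m" for n
    have "\<Delta> \<longlonglongrightarrow> cmod (- z * \<alpha>' - (- z * \<alpha>')) * real y ^ m + (\<Sum>l<m. \<bar>\<mu> l - \<mu> l\<bar> / real y ^ l) * real y ^ m"
      unfolding \<Delta>_def using less.IH y unfolding \<mu>_def[symmetric] \<mu>n_def[symmetric]
      by (intro tendsto_intros \<alpha>) auto
    then have "\<Delta> \<longlonglongrightarrow> 0" by simp
    then have "\<forall>\<^sub>F n in sequentially. \<Delta> n < e / 4" using e order_tendstoD(2)[of \<Delta> 0 sequentially "e / 4"] by simp
    then have "\<forall>\<^sub>F n in sequentially. norm (\<mu>n m n - \<mu> m) < e" using tin N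
    proof eventually_elim
      case (elim n)
      have r1: "cmod ((\<Sum>k<N n. R (real y) (t n k)) / of_nat (N n)) \<le> (K / y) ^ Suc m"
      proof -
        have "cmod (\<Sum>k<N n. R (real y) (t n k)) \<le> (\<Sum>k<N n. (K / y) ^ Suc m)"
          by (rule sum_norm_le) (use elim(2) Rb in auto)
        then show ?thesis using elim(3) by (simp add: norm_divide field_simps)
      qed
      have r2: "cmod (\<integral>x. R (real y) x \<partial>\<pi>) \<le> (K / y) ^ Suc m"
      proof -
        have "cmod (\<integral>x. R (real y) x \<partial>\<pi>) \<le> (\<integral>x. cmod (R (real y) x) \<partial>\<pi>)" by (rule integral_norm_bound)
        also have "\<dots> \<le> (\<integral>x. (K / y) ^ Suc m \<partial>\<pi>)"
        proof (rule integral_mono_AE)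
          show "AE x in \<pi>. cmod (R (real y) x) \<le> (K / y) ^ Suc m" using pi(3) by eventually_elim (rule Rb)
        qed (use Rint in \<open>auto intro: integrable_norm\<close>)
        also have "\<dots> = (K / y) ^ Suc m" by (simp add: prob_space)
        finally show ?thesis .
      qed
      have "of_real (\<mu>n m n - \<mu> m) / z ^ m = (- z * \<alpha> n - (- z * \<alpha>'))
         - (\<Sum>l<m. of_real (\<mu>n l n - \<mu> l) / z ^ l)
         - (\<Sum>k<N n. R (real y) (t n k)) / of_nat (N n) + (\<integral>x. R (real y) x \<partial>\<pi>)"
        unfolding Rn R\<pi> lessThan_Suc_atMost[symmetric]
        by (simp add: sum_subtractf diff_divide_distrib)
      then have "cmod (of_real (\<mu>n m n - \<mu> m) / z ^ m) \<le> cmod (- z * \<alpha> n - (- z * \<alpha>'))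
         + cmod (\<Sum>l<m. of_real (\<mu>n l n - \<mu> l) / z ^ l) + (K / y) ^ Suc m + (K / y) ^ Suc m"
      proof -
        have "cmod x \<le> cmod a + cmod b + cmod c + cmod d" if "x = a - b - c + d" for x a b c d :: complex
          unfolding that by (smt (verit) norm_triangle_ineq norm_triangle_ineq4)
        note tri = this
        assume "of_real (\<mu>n m n - \<mu> m) / z ^ m = (- z * \<alpha> n - (- z * \<alpha>'))
         - (\<Sum>l<m. of_real (\<mu>n l n - \<mu> l) / z ^ l)
         - (\<Sum>k<N n. R (real y) (t n k)) / of_nat (N n) + (\<integral>x. R (real y) x \<partial>\<pi>)"
        from tri[OF this] r1 r2 show ?thesis by linarith
      qed
      also have "cmod (\<Sum>l<m. of_real (\<mu>n l n - \<mu> l) / z ^ l) \<le> (\<Sum>l<m. \<bar>\<mu>n l n - \<mu> l\<bar> / real y ^ l)"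
        by (rule sum_norm_le) (unfold norm_divide norm_power z(2) norm_of_real, simp)
      finally have "\<bar>\<mu>n m n - \<mu> m\<bar> / real y ^ m \<le> cmod (- z * \<alpha> n - (- z * \<alpha>'))
         + (\<Sum>l<m. \<bar>\<mu>n l n - \<mu> l\<bar> / real y ^ l) + 2 * (K / y) ^ Suc m"
        unfolding norm_divide norm_power z(2) norm_of_real by simp
      then have "\<bar>\<mu>n m n - \<mu> m\<bar> \<le> (cmod (- z * \<alpha> n - (- z * \<alpha>'))
         + (\<Sum>l<m. \<bar>\<mu>n l n - \<mu> l\<bar> / real y ^ l) + 2 * (K / y) ^ Suc m) * real y ^ m"
        using y(1) by (simp add: divide_le_eq)
      also have "\<dots> = \<Delta> n + 2 * (K ^ Suc m / real y)"
        using y(1) unfolding \<Delta>_def by (simp add: distrib_right power_divide field_simps)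
      also have "\<dots> < e" using elim(1) Ky e by linarith
      finally show ?case by simp
    qed
    then show "\<exists>no. \<forall>n\<ge>no. norm (\<mu>n m n - \<mu> m) < e" unfolding eventually_sequentially by blast
  qed
qed

section \<open>The functions of the statement\<close>

context limit_law
begin

interpretation prob_space \<pi> by (rule pi)

lemma stieltjes_r_eq: "stieltjes_r \<pi> x = - rA x"
proof -
  have "(\<lambda>s. 1 / (s - x)) = (\<lambda>s. - (1 / (x - s)))" by (simp add: fun_eq_iff divide_simps)
  then show ?thesis unfolding stieltjes_r_def rA_def ilaw_def by simp
qed

text \<open>From \<open>s / (x - s) = x / (x - s) - 1\<close>. It reduces \<open>gfun\<close> to
  \<open>rA\<close>, whose derivative is then the only one computed by hand.\<close>

lemma rB_eq:
  assumes "T < x"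
  shows "rB x = c * (x * rA x - 1)"
proof -
  have ae: "AE s in \<pi>. c * (s * (1 / (x - s))) = c * (x * (1 / (x - s)) - 1)" using pi(3)
    by eventually_elim (use assms in \<open>simp add: field_simps\<close>)
  have "(\<integral>s. c * (s * (1 / (x - s))) \<partial>\<pi>) = (\<integral>s. c * (x * (1 / (x - s)) - 1) \<partial>\<pi>)"
    by (rule integral_cong_AE[OF borel_measurable_integrable borel_measurable_integrable ae])
      (intro integrable_shift[OF assms assms] integrable_mult_right Bochner_Integration.integrable_diff integrable_const)+
  also have "\<dots> = c * (x * rA x - 1)"
  proof -
    have "(\<integral>s. x * (1 / (x - s)) - 1 \<partial>\<pi>) = (\<integral>s. x * (1 / (x - s)) \<partial>\<pi>) - (\<integral>s. 1 \<partial>\<pi>)"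
      by (intro Bochner_Integration.integral_diff integrable_mult_right integrable_const integrable_shift(1)[OF assms assms])
    then show ?thesis unfolding rA_def ilaw_def if_False integral_mult_right_zero by (simp add: prob_space)
  qed
  finally show ?thesis unfolding rB_def ilaw_def by simp
qed

lemma rB2_eq:
  assumes "T < x"
  shows "rB2 x = c * (x * rA2 x - rA x)"
proof -
  have ae: "AE s in \<pi>. c * (s * (1 / (x - s) * (1 / (x - s)))) = c * (x * (1 / (x - s) * (1 / (x - s))) - 1 / (x - s))" using pi(3)
  proof eventually_elim
    case (elim s)
    define e where "e = 1 / (x - s)"
    have "s * e = x * e - 1" using elim assms unfolding e_def by (simp add: field_simps)
    then have "s * e * e = (x * e - 1) * e" by (rule arg_cong)
    then have "s * (e * e) = x * (e * e) - e" by (simp add: algebra_simps)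
    then show ?case unfolding e_def[symmetric] by (rule arg_cong)
  qed
  have "(\<integral>s. c * (s * (1 / (x - s) * (1 / (x - s)))) \<partial>\<pi>) = (\<integral>s. c * (x * (1 / (x - s) * (1 / (x - s))) - 1 / (x - s)) \<partial>\<pi>)"
    by (rule integral_cong_AE[OF borel_measurable_integrable borel_measurable_integrable ae])
      (intro integrable_shift[OF assms assms] integrable_mult_right Bochner_Integration.integrable_diff)+
  also have "\<dots> = c * (\<integral>s. x * (1 / (x - s) * (1 / (x - s))) - 1 / (x - s) \<partial>\<pi>)" by simp
  also have "(\<integral>s. x * (1 / (x - s) * (1 / (x - s))) - 1 / (x - s) \<partial>\<pi>)
     = (\<integral>s. x * (1 / (x - s) * (1 / (x - s))) \<partial>\<pi>) - (\<integral>s. 1 / (x - s) \<partial>\<pi>)"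
    by (intro Bochner_Integration.integral_diff integrable_mult_right integrable_shift[OF assms assms])
  also have "(\<integral>s. x * (1 / (x - s) * (1 / (x - s))) \<partial>\<pi>) = x * rA2 x"
    unfolding rA2_def ilaw_def if_False by (rule integral_mult_right_zero)
  finally show ?thesis unfolding rB2_def rA_def ilaw_def by simp
qed

lemma mtilde_eq:
  assumes "T < x"
  shows "x * mtilde c \<pi> x = - (1 + rB x)"
  using assms T unfolding mtilde_def stieltjes_r_eq rB_eq[OF assms] by (simp add: field_simps)

lemma gfun_eq:
  assumes "T < x"
  shows "gfun c \<pi> x = rg x"
proof -
  have "gfun c \<pi> x = stieltjes_r \<pi> x * (x * mtilde c \<pi> x)" unfolding gfun_def by (simp only: mult_ac)
  then show ?thesis unfolding mtilde_eq[OF assms] stieltjes_r_eq rg_def by (simp add: algebra_simps)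
qed

text \<open>Differentiation under the integral by an explicit estimate: the first order remainder of
  \<open>1 / (y - s)\<close> is \<open>(y - x)\<^sup>2\<close> divided by
  \<open>(y - s) * (x - s) * (x - s)\<close>, and all three factors exceed \<open>d\<close>.\<close>

lemma rA_deriv:
  assumes "T < x"
  shows "(rA has_real_derivative (- rA2 x)) (at x)"
proof -
  define d where "d = (x - T) / 2"
  have d: "0 < d" "T + d < x" "x = T + 2 * d" using assms unfolding d_def by (auto simp: field_simps)
  have key: "\<bar>rA y - rA x + (y - x) * rA2 x\<bar> \<le> (y - x)\<^sup>2 / d ^ 3" if y: "T + d < y" for y
  proof -
    have yT: "T < y" using y d by simp
    have "rA y - rA x + (y - x) * rA2 x = (\<integral>s. 1 / (y - s) \<partial>\<pi>) - (\<integral>s. 1 / (x - s) \<partial>\<pi>)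
        + (\<integral>s. (y - x) * (1 / (x - s) * (1 / (x - s))) \<partial>\<pi>)"
      unfolding rA_def rA2_def ilaw_def if_False integral_mult_right_zero ..
    also have "\<dots> = (\<integral>s. 1 / (y - s) - 1 / (x - s) + (y - x) * (1 / (x - s) * (1 / (x - s))) \<partial>\<pi>)"
    proof -
      have i: "integrable \<pi> (\<lambda>s. (y - x) * (1 / (x - s) * (1 / (x - s))))"
        by (intro integrable_mult_right integrable_shift assms)
      show ?thesis
        by (simp only: Bochner_Integration.integral_add[OF Bochner_Integration.integrable_diff[OF
              integrable_shift(1)[OF yT yT] integrable_shift(1)[OF assms assms]] i]
            Bochner_Integration.integral_diff[OF integrable_shift(1)[OF yT yT] integrable_shift(1)[OF assms assms]])
    qed
    finally have eq: "rA y - rA x + (y - x) * rA2 x = (\<integral>s. 1 / (y - s) - 1 / (x - s) + (y - x) * (1 / (x - s) * (1 / (x - s))) \<partial>\<pi>)" .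
    have "\<bar>rA y - rA x + (y - x) * rA2 x\<bar> \<le> (\<integral>s. \<bar>1 / (y - s) - 1 / (x - s) + (y - x) * (1 / (x - s) * (1 / (x - s)))\<bar> \<partial>\<pi>)"
      unfolding eq by (rule integral_abs_bound)
    also have "\<dots> \<le> (\<integral>s. (y - x)\<^sup>2 / d ^ 3 \<partial>\<pi>)"
    proof (rule integral_mono_AE)
      show "integrable \<pi> (\<lambda>s. \<bar>1 / (y - s) - 1 / (x - s) + (y - x) * (1 / (x - s) * (1 / (x - s)))\<bar>)"
        using integrable_shift(1)[OF yT yT] integrable_shift(1,3)[OF assms assms]
        by (intro integrable_abs Bochner_Integration.integrable_add Bochner_Integration.integrable_diff integrable_mult_right)
      show "AE s in \<pi>. \<bar>1 / (y - s) - 1 / (x - s) + (y - x) * (1 / (x - s) * (1 / (x - s)))\<bar> \<le> (y - x)\<^sup>2 / d ^ 3"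
        using pi(3)
      proof eventually_elim
        case (elim s)
        have s: "d < y - s" "d < x - s" using elim y d by auto
        then have pos: "0 < y - s" "0 < x - s" using d(1) by linarith+
        have "1 / a - 1 / b + (a - b) * (1 / b * (1 / b)) = (a - b)\<^sup>2 / (a * b * b)" if "0 < a" "0 < b" for a b :: real
          using that by (simp add: field_simps power2_eq_square)
        from this[OF pos] have "1 / (y - s) - 1 / (x - s) + (y - x) * (1 / (x - s) * (1 / (x - s))) = (y - x)\<^sup>2 / ((y - s) * (x - s) * (x - s))"
          by simp
        moreover have "0 \<le> (y - x)\<^sup>2 / ((y - s) * (x - s) * (x - s))" using pos by simp
        moreover have "d ^ 3 \<le> (y - s) * (x - s) * (x - s)"
          unfolding power3_eq_cube using s d(1) by (intro mult_mono) auto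
        then have "(y - x)\<^sup>2 / ((y - s) * (x - s) * (x - s)) \<le> (y - x)\<^sup>2 / d ^ 3"
          using d(1) pos by (intro divide_left_mono mult_pos_pos) auto
        ultimately show ?case by (simp only: abs_of_nonneg)
      qed
    qed simp
    also have "\<dots> = (y - x)\<^sup>2 / d ^ 3" by (simp add: prob_space)
    finally show ?thesis .
  qed
  have "((\<lambda>y. (rA y - rA x) / (y - x) - (- rA2 x)) \<longlongrightarrow> 0) (at x)"
  proof (rule Lim_null_comparison)
    have "\<forall>\<^sub>F y in at x. T + d < y"
      using d(2) by (intro order_tendstoD[OF tendsto_ident_at])
    then show "\<forall>\<^sub>F y in at x. norm ((rA y - rA x) / (y - x) - (- rA2 x)) \<le> \<bar>y - x\<bar> / d ^ 3"
      using eventually_neq_at_within[of x x UNIV]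
    proof eventually_elim
      case (elim y)
      have "(rA y - rA x) / (y - x) - (- rA2 x) = (rA y - rA x + (y - x) * rA2 x) / (y - x)"
        using elim by (simp add: field_simps)
      then have "norm ((rA y - rA x) / (y - x) - (- rA2 x)) = \<bar>rA y - rA x + (y - x) * rA2 x\<bar> / \<bar>y - x\<bar>"
        by (simp only: real_norm_def abs_divide)
      also have "\<dots> \<le> (y - x)\<^sup>2 / d ^ 3 / \<bar>y - x\<bar>" using key[OF elim(1)] by (intro divide_right_mono) auto
      also have "\<dots> = \<bar>y - x\<bar> / d ^ 3"
      proof -
        have "(y - x)\<^sup>2 = \<bar>y - x\<bar> * \<bar>y - x\<bar>" by (simp add: power2_eq_square abs_mult_self_eq)
        moreover have "a * a / e / a = a / e" if "a \<noteq> 0" for a e :: real using that by simp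
        from this[of "\<bar>y - x\<bar>" "d ^ 3"] have "\<bar>y - x\<bar> * \<bar>y - x\<bar> / d ^ 3 / \<bar>y - x\<bar> = \<bar>y - x\<bar> / d ^ 3"
          using elim(2) by simp
        ultimately show ?thesis by (simp only:)
      qed
      finally show ?case .
    qed
    have "((\<lambda>y. \<bar>y - x\<bar> / d ^ 3) \<longlongrightarrow> \<bar>x - x\<bar> / d ^ 3) (at x)"
      using d(1) by (intro tendsto_intros) auto
    then show "((\<lambda>y. \<bar>y - x\<bar> / d ^ 3) \<longlongrightarrow> 0) (at x)" by simp
  qed
  then have "((\<lambda>y. (rA y - rA x) / (y - x)) \<longlongrightarrow> - rA2 x) (at x)" by (rule LIM_zero_cancel)
  then show ?thesis by (simp add: has_field_derivative_iff)
qed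

lemma gfun_deriv:
  assumes "T < x"
  shows "deriv (gfun c \<pi>) x = - (rA x * rB2 x + rA2 x * (1 + rB x))"
proof (rule DERIV_imp_deriv)
  have "((\<lambda>y. rA y * (1 + c * (y * rA y - 1))) has_real_derivative
     ((- rA2 x) * (1 + c * (x * rA x - 1)) + (c * (1 * rA x + (- rA2 x) * x)) * rA x)) (at x)"
    by (auto intro!: derivative_eq_intros rA_deriv[OF assms] simp: algebra_simps)
  also have "(- rA2 x) * (1 + c * (x * rA x - 1)) + (c * (1 * rA x + (- rA2 x) * x)) * rA x
     = - (rA x * rB2 x + rA2 x * (1 + rB x))"
    unfolding rB_eq[OF assms] rB2_eq[OF assms] by (simp add: algebra_simps)
  finally have D: "((\<lambda>y. rA y * (1 + c * (y * rA y - 1))) has_real_derivative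
      - (rA x * rB2 x + rA2 x * (1 + rB x))) (at x)" .
  show "(gfun c \<pi> has_real_derivative - (rA x * rB2 x + rA2 x * (1 + rB x))) (at x)"
  proof (rule has_field_derivative_transform_within_open[OF D])
    show "open {T<..}" "x \<in> {T<..}" using assms by auto
    fix y assume "y \<in> {T<..}"
    then show "rA y * (1 + c * (y * rA y - 1)) = gfun c \<pi> y" by (simp add: gfun_eq rg_def rB_eq)
  qed
qed

text \<open>Numerator and derivative are both negative; the signs cancel and the constant found from
  the eigenvectors appears.\<close>

lemma spike_weight_eq:
  assumes "T < x"
  shows "x * (stieltjes_r \<pi> x)\<^sup>2 * mtilde c \<pi> x / deriv (gfun c \<pi>) x
    = (rA x)\<^sup>2 * (1 + rB x) / (rA x * rB2 x + rA2 x * (1 + rB x))"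
proof -
  have "x * (stieltjes_r \<pi> x)\<^sup>2 * mtilde c \<pi> x = (stieltjes_r \<pi> x)\<^sup>2 * (x * mtilde c \<pi> x)" by (simp only: mult_ac)
  also have "\<dots> = - ((rA x)\<^sup>2 * (1 + rB x))" unfolding stieltjes_r_eq mtilde_eq[OF assms] by (simp add: algebra_simps)
  finally show ?thesis unfolding gfun_deriv[OF assms] by (simp only: minus_divide_divide)
qed

end

section \<open>Blocks of equal limiting singular values\<close>

lemma blk_eqI:
  assumes "l < s" "(\<Sum>l'<l. j l') \<le> k" "k < (\<Sum>l'\<le>l. j l')"
  shows "blk j s k = l"
  unfolding blk_def
proof (rule the_equality)
  fix m assume m: "m < s \<and> (\<Sum>l'<m. j l') \<le> k \<and> k < (\<Sum>l'\<le>m. j l')"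
  show "m = l"
  proof (rule ccontr)
    assume "m \<noteq> l"
    then consider "m < l" | "l < m" by linarith
    then show False
    proof cases
      case 1
      then have "(\<Sum>l'\<le>m. j l') \<le> (\<Sum>l'<l. j l')" by (intro sum_mono2) auto
      then show False using m assms by linarith
    next
      case 2
      then have "(\<Sum>l'\<le>l. j l') \<le> (\<Sum>l'<m. j l')" by (intro sum_mono2) auto
      then show False using m assms by linarith
    qed
  qed
qed (use assms in auto)

text \<open>The block of \<open>k\<close> is the least \<open>l\<close> whose cumulative sum exceeds
  \<open>k\<close>; minimality gives the lower bound.\<close>

lemma blk_bounds:
  assumes "k < (\<Sum>l<s. j l)"
  shows "blk j s k < s" "(\<Sum>l'<blk j s k. j l') \<le> k" "k < (\<Sum>l'\<le>blk j s k. j l')"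
proof -
  have ex: "\<exists>l. k < (\<Sum>l'\<le>l. j l')"
  proof (cases s)
    case 0 then show ?thesis using assms by simp
  next
    case (Suc n) then show ?thesis using assms by (auto simp: lessThan_Suc_atMost)
  qed
  define l where "l = (LEAST l. k < (\<Sum>l'\<le>l. j l'))"
  have l: "k < (\<Sum>l'\<le>l. j l')" unfolding l_def by (rule LeastI_ex[OF ex])
  have lo: "(\<Sum>l'<l. j l') \<le> k"
  proof (cases l)
    case (Suc m)
    then have "\<not> k < (\<Sum>l'\<le>m. j l')" using not_less_Least[of m "\<lambda>l. k < (\<Sum>l'\<le>l. j l')"] unfolding l_def by simp
    then show ?thesis unfolding Suc lessThan_Suc_atMost by simp
  qed simp
  have "l < s"
  proof (rule ccontr)
    assume "\<not> l < s"
    then have "(\<Sum>l'<s. j l') \<le> (\<Sum>l'<l. j l')" by (intro sum_mono2) auto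
    then show False using lo assms by linarith
  qed
  then have "blk j s k = l" using blk_eqI l lo by blast
  then show "blk j s k < s" "(\<Sum>l'<blk j s k. j l') \<le> k" "k < (\<Sum>l'\<le>blk j s k. j l')"
    using l lo \<open>l < s\<close> by auto
qed

lemma blk_le_iff:
  assumes "k < (\<Sum>l<s. j l)"
  shows "blk j s k \<le> i \<longleftrightarrow> k < (\<Sum>l\<le>i. j l)" and "i \<le> blk j s k \<longleftrightarrow> (\<Sum>l<i. j l) \<le> k"
proof -
  note b = blk_bounds[OF assms]
  show "blk j s k \<le> i \<longleftrightarrow> k < (\<Sum>l\<le>i. j l)"
  proof
    assume "blk j s k \<le> i"
    then have "(\<Sum>l'\<le>blk j s k. j l') \<le> (\<Sum>l\<le>i. j l)" by (intro sum_mono2) auto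
    then show "k < (\<Sum>l\<le>i. j l)" using b by linarith
  next
    assume k: "k < (\<Sum>l\<le>i. j l)"
    show "blk j s k \<le> i"
    proof (rule ccontr)
      assume "\<not> blk j s k \<le> i"
      then have "(\<Sum>l\<le>i. j l) \<le> (\<Sum>l'<blk j s k. j l')" by (intro sum_mono2) auto
      then show False using b k by linarith
    qed
  qed
  show "i \<le> blk j s k \<longleftrightarrow> (\<Sum>l<i. j l) \<le> k"
  proof
    assume "i \<le> blk j s k"
    then have "(\<Sum>l<i. j l) \<le> (\<Sum>l'<blk j s k. j l')" by (intro sum_mono2) auto
    then show "(\<Sum>l<i. j l) \<le> k" using b by linarith
  next
    assume k: "(\<Sum>l<i. j l) \<le> k"
    show "i \<le> blk j s k"
    proof (rule ccontr)
      assume "\<not> i \<le> blk j s k"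
      then have "(\<Sum>l'\<le>blk j s k. j l') \<le> (\<Sum>l<i. j l)" by (intro sum_mono2) auto
      then show False using b k by linarith
    qed
  qed
qed

section \<open>From matrices to coordinates\<close>

lemma mat_mult_index:
  assumes "A \<in> carrier_mat m l" "B \<in> carrier_mat l n" "i < m" "j < n"
  shows "(A * B) $$ (i, j) = (\<Sum>k<l. A $$ (i, k) * B $$ (k, j))"
  using assms by (simp add: scalar_prod_def atLeast0LessThan)

lemma orthonormal_columns:
  fixes A :: "complex mat"
  assumes A: "A \<in> carrier_mat m r" "mat_adjoint A * A = 1\<^sub>m r" and "p < r" "q < r"
  shows "(\<Sum>a<m. cnj (A $$ (a, p)) * A $$ (a, q)) = (if p = q then 1 else 0)"
proof -
  have "(mat_adjoint A * A) $$ (p, q) = (\<Sum>a<m. mat_adjoint A $$ (p, a) * A $$ (a, q))"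
    by (rule mat_mult_index[OF mat_adjoint_carrier[OF A(1)] A(1) assms(3,4)])
  then show ?thesis unfolding A(2) using assms(3,4) by (simp add: mat_adjoint_index[OF A(1)])
qed

lemma unitary_mat_entries:
  assumes "unitary_mat d U"
  shows "isometric d d U"
    and "\<And>a b. a < d \<Longrightarrow> b < d \<Longrightarrow> (\<Sum>k<d. U $$ (a, k) * cnj (U $$ (b, k))) = (if a = b then 1 else 0)"
proof -
  have U: "U \<in> carrier_mat d d" and 1: "mat_adjoint U * U = 1\<^sub>m d" "U * mat_adjoint U = 1\<^sub>m d"
    using assms unfolding unitary_mat_def by auto
  show "isometric d d U" unfolding isometric_def using orthonormal_columns[OF U 1(1)] by blast
  have "(\<Sum>k<d. U $$ (a, k) * cnj (U $$ (b, k))) = (U * mat_adjoint U) $$ (a, b)" if "a < d" "b < d" for a b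
    using that U mat_adjoint_carrier[OF U] by (simp add: scalar_prod_def atLeast0LessThan mat_adjoint_index[OF U])
  then show "\<And>a b. a < d \<Longrightarrow> b < d \<Longrightarrow> (\<Sum>k<d. U $$ (a, k) * cnj (U $$ (b, k))) = (if a = b then 1 else 0)"
    unfolding 1 by simp
qed

lemma haar_left_invariant:
  assumes L: "L \<in> M \<rightarrow>\<^sub>M mat_space d d" and haar: "haar_unitary d (distr M (mat_space d d) L)"
  shows "left_invariant M d d L" "AE w in M. unitary_mat d (L w)"
proof -
  have "distr M (mat_space d d) (\<lambda>w. U * L w) = distr M (mat_space d d) L" if U: "unitary_mat d U" for U
  proof -
    have "U \<in> carrier_mat d d" using U unfolding unitary_mat_def by simp
    from distr_distr[OF measurable_unitary_mult[OF this] L] haar U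
    show ?thesis unfolding haar_unitary_def comp_def by simp
  qed
  then show "left_invariant M d d L" using L unfolding left_invariant_def by simp
  show "AE w in M. unitary_mat d (L w)"
    using haar unfolding haar_unitary_def by (intro AE_distrD[OF L]) simp
qed

text \<open>Selecting columns commutes with multiplication from the left, so left invariance passes
  from the square Haar matrix to \<open>R\<close>.\<close>

lemma haar_columns_left_invariant:
  assumes W: "W \<in> M \<rightarrow>\<^sub>M mat_space n n" and haar: "haar_unitary n (distr M (mat_space n n) W)"
    and cols: "inj_on cs {..<N}" "cs ` {..<N} \<subseteq> {..<n}"
  defines "R \<equiv> (\<lambda>w. mat n N (\<lambda>(a, b). W w $$ (a, cs b)))"
  shows "left_invariant M n N R" "AE w in M. isometric n N (R w)"
proof -
  define sub :: "complex mat \<Rightarrow> complex mat" where "sub A = mat n N (\<lambda>(a, b). A $$ (a, cs b))" for A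
  have cs: "cs b < n" if "b < N" for b using cols(2) that by auto
  have sub: "sub \<in> mat_space n n \<rightarrow>\<^sub>M mat_space n N"
    by (rule measurable_mat_space) (auto simp: sub_def intro!: measurable_entry cs)
  have R: "R = (\<lambda>w. sub (W w))" unfolding R_def sub_def ..
  have Wc: "W w \<in> carrier_mat n n" if "w \<in> space M" for w
    using measurable_space[OF W that] by (simp add: space_mat_space)
  have "distr M (mat_space n N) (\<lambda>w. U * R w) = distr M (mat_space n N) R" if U: "unitary_mat n U" for U
  proof -
    have Uc: "U \<in> carrier_mat n n" using U unfolding unitary_mat_def by simp
    have "distr M (mat_space n N) (\<lambda>w. U * R w) = distr M (mat_space n N) (\<lambda>w. sub (U * W w))"
    proof (rule distr_cong)
      fix w assume "w \<in> space M"
      then have "W w \<in> carrier_mat n n" by (rule Wc)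
      then show "U * R w = sub (U * W w)" unfolding R sub_def using Uc cs
        by (intro eq_matI) (auto simp: scalar_prod_def intro!: sum.cong)
    qed auto
    also have "\<dots> = distr (distr M (mat_space n n) (\<lambda>w. U * W w)) (mat_space n N) sub"
      using distr_distr[OF sub measurable_compose[OF W measurable_unitary_mult[OF Uc]]] by (simp add: comp_def)
    also have "distr M (mat_space n n) (\<lambda>w. U * W w) = distr M (mat_space n n) W"
      using haar_left_invariant(1)[OF W haar] U unfolding left_invariant_def by simp
    also have "distr (distr M (mat_space n n) W) (mat_space n N) sub = distr M (mat_space n N) R"
      unfolding R using distr_distr[OF sub W] by (simp add: comp_def)
    finally show ?thesis .
  qed
  moreover have "R \<in> M \<rightarrow>\<^sub>M mat_space n N" unfolding R by (rule measurable_compose[OF W sub])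
  ultimately show "left_invariant M n N R" unfolding left_invariant_def by simp
  have "AE w in M. unitary_mat n (W w)" by (rule haar_left_invariant(2)[OF W haar])
  then show "AE w in M. isometric n N (R w)"
  proof eventually_elim
    case (elim w)
    have "(\<Sum>a<n. cnj (R w $$ (a, k)) * R w $$ (a, l)) = (if k = l then 1 else 0)" if "k < N" "l < N" for k l
    proof -
      have "(\<Sum>a<n. cnj (R w $$ (a, k)) * R w $$ (a, l)) = (\<Sum>a<n. cnj (W w $$ (a, cs k)) * W w $$ (a, cs l))"
        using that unfolding R_def by (intro sum.cong) auto
      also have "\<dots> = (if cs k = cs l then 1 else 0)"
        using unitary_mat_entries(1)[OF elim] cs that unfolding isometric_def by simp
      finally show ?thesis using cols(1) that by (simp add: inj_on_eq_iff)
    qed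
    then show ?case unfolding isometric_def by simp
  qed
qed

text \<open>Groups the other factors into one variable with values in a product space, which plays
  the role of \<open>Y\<close>.\<close>

lemma indep_vars_indep_pair:
  assumes M: "prob_space M" and ind: "prob_space.indep_vars M M' X I"
    and "i \<in> I" "J \<subseteq> I" "i \<notin> J"
  shows "indep_pair M (M' i) (X i) (PiM J M') (\<lambda>w. \<lambda>j\<in>J. X j w)"
proof -
  have "prob_space.indep_var M (PiM {i} M') (\<lambda>w. \<lambda>j\<in>{i}. X j w) (PiM J M') (\<lambda>w. \<lambda>j\<in>J. X j w)"
    by (rule prob_space.indep_var_restrict[OF M ind]) (use assms in auto)
  from indep_pair_compose[OF M indep_pair_of_indep_var[OF M this], of "\<lambda>f. f i" "M' i"]
  show ?thesis by (simp add: measurable_component_singleton)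
qed

text \<open>Bessel's inequality, from the nonnegative squared distance between \<open>q\<close> and
  its projection on the columns of \<open>B\<close>.\<close>

lemma isometric_bessel:
  assumes "isometric d N B"
  shows "(\<Sum>k<N. (cmod (hat d B q k))\<^sup>2) \<le> (\<Sum>a<d. (cmod (q a))\<^sup>2)"
proof -
  define y where "y = hat d B q"
  define z where "z a = (\<Sum>k<N. B $$ (a, k) * y k)" for a
  have zz: "(\<Sum>a<d. (cmod (z a))\<^sup>2) = (\<Sum>k<N. (cmod (y k))\<^sup>2)"
    unfolding z_def by (rule isometric_norm[OF assms])
  have "(\<Sum>a<d. cnj (z a) * q a) = (\<Sum>a<d. \<Sum>k<N. cnj (y k) * (cnj (B $$ (a, k)) * q a))"
    unfolding z_def cnj_sum sum_distrib_right by (simp add: mult_ac)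
  also have "\<dots> = (\<Sum>k<N. \<Sum>a<d. cnj (y k) * (cnj (B $$ (a, k)) * q a))" by (rule sum.swap)
  also have "\<dots> = (\<Sum>k<N. cnj (y k) * y k)" unfolding y_def hat_def sum_distrib_left ..
  also have "\<dots> = of_real (\<Sum>k<N. (cmod (y k))\<^sup>2)" by (simp add: cnj_mult_cmod)
  finally have "Re (\<Sum>a<d. cnj (z a) * q a) = (\<Sum>k<N. (cmod (y k))\<^sup>2)" by simp
  then have zq: "(\<Sum>a<d. Re (cnj (z a) * q a)) = (\<Sum>k<N. (cmod (y k))\<^sup>2)" by simp
  have "0 \<le> (\<Sum>a<d. (cmod (q a - z a))\<^sup>2)" by (intro sum_nonneg) auto
  also have "\<dots> = (\<Sum>a<d. (cmod (q a))\<^sup>2 + (cmod (z a))\<^sup>2 - 2 * Re (cnj (z a) * q a))"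
    unfolding cmod_power2 by (intro sum.cong refl) (simp add: power2_eq_square algebra_simps)
  also have "\<dots> = (\<Sum>a<d. (cmod (q a))\<^sup>2) - (\<Sum>k<N. (cmod (y k))\<^sup>2)"
    using zz zq by (simp add: sum.distrib sum_subtractf sum_distrib_left[symmetric])
  finally show ?thesis unfolding y_def by simp
qed

lemma hat_parseval:
  assumes "\<And>a b. a < d \<Longrightarrow> b < d \<Longrightarrow> (\<Sum>k<d. L $$ (a, k) * cnj (L $$ (b, k))) = (if a = b then 1 else 0)"
  shows "(\<Sum>k<d. cnj (hat d L p k) * hat d L q k) = (\<Sum>a<d. cnj (p a) * q a)"
proof -
  have "(\<Sum>k<d. cnj (hat d L p k) * hat d L q k)
      = (\<Sum>k<d. \<Sum>a<d. \<Sum>b<d. cnj (p a) * q b * (L $$ (a, k) * cnj (L $$ (b, k))))"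
    unfolding hat_def cnj_sum sum_product by (simp add: mult_ac)
  also have "\<dots> = (\<Sum>a<d. cnj (p a) * q a)" by (rule triple_sum_delta) (rule assms)
  finally show ?thesis .
qed

lemma hat_sum: "hat d B (\<lambda>a. \<Sum>i\<in>X. c i * f i a) k = (\<Sum>i\<in>X. c i * hat d B (f i) k)"
proof -
  have "hat d B (\<lambda>a. \<Sum>i\<in>X. c i * f i a) k = (\<Sum>a<d. \<Sum>i\<in>X. c i * (cnj (B $$ (a, k)) * f i a))"
    unfolding hat_def sum_distrib_left by (simp add: mult_ac)
  also have "\<dots> = (\<Sum>i\<in>X. \<Sum>a<d. c i * (cnj (B $$ (a, k)) * f i a))" by (rule sum.swap)
  finally show ?thesis unfolding hat_def sum_distrib_left .
qed

lemma hat_add: "hat d B (\<lambda>a. f a + g a) k = hat d B f k + hat d B g k"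
  unfolding hat_def by (simp add: distrib_left sum.distrib)

lemma hat_cong: "(\<And>a. a < d \<Longrightarrow> f a = g a) \<Longrightarrow> hat d B f k = hat d B g k"
  unfolding hat_def by (intro sum.cong) auto

lemma hat_column:
  assumes "isometric d N B" "k < N"
  shows "hat d B (\<lambda>a. \<Sum>l<N. y l * B $$ (a, l)) k = y k"
proof -
  have "hat d B (\<lambda>a. \<Sum>l<N. y l * B $$ (a, l)) k = (\<Sum>l<N. y l * hat d B (\<lambda>a. B $$ (a, l)) k)"
    by (rule hat_sum)
  also have "\<dots> = (\<Sum>l<N. y l * (if k = l then 1 else 0))"
    using assms unfolding hat_def isometric_def by (intro sum.cong refl) auto
  also have "\<dots> = y k" using assms(2) by (simp add: if_distrib sum.delta cong: if_cong)
  finally show ?thesis .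
qed

text \<open>The Gram matrix of \<open>X + P\<close> in the basis of left singular vectors of \<open>X\<close>: diagonal plus finite rank.\<close>

lemma gram_matrix_coordinates:
  fixes g :: "nat \<Rightarrow> real" and om :: "nat \<Rightarrow> real" and U V :: "nat \<Rightarrow> nat \<Rightarrow> complex"
    and u :: "nat \<Rightarrow> complex"
  assumes L: "isometric N N L"
    "\<And>a b. a < N \<Longrightarrow> b < N \<Longrightarrow> (\<Sum>k<N. L $$ (a, k) * cnj (L $$ (b, k))) = (if a = b then 1 else 0)"
    and R: "isometric n N R"
    and V: "\<And>p q. p < r \<Longrightarrow> q < r \<Longrightarrow> (\<Sum>b<n. cnj (V p b) * V q b) = (if p = q then 1 else 0)"
    and S: "\<And>a b. a < N \<Longrightarrow> b < n \<Longrightarrow> S a b = (\<Sum>k<N. L $$ (a, k) * of_real (g k) * cnj (R $$ (b, k)))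
       + (\<Sum>p<r. U p a * of_real (om p) * cnj (V p b))"
    and k: "k < N"
  defines "x \<equiv> hat N L u"
    and "d \<equiv> (\<lambda>p. of_real (om p) * (\<Sum>k<N. cnj (hat N L (U p) k) * hat N L u k))"
  shows "hat N L (\<lambda>a. \<Sum>b<n. S a b * (\<Sum>a'<N. cnj (S a' b) * u a')) k
    = of_real ((g k)\<^sup>2) * x k + (\<Sum>p<r. of_real (om p) *
        ((\<Sum>k<N. cnj (of_real (g k) * hat n R (V p) k) * x k) + d p) * hat N L (U p) k
        + d p * (of_real (g k) * hat n R (V p) k))"
proof -
  \<comment> \<open>The adjoint of X + P applied to \<open>u\<close>, in terms of the columns of
    \<open>R\<close> and the right singular vectors of P.\<close>
  define z where "z b = (\<Sum>k<N. (of_real (g k) * x k) * R $$ (b, k)) + (\<Sum>p<r. d p * V p b)" for b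
  have pars: "(\<Sum>a<N. cnj (U p a) * u a) = (\<Sum>k<N. cnj (hat N L (U p) k) * hat N L u k)" for p
    by (rule hat_parseval[symmetric, OF L(2)])
  have z: "(\<Sum>a'<N. cnj (S a' b) * u a') = z b" if b: "b < n" for b
  proof -
    have "(\<Sum>a<N. cnj (S a b) * u a) = (\<Sum>a<N. (\<Sum>k<N. (of_real (g k) * R $$ (b, k)) * (cnj (L $$ (a, k)) * u a))
        + (\<Sum>p<r. (of_real (om p) * V p b) * (cnj (U p a) * u a)))"
      using S[OF _ b] by (intro sum.cong refl) (simp add: distrib_left distrib_right sum_distrib_left sum_distrib_right mult_ac)
    also have "\<dots> = (\<Sum>k<N. (of_real (g k) * R $$ (b, k)) * x k)
        + (\<Sum>p<r. (of_real (om p) * V p b) * (\<Sum>a<N. cnj (U p a) * u a))"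
      unfolding sum.distrib x_def hat_def sum_distrib_left
      by (intro arg_cong2[where f = "(+)"] sum.swap)
    finally show ?thesis unfolding z_def d_def pars by (simp add: mult_ac)
  qed
  have Rz: "hat n R z l = of_real (g l) * x l + (\<Sum>p<r. d p * hat n R (V p) l)" if "l < N" for l
  proof -
    have "hat n R z l = hat n R (\<lambda>b. \<Sum>k<N. (of_real (g k) * x k) * R $$ (b, k)) l + hat n R (\<lambda>b. \<Sum>p<r. d p * V p b) l"
      unfolding z_def by (rule hat_add)
    then show ?thesis unfolding hat_column[OF R that] unfolding hat_sum .
  qed
  \<comment> \<open>Orthonormality of the \<open>V p\<close> collapses the finite rank part to
    \<open>d p\<close>.\<close>
  have Vz: "(\<Sum>b<n. cnj (V p b) * z b) = (\<Sum>k<N. cnj (of_real (g k) * hat n R (V p) k) * x k) + d p" if p: "p < r" for p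
  proof -
    have "(\<Sum>b<n. cnj (V p b) * z b) = (\<Sum>b<n. \<Sum>k<N. (of_real (g k) * x k) * (R $$ (b, k) * cnj (V p b)))
       + (\<Sum>b<n. \<Sum>q<r. d q * (cnj (V p b) * V q b))"
      unfolding z_def by (simp add: distrib_left sum.distrib sum_distrib_left mult_ac)
    also have "(\<Sum>b<n. \<Sum>k<N. (of_real (g k) * x k) * (R $$ (b, k) * cnj (V p b)))
      = (\<Sum>k<N. (of_real (g k) * x k) * (\<Sum>b<n. R $$ (b, k) * cnj (V p b)))"
      unfolding sum_distrib_left by (rule sum.swap)
    also have "\<dots> = (\<Sum>k<N. cnj (of_real (g k) * hat n R (V p) k) * x k)"
      unfolding hat_def by (simp add: mult_ac)
    also have "(\<Sum>b<n. \<Sum>q<r. d q * (cnj (V p b) * V q b)) = (\<Sum>q<r. d q * (\<Sum>b<n. cnj (V p b) * V q b))"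
      unfolding sum_distrib_left by (rule sum.swap)
    also have "\<dots> = (\<Sum>q<r. d q * (if p = q then 1 else 0))" using V p by (intro sum.cong refl) auto
    also have "\<dots> = d p" using p by (simp add: if_distrib sum.delta cong: if_cong)
    finally show ?thesis .
  qed
  have "hat N L (\<lambda>a. \<Sum>b<n. S a b * (\<Sum>a'<N. cnj (S a' b) * u a')) k
     = hat N L (\<lambda>a. (\<Sum>l<N. (of_real (g l) * hat n R z l) * L $$ (a, l))
        + (\<Sum>p<r. (of_real (om p) * (\<Sum>b<n. cnj (V p b) * z b)) * U p a)) k"
  proof (rule hat_cong)
    fix a assume a: "a < N"
    have "(\<Sum>b<n. S a b * (\<Sum>a'<N. cnj (S a' b) * u a')) = (\<Sum>b<n. S a b * z b)" by (simp add: z)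
    also have "\<dots> = (\<Sum>b<n. (\<Sum>l<N. (of_real (g l) * L $$ (a, l)) * (cnj (R $$ (b, l)) * z b))
        + (\<Sum>p<r. (of_real (om p) * U p a) * (cnj (V p b) * z b)))"
      using S[OF a] by (intro sum.cong refl) (simp add: distrib_left distrib_right sum_distrib_left sum_distrib_right mult_ac)
    also have "\<dots> = (\<Sum>l<N. (of_real (g l) * L $$ (a, l)) * hat n R z l)
        + (\<Sum>p<r. (of_real (om p) * U p a) * (\<Sum>b<n. cnj (V p b) * z b))"
      unfolding sum.distrib hat_def sum_distrib_left by (intro arg_cong2[where f = "(+)"] sum.swap)
    finally show "(\<Sum>b<n. S a b * (\<Sum>a'<N. cnj (S a' b) * u a')) = (\<Sum>l<N. (of_real (g l) * hat n R z l) * L $$ (a, l))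
        + (\<Sum>p<r. (of_real (om p) * (\<Sum>b<n. cnj (V p b) * z b)) * U p a)"
      by (simp add: mult_ac)
  qed
  also have "\<dots> = of_real (g k) * hat n R z k + (\<Sum>p<r. (of_real (om p) * (\<Sum>b<n. cnj (V p b) * z b)) * hat N L (U p) k)"
    unfolding hat_add unfolding hat_column[OF L(1) k] unfolding hat_sum ..
  also have "of_real (g k) * hat n R z k = of_real ((g k)\<^sup>2) * x k + (\<Sum>p<r. d p * (of_real (g k) * hat n R (V p) k))"
    unfolding Rz[OF k] by (simp add: distrib_left sum_distrib_left power2_eq_square mult_ac)
  also have "(\<Sum>p<r. (of_real (om p) * (\<Sum>b<n. cnj (V p b) * z b)) * hat N L (U p) k)
     = (\<Sum>p<r. of_real (om p) * ((\<Sum>k<N. cnj (of_real (g k) * hat n R (V p) k) * x k) + d p) * hat N L (U p) k)"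
    by (intro sum.cong refl) (simp add: Vz)
  finally show ?thesis by (simp add: sum.distrib add_ac)
qed

section \<open>Functional calculus in a unitary basis\<close>

definition spectral_mat :: "nat \<Rightarrow> complex mat \<Rightarrow> (nat \<Rightarrow> complex) \<Rightarrow> complex mat" where
  "spectral_mat N L f = mat N N (\<lambda>(a, b). \<Sum>k<N. L $$ (a, k) * f k * cnj (L $$ (b, k)))"

text \<open>Conjugating a diagonal matrix by \<open>L\<close> is multiplicative, so inverses, and
  hence the resolvent of the Gram matrix of X, are computed entrywise.\<close>

lemma spectral_mat_mult:
  assumes "isometric N N L"
  shows "spectral_mat N L f * spectral_mat N L h = spectral_mat N L (\<lambda>k. f k * h k)"
proof (rule eq_matI)
  fix a b assume "a < dim_row (spectral_mat N L (\<lambda>k. f k * h k))" "b < dim_col (spectral_mat N L (\<lambda>k. f k * h k))"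
  then have ab: "a < N" "b < N" by (auto simp: spectral_mat_def)
  have "(spectral_mat N L f * spectral_mat N L h) $$ (a, b)
     = (\<Sum>c<N. (\<Sum>k<N. L $$ (a, k) * f k * cnj (L $$ (c, k))) * (\<Sum>l<N. L $$ (c, l) * h l * cnj (L $$ (b, l))))"
    using ab by (simp add: spectral_mat_def scalar_prod_def atLeast0LessThan)
  also have "\<dots> = (\<Sum>c<N. \<Sum>k<N. \<Sum>l<N. (L $$ (a, k) * f k * h l * cnj (L $$ (b, l))) * (cnj (L $$ (c, k)) * L $$ (c, l)))"
    unfolding sum_product by (simp add: mult_ac)
  also have "\<dots> = (\<Sum>k<N. L $$ (a, k) * f k * h k * cnj (L $$ (b, k)))"
    by (rule triple_sum_delta) (use assms in \<open>simp add: isometric_def\<close>)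
  also have "\<dots> = spectral_mat N L (\<lambda>k. f k * h k) $$ (a, b)" using ab by (simp add: spectral_mat_def mult_ac)
  finally show "(spectral_mat N L f * spectral_mat N L h) $$ (a, b) = spectral_mat N L (\<lambda>k. f k * h k) $$ (a, b)" .
qed (auto simp: spectral_mat_def)

lemma spectral_mat_trace:
  assumes "isometric N N L"
  shows "mtrace (spectral_mat N L f) = (\<Sum>k<N. f k)"
proof -
  have "mtrace (spectral_mat N L f) = (\<Sum>a<N. \<Sum>k<N. f k * (cnj (L $$ (a, k)) * L $$ (a, k)))"
    unfolding mtrace_def by (simp add: spectral_mat_def mult_ac)
  also have "\<dots> = (\<Sum>k<N. \<Sum>a<N. f k * (cnj (L $$ (a, k)) * L $$ (a, k)))" by (rule sum.swap)
  also have "\<dots> = (\<Sum>k<N. f k)"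
    using assms unfolding isometric_def sum_distrib_left[symmetric] by simp
  finally show ?thesis .
qed

lemma minv_spectral_mat:
  assumes L: "isometric N N L"
    "\<And>a b. a < N \<Longrightarrow> b < N \<Longrightarrow> (\<Sum>k<N. L $$ (a, k) * cnj (L $$ (b, k))) = (if a = b then 1 else 0)"
    and f: "\<And>k. k < N \<Longrightarrow> f k \<noteq> 0"
  shows "minv (spectral_mat N L f) = spectral_mat N L (\<lambda>k. 1 / f k)"
proof -
  let ?A = "spectral_mat N L f" and ?B = "spectral_mat N L (\<lambda>k. 1 / f k)"
  have A: "?A \<in> carrier_mat N N" and B: "?B \<in> carrier_mat N N" by (auto simp: spectral_mat_def)
  have one: "spectral_mat N L h = 1\<^sub>m N" if "\<And>k. k < N \<Longrightarrow> h k = 1" for h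
    using L(2) that by (intro eq_matI) (auto simp: spectral_mat_def)
  have AB: "?A * ?B = 1\<^sub>m N" "?B * ?A = 1\<^sub>m N" unfolding spectral_mat_mult[OF L(1)]
    using f by (auto intro!: one)
  \<comment> \<open>\<open>mat_inverse\<close> returns an option; invertibility shows that it is not
    \<open>None\<close>, and uniqueness of inverses identifies its value with
    \<open>?B\<close>.\<close>
  have "?A \<in> Units (ring_mat TYPE(complex) N ())"
    using A B AB by (auto simp: Units_def ring_mat_def)
  then obtain C where C: "mat_inverse ?A = Some C" using mat_inverse(1)[OF A, where b = "()"] by (cases "mat_inverse ?A") auto
  then have C': "?A * C = 1\<^sub>m N" "C \<in> carrier_mat N N" using mat_inverse(2)[OF A] by auto
  have "C = (?B * ?A) * C" using C'(2) AB by simp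
  also have "\<dots> = ?B" using assoc_mult_mat[OF B A C'(2)] C' B by simp
  finally show ?thesis unfolding minv_def C by simp
qed

text \<open>Serves both X, with its random diagonal, and P, with its singular values.\<close>

lemma singular_model_index:
  assumes L: "L \<in> carrier_mat l N" and G: "G \<in> carrier_mat N N" "diagonal_mat G" and R: "R \<in> carrier_mat n N"
    and "a < l" "b < n"
  shows "(L * G * mat_adjoint R) $$ (a, b) = (\<Sum>k<N. L $$ (a, k) * G $$ (k, k) * cnj (R $$ (b, k)))"
proof -
  have LG: "(L * G) $$ (a, k) = L $$ (a, k) * G $$ (k, k)" if "k < N" for k
  proof -
    have "(L * G) $$ (a, k) = (\<Sum>l<N. L $$ (a, l) * G $$ (l, k))"
      using L G(1) assms(5) that by (rule mat_mult_index)
    also have "\<dots> = (\<Sum>l<N. if l = k then L $$ (a, k) * G $$ (k, k) else 0)"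
      using G that unfolding diagonal_mat_def by (intro sum.cong refl) auto
    finally show ?thesis using that by simp
  qed
  have "(L * G * mat_adjoint R) $$ (a, b) = (\<Sum>k<N. (L * G) $$ (a, k) * mat_adjoint R $$ (k, b))"
    using mult_carrier_mat[OF L G(1)] mat_adjoint_carrier[OF R] assms(5,6) by (rule mat_mult_index)
  also have "\<dots> = (\<Sum>k<N. L $$ (a, k) * G $$ (k, k) * cnj (R $$ (b, k)))"
    using LG mat_adjoint_index[OF R] assms by (intro sum.cong refl) simp
  finally show ?thesis .
qed

lemma mat_vec_index:
  assumes "A \<in> carrier_mat m n" "v \<in> carrier_vec n" "i < m"
  shows "(A *\<^sub>v v) $ i = (\<Sum>k<n. A $$ (i, k) * v $ k)"
  using assms by (simp add: scalar_prod_def atLeast0LessThan)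

lemma gram_mult_vec_index:
  fixes A :: "complex mat"
  assumes A: "A \<in> carrier_mat N n" and u: "u \<in> carrier_vec N" and a: "a < N"
  shows "((A * mat_adjoint A) *\<^sub>v u) $ a = (\<Sum>b<n. A $$ (a, b) * (\<Sum>a'<N. cnj (A $$ (a', b)) * u $ a'))"
proof -
  have A': "mat_adjoint A \<in> carrier_mat n N" by (rule mat_adjoint_carrier[OF A])
  have "(mat_adjoint A *\<^sub>v u) $ b = (\<Sum>a'<N. cnj (A $$ (a', b)) * u $ a')" if "b < n" for b
    using A' u that by (simp add: scalar_prod_def atLeast0LessThan mat_adjoint_index[OF A])
  moreover have "(A *\<^sub>v (mat_adjoint A *\<^sub>v u)) $ a = (\<Sum>b<n. A $$ (a, b) * (mat_adjoint A *\<^sub>v u) $ b)"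
    using A mult_mat_vec_carrier[OF A' u] a by (rule mat_vec_index)
  ultimately show ?thesis unfolding assoc_mult_mat_vec[OF A A' u] by simp
qed

lemma spectral_mat_shift:
  assumes "\<And>a b. a < N \<Longrightarrow> b < N \<Longrightarrow> (\<Sum>k<N. L $$ (a, k) * cnj (L $$ (b, k))) = (if a = b then 1 else 0)"
  shows "spectral_mat N L f - z \<cdot>\<^sub>m 1\<^sub>m N = spectral_mat N L (\<lambda>k. f k - z)"
proof (rule eq_matI)
  fix a b assume "a < dim_row (spectral_mat N L (\<lambda>k. f k - z))" "b < dim_col (spectral_mat N L (\<lambda>k. f k - z))"
  then have ab: "a < N" "b < N" by (auto simp: spectral_mat_def)
  have "(\<Sum>k<N. L $$ (a, k) * (f k - z) * cnj (L $$ (b, k)))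
    = (\<Sum>k<N. L $$ (a, k) * f k * cnj (L $$ (b, k))) - z * (\<Sum>k<N. L $$ (a, k) * cnj (L $$ (b, k)))"
    by (simp add: sum_subtractf sum_distrib_left algebra_simps)
  also have "\<dots> = (\<Sum>k<N. L $$ (a, k) * f k * cnj (L $$ (b, k))) - z * (if a = b then 1 else 0)"
    using assms[OF ab] by simp
  finally show "(spectral_mat N L f - z \<cdot>\<^sub>m 1\<^sub>m N) $$ (a, b) = spectral_mat N L (\<lambda>k. f k - z) $$ (a, b)"
    using ab by (simp add: spectral_mat_def)
qed (auto simp: spectral_mat_def)

lemma gram_of_singular_model:
  fixes g :: "nat \<Rightarrow> real"
  assumes R: "isometric n N R" and X: "X \<in> carrier_mat N n"
    and Xi: "\<And>a b. a < N \<Longrightarrow> b < n \<Longrightarrow> X $$ (a, b) = (\<Sum>k<N. L $$ (a, k) * of_real (g k) * cnj (R $$ (b, k)))"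
  shows "X * mat_adjoint X = spectral_mat N L (\<lambda>k. of_real ((g k)\<^sup>2))"
proof (rule eq_matI)
  fix a b assume "a < dim_row (spectral_mat N L (\<lambda>k. of_real ((g k)\<^sup>2)))" "b < dim_col (spectral_mat N L (\<lambda>k. of_real ((g k)\<^sup>2)))"
  then have ab: "a < N" "b < N" by (auto simp: spectral_mat_def)
  have "(X * mat_adjoint X) $$ (a, b) = (\<Sum>c<n. X $$ (a, c) * cnj (X $$ (b, c)))"
    using X mat_adjoint_carrier[OF X] ab by (simp add: scalar_prod_def atLeast0LessThan mat_adjoint_index[OF X])
  also have "\<dots> = (\<Sum>c<n. \<Sum>k<N. \<Sum>l<N. (L $$ (a, k) * of_real (g k) * cnj (L $$ (b, l)) * of_real (g l)) * (cnj (R $$ (c, k)) * R $$ (c, l)))"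
    using Xi ab by (intro sum.cong refl) (simp add: sum_product mult_ac)
  also have "\<dots> = (\<Sum>k<N. L $$ (a, k) * of_real (g k) * cnj (L $$ (b, k)) * of_real (g k))"
    by (rule triple_sum_delta) (use R in \<open>simp add: isometric_def\<close>)
  also have "\<dots> = spectral_mat N L (\<lambda>k. of_real ((g k)\<^sup>2)) $$ (a, b)"
    using ab by (simp add: spectral_mat_def power2_eq_square mult_ac)
  finally show "(X * mat_adjoint X) $$ (a, b) = spectral_mat N L (\<lambda>k. of_real ((g k)\<^sup>2)) $$ (a, b)" .
qed (use X mat_adjoint_carrier[OF X] in \<open>auto simp: spectral_mat_def\<close>)

section \<open>Operator norm and singular values\<close>

lemma vnorm_sum_bound:
  assumes "v \<in> carrier_vec m" "vnorm v \<le> 1" "i < m"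
  shows "cmod (v $ i) \<le> 1"
proof -
  have "(cmod (v $ i))\<^sup>2 \<le> (\<Sum>i<m. (cmod (v $ i))\<^sup>2)" using assms(3) by (intro member_le_sum) auto
  also have "\<dots> = (vnorm v)\<^sup>2" using assms(1) by (simp add: vnorm_def sum_nonneg)
  also have "\<dots> \<le> 1" using assms(2) by (simp add: vnorm_def abs_square_le_1 sum_nonneg)
  finally show ?thesis by (simp add: abs_square_le_1)
qed

text \<open>A supremum of reals is an upper bound only for bounded sets; a crude estimate by row
  sums provides the boundedness.\<close>

lemma vnorm_le_opnorm:
  assumes A: "A \<in> carrier_mat m n" and v: "v \<in> carrier_vec n" "vnorm v \<le> 1"
  shows "vnorm (A *\<^sub>v v) \<le> opnorm A"
  unfolding opnorm_def
proof (rule cSup_upper)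
  show "vnorm (A *\<^sub>v v) \<in> {vnorm (A *\<^sub>v v) |v. v \<in> carrier_vec (dim_col A) \<and> vnorm v \<le> 1}"
    using A v by auto
  show "bdd_above {vnorm (A *\<^sub>v v) |v. v \<in> carrier_vec (dim_col A) \<and> vnorm v \<le> 1}"
  proof (rule bdd_aboveI)
    fix x assume "x \<in> {vnorm (A *\<^sub>v v) |v. v \<in> carrier_vec (dim_col A) \<and> vnorm v \<le> 1}"
    then obtain v where v: "x = vnorm (A *\<^sub>v v)" "v \<in> carrier_vec n" "vnorm v \<le> 1" using A by auto
    have "(\<Sum>i<m. (cmod ((A *\<^sub>v v) $ i))\<^sup>2) \<le> (\<Sum>i<m. (\<Sum>k<n. cmod (A $$ (i, k)))\<^sup>2)"
    proof (intro sum_mono power_mono)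
      fix i assume i: "i \<in> {..<m}"
      have "(A *\<^sub>v v) $ i = (\<Sum>k<n. A $$ (i, k) * v $ k)"
        using A v i by (simp add: scalar_prod_def atLeast0LessThan)
      then have "cmod ((A *\<^sub>v v) $ i) \<le> (\<Sum>k<n. cmod (A $$ (i, k) * v $ k))" by (simp add: norm_sum)
      also have "\<dots> \<le> (\<Sum>k<n. cmod (A $$ (i, k)))"
        using vnorm_sum_bound[OF v(2,3)] by (intro sum_mono) (auto simp: norm_mult intro!: mult_left_le)
      finally show "cmod ((A *\<^sub>v v) $ i) \<le> (\<Sum>k<n. cmod (A $$ (i, k)))" .
    qed auto
    then show "x \<le> sqrt (\<Sum>i<m. (\<Sum>k<n. cmod (A $$ (i, k)))\<^sup>2)"
      unfolding v vnorm_def using A by simp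
  qed
qed

text \<open>The \<open>k\<close>-th column of \<open>L\<close> is a unit eigenvector with eigenvalue
  \<open>g k\<close>.\<close>

lemma spectral_mat_le_opnorm:
  fixes g :: "nat \<Rightarrow> real"
  assumes L: "isometric N N L" and k: "k < N" and g: "0 \<le> g k"
  shows "g k \<le> opnorm (spectral_mat N L (\<lambda>k. of_real (g k)))"
proof -
  define v where "v = vec N (\<lambda>a. L $$ (a, k))"
  have A: "spectral_mat N L (\<lambda>k. of_real (g k)) \<in> carrier_mat N N" by (simp add: spectral_mat_def)
  have n1: "(\<Sum>a<N. (cmod (L $$ (a, k)))\<^sup>2) = 1"
    by (rule sum_cmod_square_eq_1) (use L k in \<open>simp add: isometric_def\<close>)
  then have v: "v \<in> carrier_vec N" "vnorm v = 1" unfolding v_def vnorm_def by auto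
  have Av: "(spectral_mat N L (\<lambda>k. of_real (g k)) *\<^sub>v v) $ a = of_real (g k) * L $$ (a, k)" if a: "a < N" for a
  proof -
    have "(spectral_mat N L (\<lambda>k. of_real (g k)) *\<^sub>v v) $ a
       = (\<Sum>b<N. \<Sum>l<N. (L $$ (a, l) * of_real (g l)) * (cnj (L $$ (b, l)) * L $$ (b, k)))"
      using a unfolding v_def spectral_mat_def
      by (simp add: scalar_prod_def atLeast0LessThan sum_distrib_left sum_distrib_right mult_ac)
    also have "\<dots> = (\<Sum>l<N. \<Sum>b<N. (L $$ (a, l) * of_real (g l)) * (cnj (L $$ (b, l)) * L $$ (b, k)))" by (rule sum.swap)
    also have "\<dots> = (\<Sum>l<N. if l = k then L $$ (a, l) * of_real (g l) else 0)"
      using L k unfolding isometric_def sum_distrib_left[symmetric] by (intro sum.cong refl) simp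
    finally show ?thesis using k by simp
  qed
  have "vnorm (spectral_mat N L (\<lambda>k. of_real (g k)) *\<^sub>v v) = sqrt (\<Sum>a<N. (g k)\<^sup>2 * (cmod (L $$ (a, k)))\<^sup>2)"
    unfolding vnorm_def using Av by (simp add: spectral_mat_def norm_mult power_mult_distrib)
  also have "\<dots> = g k" unfolding sum_distrib_left[symmetric] n1 using g by simp
  finally show ?thesis using vnorm_le_opnorm[OF A v(1)] v(2) by simp
qed

section \<open>The spiked model along a path\<close>

text \<open>Purely deterministic. What concentration provides along almost every path enters through
  \<open>cu\<close> and \<open>cb\<close> for pairs of left vectors, \<open>cv\<close> for right
  ones, and \<open>cx\<close> and \<open>cbx\<close> for mixed pairs.\<close>

lemma spiked_model_pathwise:
  fixes Nf :: "nat \<Rightarrow> nat" and L R :: "nat \<Rightarrow> complex mat" and g :: "nat \<Rightarrow> nat \<Rightarrow> real"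
    and uv vv :: "nat \<Rightarrow> nat \<Rightarrow> nat \<Rightarrow> complex" and bb :: "bool \<Rightarrow> nat \<Rightarrow> nat \<Rightarrow> complex"
    and uh :: "nat \<Rightarrow> nat \<Rightarrow> nat \<Rightarrow> complex" and lh :: "nat \<Rightarrow> nat \<Rightarrow> real"
    and S :: "nat \<Rightarrow> nat \<Rightarrow> nat \<Rightarrow> complex" and om :: "nat \<Rightarrow> nat \<Rightarrow> real"
  assumes pi: "prob_space \<pi>" "sets \<pi> = sets borel" "AE x in \<pi>. x \<in> {lm..lp}"
    and c: "0 < c" "(\<lambda>n. real (Nf n) / real n) \<longlonglongrightarrow> c"
    and L: "\<And>n. isometric (Nf n) (Nf n) (L n)"
      "\<And>n a b. a < Nf n \<Longrightarrow> b < Nf n \<Longrightarrow> (\<Sum>k<Nf n. L n $$ (a, k) * cnj (L n $$ (b, k))) = (if a = b then 1 else 0)"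
    and R: "\<And>n. isometric n (Nf n) (R n)"
    and top: "\<Lambda> \<longlonglongrightarrow> lp" "\<And>n k. k < Nf n \<Longrightarrow> (g n k)\<^sup>2 \<le> \<Lambda> n"
    and st: "\<And>y::nat. 0 < y \<Longrightarrow> (\<lambda>n. (\<Sum>k<Nf n. 1 / (of_real ((g n k)\<^sup>2) - \<i> * of_nat y)) / of_nat (Nf n))
        \<longlonglongrightarrow> (\<integral>x. 1 / (of_real x - \<i> * of_nat y) \<partial>\<pi>)"
    and cu: "\<And>p q m. p < r \<Longrightarrow> q < r \<Longrightarrow> (\<lambda>n. (\<Sum>k<Nf n. of_real (g n k ^ m) *
        (cnj (hat (Nf n) (L n) (uv n p) k) * hat (Nf n) (L n) (uv n q) k))
        - (\<Sum>a<Nf n. cnj (uv n p a) * uv n q a) * of_real ((\<Sum>k<Nf n. g n k ^ m) / Nf n)) \<longlonglongrightarrow> 0"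
    and cb: "\<And>b q m. q < r \<Longrightarrow> (\<lambda>n. (\<Sum>k<Nf n. of_real (g n k ^ m) *
        (cnj (hat (Nf n) (L n) (bb b n) k) * hat (Nf n) (L n) (uv n q) k))
        - (\<Sum>a<Nf n. cnj (bb b n a) * uv n q a) * of_real ((\<Sum>k<Nf n. g n k ^ m) / Nf n)) \<longlonglongrightarrow> 0"
    and cv: "\<And>p q m. p < r \<Longrightarrow> q < r \<Longrightarrow> (\<lambda>n. (\<Sum>k<Nf n. of_real (g n k ^ m) *
        (cnj (hat n (R n) (vv n p) k) * hat n (R n) (vv n q) k))
        - (\<Sum>a<n. cnj (vv n p a) * vv n q a) * of_real ((\<Sum>k<Nf n. g n k ^ m) / n)) \<longlonglongrightarrow> 0"
    and cx: "\<And>p q m. p < r \<Longrightarrow> q < r \<Longrightarrow> (\<lambda>n. \<Sum>k<Nf n. of_real (g n k ^ m) *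
        (cnj (hat (Nf n) (L n) (uv n p) k) * hat n (R n) (vv n q) k)) \<longlonglongrightarrow> 0"
    and cbx: "\<And>b q m. q < r \<Longrightarrow> (\<lambda>n. \<Sum>k<Nf n. of_real (g n k ^ m) *
        (cnj (hat (Nf n) (L n) (bb b n) k) * hat n (R n) (vv n q) k)) \<longlonglongrightarrow> 0"
    and ou: "\<forall>\<^sub>F n in sequentially. \<forall>p<r. \<forall>q<r. (\<Sum>a<Nf n. cnj (uv n p a) * uv n q a) = (if p = q then 1 else 0)"
    and ov: "\<forall>\<^sub>F n in sequentially. \<forall>p<r. \<forall>q<r. (\<Sum>a<n. cnj (vv n p a) * vv n q a) = (if p = q then 1 else 0)"
    and bB: "\<And>b n. (\<Sum>a<Nf n. (cmod (bb b n a))\<^sup>2) \<le> Bd"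
    and om: "\<And>p. p < r \<Longrightarrow> (\<lambda>n. om n p) \<longlonglongrightarrow> \<omega> p" and \<omega>pos: "\<And>p. p < r \<Longrightarrow> 0 < \<omega> p"
    and S: "\<forall>\<^sub>F n in sequentially. \<forall>a<Nf n. \<forall>b<n. S n a b =
        (\<Sum>k<Nf n. L n $$ (a, k) * of_real (g n k) * cnj (R n $$ (b, k)))
        + (\<Sum>p<r. uv n p a * of_real (om n p) * cnj (vv n p b))"
    and eig: "\<forall>\<^sub>F n in sequentially. \<forall>q<Nf n. \<forall>a<Nf n.
        (\<Sum>b<n. S n a b * (\<Sum>a'<Nf n. cnj (S n a' b) * uh n q a')) = of_real (lh n q) * uh n q a"
    and uho: "\<And>n q q'. q < Nf n \<Longrightarrow> q' < Nf n \<Longrightarrow> (\<Sum>a<Nf n. cnj (uh n q a) * uh n q' a) = (if q = q' then 1 else 0)"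
    and lhm: "\<And>n q q'. q' < Nf n \<Longrightarrow> q \<le> q' \<Longrightarrow> lh n q' \<le> lh n q"
    and \<rho>: "lp < \<rho>" "\<omega>i\<^sup>2 * gfun c \<pi> \<rho> = 1" and \<omega>i: "0 < \<omega>i"
    and J: "0 < J" "J \<le> r" "\<And>p. p < r \<Longrightarrow> p < J \<longleftrightarrow> \<omega>i \<le> \<omega> p"
    and G: "G = {m0..<J}" "\<And>p. p < r \<Longrightarrow> p \<in> G \<longleftrightarrow> \<omega> p = \<omega>i"
  shows "(\<lambda>n. (\<Sum>q\<in>G. (\<Sum>a<Nf n. cnj (bb True n a) * uh n q a) * (\<Sum>a<Nf n. cnj (uh n q a) * bb False n a))
     - of_real (\<rho> * (stieltjes_r \<pi> \<rho>)\<^sup>2 * mtilde c \<pi> \<rho> / deriv (gfun c \<pi>) \<rho>)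
       * (\<Sum>p\<in>G. (\<Sum>a<Nf n. cnj (bb True n a) * uv n p a) * (\<Sum>a<Nf n. cnj (uv n p a) * bb False n a))) \<longlonglongrightarrow> 0"
proof -
  interpret P: prob_space \<pi> by (rule pi)
  define T where "T = (lp + \<rho>) / 2"
  have lpT: "lp < T" "T < \<rho>" using \<rho>(1) unfolding T_def by auto
  note Nlarge = linear_growth_of_ratio(2)[OF c(2,1)]
  have lp0: "0 \<le> lp"
  proof (rule tendsto_lowerbound[OF top(1)])
    show "\<forall>\<^sub>F n in sequentially. 0 \<le> \<Lambda> n" using Nlarge[of 1]
      by eventually_elim (use top(2) order_trans[OF zero_le_power2] in force)
  qed simp
  have T0: "0 \<le> T" using lp0 lpT by simp
  define t where "t n k = (g n k)\<^sup>2" for n k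
  have tT: "\<forall>\<^sub>F n in sequentially. \<forall>k<Nf n. t n k \<in> {0..T}"
    using order_tendstoD(2)[OF top(1) lpT(1)]
  proof eventually_elim
    case (elim n)
    show ?case using order_trans[OF top(2) less_imp_le[OF elim]] by (simp add: t_def)
  qed
  have tpow: "t n k ^ m = g n k ^ (2 * m)" for n k m unfolding t_def by (simp add: power_mult)
  define M where "M m = (\<integral>x. x ^ m \<partial>\<pi>)" for m
  define Mn where "Mn m n = (\<Sum>k<Nf n. t n k ^ m) / Nf n" for m n
  have M: "Mn m \<longlonglongrightarrow> M m" for m unfolding Mn_def M_def
  proof (rule moments_of_stieltjes[OF pi(1,2), where K = "max \<bar>lm\<bar> T"])
    show "AE x in \<pi>. \<bar>x\<bar> \<le> max \<bar>lm\<bar> T" using pi(3) by eventually_elim (use lpT T0 in auto)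
    show "\<forall>\<^sub>F n in sequentially. \<forall>k<Nf n. \<bar>t n k\<bar> \<le> max \<bar>lm\<bar> T" using tT by eventually_elim force
    show "\<forall>\<^sub>F n in sequentially. 0 < Nf n" using Nlarge[of 1] by eventually_elim simp
  qed (use st in \<open>simp add: t_def\<close>)
  \<comment> \<open>\<open>lm\<close> may be negative, so \<open>\<pi>\<close> is shown to live on
    the half line by testing with the negative part, which vanishes at every
    \<open>t n k\<close>.\<close>
  have pos: "AE x in \<pi>. 0 \<le> x"
  proof -
    define f where "f = (\<lambda>x::real. max 0 (- x))"
    define lo where "lo = min lm 0"
    have fm: "f \<in> borel_measurable borel" unfolding f_def by measurable
    have fc: "continuous_on {lo..T} f" unfolding f_def by (intro continuous_intros)
    have aeI: "AE x in \<pi>. x \<in> {lo..T}" using pi(3) by eventually_elim (use lpT in \<open>auto simp: lo_def\<close>)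
    have "(\<lambda>n. (\<Sum>k<Nf n. of_real (f (t n k)) * (1 / of_nat (Nf n))) - 1 * complex_of_real (\<integral>x. f x \<partial>\<pi>)) \<longlonglongrightarrow> 0"
    proof (rule weighted_sum_limit_of_moments[OF pi(1,2) aeI _ _ _ _ fm fc, where C = 1])
      show "\<forall>\<^sub>F n in sequentially. \<forall>k<Nf n. t n k \<in> {lo..T}" using tT by eventually_elim (force simp: lo_def)
      show "\<forall>\<^sub>F n in sequentially. (\<Sum>k<Nf n. cmod (1 / of_nat (Nf n))) \<le> 1"
        by (simp add: norm_divide)
      show "(\<lambda>n. (\<Sum>k<Nf n. of_real (t n k ^ m) * (1 / of_nat (Nf n))) - 1 * complex_of_real (\<integral>x. x ^ m \<partial>\<pi>)) \<longlonglongrightarrow> 0" for m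
      proof -
        have "(\<lambda>n. complex_of_real (Mn m n - M m)) \<longlonglongrightarrow> of_real (M m - M m)"
          by (intro tendsto_intros M)
        moreover have "complex_of_real (Mn m n - M m) = (\<Sum>k<Nf n. of_real (t n k ^ m) * (1 / of_nat (Nf n))) - 1 * complex_of_real (\<integral>x. x ^ m \<partial>\<pi>)" for n
          unfolding Mn_def M_def by (simp add: sum_divide_distrib)
        ultimately show ?thesis by simp
      qed
    qed auto
    moreover have "\<forall>\<^sub>F n in sequentially. (\<Sum>k<Nf n. of_real (f (t n k)) * (1 / of_nat (Nf n))) - 1 * complex_of_real (\<integral>x. f x \<partial>\<pi>) = - of_real (\<integral>x. f x \<partial>\<pi>)"
      using tT by eventually_elim (simp add: f_def)
    ultimately have "(\<lambda>n. - complex_of_real (\<integral>x. f x \<partial>\<pi>)) \<longlonglongrightarrow> 0" by (rule Lim_transform_eventually)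
    then have f0: "(\<integral>x. f x \<partial>\<pi>) = 0" by (simp add: LIMSEQ_const_iff)
    have "integrable \<pi> f"
    proof (rule P.integrable_const_bound)
      show "AE x in \<pi>. norm (f x) \<le> \<bar>lm\<bar>" using pi(3) by eventually_elim (auto simp: f_def)
      show "f \<in> borel_measurable \<pi>" using fm by (simp cong: measurable_cong_sets add: pi(2))
    qed
    then have "AE x in \<pi>. f x = 0" using f0 integral_nonneg_eq_0_iff_AE[of \<pi> f] by (simp add: f_def)
    then show ?thesis by eventually_elim (simp add: f_def max_def split: if_splits)
  qed
  interpret LL: limit_law \<pi> c T
  proof
    show "AE x in \<pi>. 0 \<le> x \<and> x \<le> T" using pi(3) pos by eventually_elim (use lpT in auto)
  qed (use pi c T0 in auto)
  have aeT: "AE x in \<pi>. x \<in> {0..T}" using LL.pi(3) by eventually_elim simp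
  define src :: "bool \<times> nat \<Rightarrow> nat \<Rightarrow> nat \<Rightarrow> complex" where
    "src i n k = (if fst i then of_real (g n k) * hat n (R n) (vv n (snd i)) k else hat (Nf n) (L n) (uv n (snd i)) k)" for i n k
  define z where "z b n q = (\<Sum>a<Nf n. cnj (bb b n a) * uv n q a)" for b n q
  have unorm: "\<forall>\<^sub>F n in sequentially. \<forall>p<r. (\<Sum>a<Nf n. (cmod (uv n p a))\<^sup>2) = 1"
    using ou by eventually_elim (intro allI impI sum_cmod_square_eq_1, simp)
  have vnorm1: "\<forall>\<^sub>F n in sequentially. \<forall>p<r. (\<Sum>a<n. (cmod (vv n p a))\<^sup>2) = 1"
    using ov by eventually_elim (intro allI impI sum_cmod_square_eq_1, simp)
  have hu: "\<forall>\<^sub>F n in sequentially. (\<Sum>k<Nf n. (cmod (hat (Nf n) (L n) (uv n p) k))\<^sup>2) \<le> 1" if "p < r" for p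
    using unorm by eventually_elim (use isometric_bessel[OF L(1)] that in metis)
  have hv: "\<forall>\<^sub>F n in sequentially. (\<Sum>k<Nf n. (cmod (hat n (R n) (vv n p) k))\<^sup>2) \<le> 1" if "p < r" for p
    using vnorm1 by eventually_elim (use isometric_bessel[OF R] that in metis)
  have hb: "(\<Sum>k<Nf n. (cmod (hat (Nf n) (L n) (bb b n) k))\<^sup>2) \<le> Bd" for b n
    using isometric_bessel[OF L(1)] bB order_trans by blast
  have Bd0: "0 \<le> Bd" using order_trans[OF sum_nonneg hb] by (metis zero_le_power2)
  have hgv: "\<forall>\<^sub>F n in sequentially. (\<Sum>k<Nf n. (cmod (src (True, p) n k))\<^sup>2) \<le> T" if "p < r" for p
    using hv[OF that] tT
  proof eventually_elim
    case (elim n)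
    have "(\<Sum>k<Nf n. (cmod (src (True, p) n k))\<^sup>2) \<le> (\<Sum>k<Nf n. T * (cmod (hat n (R n) (vv n p) k))\<^sup>2)"
    proof (rule sum_mono)
      fix k assume "k \<in> {..<Nf n}"
      then have "(g n k)\<^sup>2 \<le> T" using elim(2) by (auto simp: t_def)
      then show "(cmod (src (True, p) n k))\<^sup>2 \<le> T * (cmod (hat n (R n) (vv n p) k))\<^sup>2"
        by (simp add: src_def norm_mult power_mult_distrib mult_right_mono)
    qed
    also have "\<dots> \<le> T" unfolding sum_distrib_left[symmetric] using elim(1) T0 by (rule mult_left_le)
    finally show ?case .
  qed
  have src_bound: "\<forall>\<^sub>F n in sequentially. (\<Sum>k<Nf n. (cmod (src (b, p) n k))\<^sup>2) \<le> 1 + T" if "p < r" for b p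
  proof (cases b)
    case True
    show ?thesis using hgv[OF that] by eventually_elim (use True in simp)
  next
    case False
    show ?thesis using hu[OF that] by eventually_elim (use False T0 in \<open>simp add: src_def\<close>)
  qed
  have even_odd: "(\<Sum>k<Nf n. of_real (t n k ^ m) * (x k :: complex)) = (\<Sum>k<Nf n. of_real (g n k ^ (2 * m)) * x k)" for n m x
    unfolding tpow ..
  \<comment> \<open>From powers to continuous functions for pairs of left vectors; \<open>y\<close>
    will be a spike direction or one of the vectors \<open>bb\<close>.\<close>
  have Lq: "(\<lambda>n. (\<Sum>k<Nf n. of_real (f (t n k)) * (cnj (hat (Nf n) (L n) (y n) k) * hat (Nf n) (L n) (uv n q) k))
       - (\<Sum>a<Nf n. cnj (y n a) * uv n q a) * of_real (\<integral>x. f x \<partial>\<pi>)) \<longlonglongrightarrow> 0"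
    if q: "q < r" and f: "f \<in> borel_measurable borel" "continuous_on {0..T} f"
      and conc: "\<And>m. (\<lambda>n. (\<Sum>k<Nf n. of_real (g n k ^ m) * (cnj (hat (Nf n) (L n) (y n) k) * hat (Nf n) (L n) (uv n q) k))
        - (\<Sum>a<Nf n. cnj (y n a) * uv n q a) * of_real ((\<Sum>k<Nf n. g n k ^ m) / Nf n)) \<longlonglongrightarrow> 0"
      and yb: "\<forall>\<^sub>F n in sequentially. (\<Sum>a<Nf n. (cmod (y n a))\<^sup>2) \<le> B0" for q f y B0
  proof (rule weighted_sum_limit_of_moments[OF pi(1,2) aeT tT _ _ _ f, where C = "(B0 + 1) / 2"])
    show "\<forall>\<^sub>F n in sequentially. (\<Sum>k<Nf n. cmod (cnj (hat (Nf n) (L n) (y n) k) * hat (Nf n) (L n) (uv n q) k)) \<le> (B0 + 1) / 2"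
      using yb hu[OF q]
    proof eventually_elim
      case (elim n)
      show ?case
        by (rule weighted_cauchy_schwarz[OF order_trans[OF isometric_bessel[OF L(1)] elim(1)] elim(2)])
    qed
    show zb: "\<forall>\<^sub>F n in sequentially. cmod (\<Sum>a<Nf n. cnj (y n a) * uv n q a) \<le> (B0 + 1) / 2"
      using yb unorm by eventually_elim
        (intro order_trans[OF norm_sum] weighted_cauchy_schwarz, use q in auto)
    fix m
    have "(\<lambda>n. (\<Sum>a<Nf n. cnj (y n a) * uv n q a) * of_real (Mn m n - M m)) \<longlonglongrightarrow> 0"
    proof (rule tendsto_0_le[where K = "(B0 + 1) / 2"])
      show "(\<lambda>n. Mn m n - M m) \<longlonglongrightarrow> 0" using tendsto_diff[OF M tendsto_const, of m "M m"] by simp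
      show "\<forall>\<^sub>F n in sequentially. norm ((\<Sum>a<Nf n. cnj (y n a) * uv n q a) * of_real (Mn m n - M m)) \<le> norm (Mn m n - M m) * ((B0 + 1) / 2)"
        using zb
      proof eventually_elim
        case (elim n)
        from mult_right_mono[OF elim norm_ge_zero[of "Mn m n - M m"]]
        show ?case unfolding norm_mult norm_of_real real_norm_def by (simp only: mult.commute)
      qed
    qed
    from tendsto_add[OF conc[of "2 * m"] this]
    show "(\<lambda>n. (\<Sum>k<Nf n. of_real (t n k ^ m) * (cnj (hat (Nf n) (L n) (y n) k) * hat (Nf n) (L n) (uv n q) k))
       - (\<Sum>a<Nf n. cnj (y n a) * uv n q a) * of_real (\<integral>x. x ^ m \<partial>\<pi>)) \<longlonglongrightarrow> 0"
      unfolding even_odd Mn_def M_def tpow by (simp add: algebra_simps)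
  qed
  \<comment> \<open>The right source contributes one factor \<open>g\<close>, so the
    \<open>m\<close>-th power of \<open>t\<close> calls for the odd power \<open>2 * m + 1\<close>
    of \<open>g\<close>.\<close>
  have Lx: "(\<lambda>n. \<Sum>k<Nf n. of_real (f (t n k)) * (cnj (hat (Nf n) (L n) (y n) k) * src (True, q) n k)) \<longlonglongrightarrow> 0"
    if q: "q < r" and f: "f \<in> borel_measurable borel" "continuous_on {0..T} f"
      and conc: "\<And>m. (\<lambda>n. \<Sum>k<Nf n. of_real (g n k ^ m) * (cnj (hat (Nf n) (L n) (y n) k) * hat n (R n) (vv n q) k)) \<longlonglongrightarrow> 0"
      and yb: "\<forall>\<^sub>F n in sequentially. (\<Sum>a<Nf n. (cmod (y n a))\<^sup>2) \<le> B0" for q f y B0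
  proof -
    have "(\<lambda>n. (\<Sum>k<Nf n. of_real (f (t n k)) * (cnj (hat (Nf n) (L n) (y n) k) * src (True, q) n k))
        - 0 * of_real (\<integral>x. f x \<partial>\<pi>)) \<longlonglongrightarrow> 0"
    proof (rule weighted_sum_limit_of_moments[OF pi(1,2) aeT tT _ _ _ f, where C = "(\<bar>B0\<bar> + T) / 2"])
      show "\<forall>\<^sub>F n in sequentially. (\<Sum>k<Nf n. cmod (cnj (hat (Nf n) (L n) (y n) k) * src (True, q) n k)) \<le> (\<bar>B0\<bar> + T) / 2"
        using yb hgv[OF q]
      proof eventually_elim
        case (elim n)
        have "(\<Sum>a<Nf n. (cmod (y n a))\<^sup>2) \<le> \<bar>B0\<bar>" using elim(1) by simp
        from weighted_cauchy_schwarz[OF order_trans[OF isometric_bessel[OF L(1)] this] elim(2)]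
        show ?case .
      qed
      show "\<forall>\<^sub>F n in sequentially. cmod 0 \<le> (\<bar>B0\<bar> + T) / 2" using T0 by simp
      fix m
      have "(\<Sum>k<Nf n. of_real (t n k ^ m) * (cnj (hat (Nf n) (L n) (y n) k) * src (True, q) n k))
         = (\<Sum>k<Nf n. of_real (g n k ^ (2 * m + 1)) * (cnj (hat (Nf n) (L n) (y n) k) * hat n (R n) (vv n q) k))" for n
        unfolding tpow src_def by (simp add: mult_ac)
      then show "(\<lambda>n. (\<Sum>k<Nf n. of_real (t n k ^ m) * (cnj (hat (Nf n) (L n) (y n) k) * src (True, q) n k))
         - 0 * of_real (\<integral>x. x ^ m \<partial>\<pi>)) \<longlonglongrightarrow> 0"
        using conc[of "2 * m + 1"] by simp
    qed
    then show ?thesis by simp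
  qed
  have u1: "\<forall>\<^sub>F n in sequentially. (\<Sum>a<Nf n. (cmod (uv n p a))\<^sup>2) \<le> 1" if "p < r" for p
    using unorm by eventually_elim (use that in simp)
  have FF: "(\<lambda>n. \<Sum>k<Nf n. of_real (f (t n k)) * (cnj (src (False, p) n k) * src (False, q) n k))
      \<longlonglongrightarrow> (if p = q then of_real (LL.ilaw False f) else 0)"
    if pq: "p < r" "q < r" and f: "f \<in> borel_measurable borel" "continuous_on {0..T} f" for p q f
  proof -
    have "\<forall>\<^sub>F n in sequentially. (if p = q then of_real (LL.ilaw False f) else 0)
       = (\<Sum>a<Nf n. cnj (uv n p a) * uv n q a) * complex_of_real (\<integral>x. f x \<partial>\<pi>)"
      using ou by eventually_elim (use pq in \<open>simp add: LL.ilaw_def\<close>)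
    then have "(\<lambda>n. (\<Sum>a<Nf n. cnj (uv n p a) * uv n q a) * complex_of_real (\<integral>x. f x \<partial>\<pi>)) \<longlonglongrightarrow> (if p = q then of_real (LL.ilaw False f) else 0)"
      by (rule Lim_transform_eventually[OF tendsto_const])
    from tendsto_add[OF Lq[OF pq(2) f cu[OF pq] u1[OF pq(1)]] this]
    show ?thesis by (simp add: src_def)
  qed
  have FT: "(\<lambda>n. \<Sum>k<Nf n. of_real (f (t n k)) * (cnj (src (False, p) n k) * src (True, q) n k)) \<longlonglongrightarrow> 0"
    if pq: "p < r" "q < r" and f: "f \<in> borel_measurable borel" "continuous_on {0..T} f" for p q f
    using Lx[OF pq(2) f cx[OF pq] u1[OF pq(1)]] by (simp add: src_def)
  have TF: "(\<lambda>n. \<Sum>k<Nf n. of_real (f (t n k)) * (cnj (src (True, p) n k) * src (False, q) n k)) \<longlonglongrightarrow> 0"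
    if pq: "p < r" "q < r" and f: "f \<in> borel_measurable borel" "continuous_on {0..T} f" for p q f
    using tendsto_cnj[OF FT[OF pq(2,1) f]] by (simp add: mult_ac)
  have TT: "(\<lambda>n. \<Sum>k<Nf n. of_real (f (t n k)) * (cnj (src (True, p) n k) * src (True, q) n k))
      \<longlonglongrightarrow> (if p = q then of_real (LL.ilaw True f) else 0)"
    if pq: "p < r" "q < r" and f: "f \<in> borel_measurable borel" "continuous_on {0..T} f" for p q f
  proof -
    \<comment> \<open>The mass is \<open>c\<close> rather than 1: concentration for \<open>R\<close>
      divides by \<open>n\<close>, whereas the moments divide by \<open>Nf n\<close>.\<close>
    define \<delta> :: complex where "\<delta> = (if p = q then of_real c else 0)"
    have "(\<lambda>n. (\<Sum>k<Nf n. of_real (t n k * f (t n k)) * (cnj (hat n (R n) (vv n p) k) * hat n (R n) (vv n q) k))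
       - \<delta> * of_real (\<integral>x. x * f x \<partial>\<pi>)) \<longlonglongrightarrow> 0"
    proof (rule weighted_sum_limit_of_moments[OF pi(1,2) aeT tT, where C = "1 + c"])
      show "\<forall>\<^sub>F n in sequentially. (\<Sum>k<Nf n. cmod (cnj (hat n (R n) (vv n p) k) * hat n (R n) (vv n q) k)) \<le> 1 + c"
        using hv[OF pq(1)] hv[OF pq(2)]
      proof eventually_elim
        case (elim n)
        from weighted_cauchy_schwarz[OF elim] show ?case using c by simp
      qed
      show "\<forall>\<^sub>F n in sequentially. cmod \<delta> \<le> 1 + c" using c by (simp add: \<delta>_def)
      fix m
      have "(\<lambda>n. (if p = q then 1 else 0) * (complex_of_real (Mn m n) * of_real (real (Nf n) / real n))) \<longlonglongrightarrow> (if p = q then 1 else 0) * (of_real (M m) * of_real c)"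
        by (intro tendsto_intros M c)
      moreover have "\<forall>\<^sub>F n in sequentially. (if p = q then 1 else 0) * (complex_of_real (Mn m n) * of_real (real (Nf n) / real n))
          = (\<Sum>a<n. cnj (vv n p a) * vv n q a) * of_real ((\<Sum>k<Nf n. g n k ^ (2 * m)) / n)"
        using ov Nlarge[of 1]
      proof eventually_elim
        case (elim n)
        have "Mn m n * (real (Nf n) / real n) = (\<Sum>k<Nf n. g n k ^ (2 * m)) / n"
          unfolding Mn_def tpow using elim(2) by simp
        then show ?case using elim(1) pq by (simp add: of_real_mult[symmetric] del: of_real_mult of_real_divide)
      qed
      ultimately have "(\<lambda>n. (\<Sum>a<n. cnj (vv n p a) * vv n q a) * of_real ((\<Sum>k<Nf n. g n k ^ (2 * m)) / n)) \<longlonglongrightarrow> (if p = q then 1 else 0) * (of_real (M m) * of_real c)"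
        by (rule Lim_transform_eventually)
      from tendsto_diff[OF tendsto_add[OF cv[OF pq, of "2 * m"] this] tendsto_const, of "\<delta> * of_real (M m)"]
      show "(\<lambda>n. (\<Sum>k<Nf n. of_real (t n k ^ m) * (cnj (hat n (R n) (vv n p) k) * hat n (R n) (vv n q) k))
       - \<delta> * of_real (\<integral>x. x ^ m \<partial>\<pi>)) \<longlonglongrightarrow> 0"
        unfolding even_odd by (simp add: M_def \<delta>_def mult.commute split: if_splits)
    next
      show "(\<lambda>x. x * f x) \<in> borel_measurable borel" using f(1) by measurable
      show "continuous_on {0..T} (\<lambda>x. x * f x)" using f(2) by (intro continuous_intros)
    qed
    moreover have "\<delta> * of_real (\<integral>x. x * f x \<partial>\<pi>) = (if p = q then of_real (LL.ilaw True f) else 0)"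
      unfolding \<delta>_def LL.ilaw_def by simp
    \<comment> \<open>The factor \<open>t\<close> of the weight is shared between the two right
      sources.\<close>
    moreover have "(\<Sum>k<Nf n. of_real (t n k * f (t n k)) * (cnj (hat n (R n) (vv n p) k) * hat n (R n) (vv n q) k))
       = (\<Sum>k<Nf n. of_real (f (t n k)) * (cnj (src (True, p) n k) * src (True, q) n k))" for n
      unfolding src_def t_def by (intro sum.cong refl) (simp add: power2_eq_square mult_ac)
    ultimately show ?thesis using LIM_zero_cancel by auto
  qed
  define xi where "xi n q = hat (Nf n) (L n) (uh n q)" for n q
  interpret SP: spiked \<pi> c T Nf t r src om \<omega> lh xi
  proof
    show "\<forall>\<^sub>F n in sequentially. \<forall>k<Nf n. t n k \<in> {0..T}" by (rule tT)
    show "\<exists>C. \<forall>i\<in>UNIV \<times> {..<r}. \<forall>\<^sub>F n in sequentially. (\<Sum>k<Nf n. (cmod (src i n k))\<^sup>2) \<le> C"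
      using src_bound by (intro exI[of _ "1 + T"]) auto
    show "(\<lambda>n. \<Sum>k<Nf n. of_real (f (t n k)) * (cnj (src i n k) * src j n k))
          \<longlonglongrightarrow> (if i = j then of_real (LL.ilaw (fst i) f) else 0)"
      if "i \<in> UNIV \<times> {..<r}" "j \<in> UNIV \<times> {..<r}" "f \<in> borel_measurable borel" "continuous_on {0..T} f" for i j f
    proof -
      obtain b p b' q where ij: "i = (b, p)" "j = (b', q)" "p < r" "q < r" using \<open>i \<in> _\<close> \<open>j \<in> _\<close> by auto
      show ?thesis using FF[OF ij(3,4) that(3,4)] FT[OF ij(3,4) that(3,4)] TF[OF ij(3,4) that(3,4)] TT[OF ij(3,4) that(3,4)]
        unfolding ij by (cases b; cases b') auto
    qed
    show "(\<lambda>n. om n p) \<longlonglongrightarrow> \<omega> p" if "p < r" for p by (rule om[OF that])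
    show "\<forall>\<^sub>F n in sequentially. \<forall>q<Nf n. \<forall>q'<Nf n. (\<Sum>k<Nf n. cnj (xi n q k) * xi n q' k) = (if q = q' then 1 else 0)"
      unfolding xi_def using hat_parseval[OF L(2)] uho by simp
    show "\<forall>\<^sub>F n in sequentially. \<forall>q<Nf n. \<forall>q'<Nf n. q \<le> q' \<longrightarrow> lh n q' \<le> lh n q" using lhm by simp
    show "\<forall>\<^sub>F n in sequentially. r \<le> Nf n" by (rule Nlarge)
  qed
  have gram: "\<forall>\<^sub>F n in sequentially. \<forall>q<Nf n. \<forall>k<Nf n. SP.gram_op n (xi n q) k = of_real (lh n q) * xi n q k"
    using S ov eig
  proof (eventually_elim, intro allI impI)
    fix n q k
    assume eig: "\<forall>q<Nf n. \<forall>a<Nf n.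
        (\<Sum>b<n. S n a b * (\<Sum>a'<Nf n. cnj (S n a' b) * uh n q a')) = of_real (lh n q) * uh n q a"
    assume S: "\<forall>a<Nf n. \<forall>b<n. S n a b = (\<Sum>k<Nf n. L n $$ (a, k) * of_real (g n k) * cnj (R n $$ (b, k)))
        + (\<Sum>p<r. uv n p a * of_real (om n p) * cnj (vv n p b))"
      and ov: "\<forall>p<r. \<forall>q<r. (\<Sum>a<n. cnj (vv n p a) * vv n q a) = (if p = q then 1 else 0)"
      and qk: "q < Nf n" "k < Nf n"
    have "SP.gram_op n (xi n q) k = of_real ((g n k)\<^sup>2) * hat (Nf n) (L n) (uh n q) k + (\<Sum>p<r. of_real (om n p) *
        ((\<Sum>k<Nf n. cnj (of_real (g n k) * hat n (R n) (vv n p) k) * hat (Nf n) (L n) (uh n q) k)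
          + of_real (om n p) * (\<Sum>k<Nf n. cnj (hat (Nf n) (L n) (uv n p) k) * hat (Nf n) (L n) (uh n q) k)) * hat (Nf n) (L n) (uv n p) k
        + of_real (om n p) * (\<Sum>k<Nf n. cnj (hat (Nf n) (L n) (uv n p) k) * hat (Nf n) (L n) (uh n q) k) * (of_real (g n k) * hat n (R n) (vv n p) k))"
      unfolding SP.gram_op_def SP.sum_Ix SP.coef_def SP.ip_def xi_def t_def Let_def
      by (simp add: src_def)
    also have "\<dots> = hat (Nf n) (L n) (\<lambda>a. \<Sum>b<n. S n a b * (\<Sum>a'<Nf n. cnj (S n a' b) * uh n q a')) k"
      by (rule gram_matrix_coordinates[OF L R, symmetric]) (use S ov qk in auto)
    also have "\<dots> = hat (Nf n) (L n) (\<lambda>a. of_real (lh n q) * uh n q a) k"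
      by (rule hat_cong) (use eig qk(1) in blast)
    also have "\<dots> = of_real (lh n q) * xi n q k"
      unfolding xi_def hat_def by (simp add: sum_distrib_left mult_ac)
    finally show "SP.gram_op n (xi n q) k = of_real (lh n q) * xi n q k" .
  qed
  define \<beta> where "\<beta> b n = hat (Nf n) (L n) (bb b n)" for b n
  have main: "(\<lambda>n. (\<Sum>q\<in>G. SP.ip n (\<beta> True n) (xi n q) * SP.ip n (xi n q) (\<beta> False n))
    - of_real ((LL.rA \<rho>)\<^sup>2 * (1 + LL.rB \<rho>) / (LL.rA \<rho> * LL.rB2 \<rho> + LL.rA2 \<rho> * (1 + LL.rB \<rho>)))
        * (\<Sum>p\<in>G. z True n p * cnj (z False n p))) \<longlonglongrightarrow> 0"
  proof (rule SP.eigenprojection_asymptotics[OF lpT(2) \<omega>i _ \<omega>pos J G gram])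
    show "\<omega>i\<^sup>2 * LL.rg \<rho> = 1" using \<rho>(2) LL.gfun_eq[OF lpT(2)] by simp
    show "\<exists>C. \<forall>\<^sub>F n in sequentially. (\<Sum>k<Nf n. (cmod (\<beta> b n k))\<^sup>2) \<le> C" for b
      unfolding \<beta>_def using hb by (intro exI[of _ Bd]) simp
    show "\<exists>C. \<forall>\<^sub>F n in sequentially. cmod (z b n p) \<le> C" if "p < r" for b p
    proof (intro exI)
      show "\<forall>\<^sub>F n in sequentially. cmod (z b n p) \<le> (Bd + 1) / 2"
        using u1[OF that] unfolding z_def
        by eventually_elim (intro order_trans[OF norm_sum] weighted_cauchy_schwarz bB)
    qed
    show "(\<lambda>n. (\<Sum>k<Nf n. of_real (f (t n k)) * (cnj (\<beta> b n k) * src i n k))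
          - (if fst i then 0 else z b n (snd i) * of_real (LL.ilaw False f))) \<longlonglongrightarrow> 0"
      if "i \<in> UNIV \<times> {..<r}" "f \<in> borel_measurable borel" "continuous_on {0..T} f" for b i f
    proof -
      obtain b' p where i: "i = (b', p)" "p < r" using \<open>i \<in> _\<close> by auto
      have bB': "\<forall>\<^sub>F n in sequentially. (\<Sum>a<Nf n. (cmod (bb b n a))\<^sup>2) \<le> Bd" using bB by simp
      show ?thesis
      proof (cases b')
        case True
        then show ?thesis using Lx[OF i(2) that(2,3) cbx[OF i(2)] bB'] unfolding i \<beta>_def by simp
      next
        case False
        then show ?thesis using Lq[OF i(2) that(2,3) cb[OF i(2)] bB']
          unfolding i \<beta>_def z_def LL.ilaw_def src_def by simp
      qed
    qed
  qed
  have zc: "cnj (z False n p) = (\<Sum>a<Nf n. cnj (uv n p a) * bb False n a)" for n p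
    unfolding z_def by (simp add: mult.commute)
  have ips: "SP.ip n (\<beta> True n) (xi n q) = (\<Sum>a<Nf n. cnj (bb True n a) * uh n q a)"
    "SP.ip n (xi n q) (\<beta> False n) = (\<Sum>a<Nf n. cnj (uh n q a) * bb False n a)" for n q
    unfolding SP.ip_def \<beta>_def xi_def by (simp_all add: hat_parseval[OF L(2)])
  show ?thesis using main unfolding zc ips LL.spike_weight_eq[OF lpT(2)] by (simp only: z_def)
qed

theorem theorem2:
  fixes M :: "'w measure"
    and Nf :: "nat \<Rightarrow> nat" and c :: real
    and L Gam W :: "nat \<Rightarrow> 'w \<Rightarrow> complex mat" and cols :: "nat \<Rightarrow> nat \<Rightarrow> nat"
    and \<pi> :: "real measure" and lm lp :: real
    and r s :: nat and j :: "nat \<Rightarrow> nat" and omega :: "nat \<Rightarrow> real"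
    and P U V :: "nat \<Rightarrow> complex mat" and om :: "nat \<Rightarrow> nat \<Rightarrow> real"
    and uh :: "nat \<Rightarrow> 'w \<Rightarrow> nat \<Rightarrow> complex vec" and lh :: "nat \<Rightarrow> 'w \<Rightarrow> nat \<Rightarrow> real"
    and i :: nat and \<rho> :: real and b1 b2 :: "nat \<Rightarrow> complex vec"
  defines "R \<equiv> (\<lambda>n w. mat n (Nf n) (\<lambda>(a,b). W n w $$ (a, cols n b)))"
  defines "X \<equiv> (\<lambda>n w. L n w * Gam n w * mat_adjoint (R n w))"
  defines "Sig \<equiv> (\<lambda>n w. X n w + P n)"
  assumes M: "prob_space M"
  (* (A1) *)
  assumes A1: "\<forall>n. Nf n \<le> n" "(\<lambda>n. real (Nf n) / real n) \<longlonglongrightarrow> c" "0 < c" "c \<le> 1"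
  (* (A2) *)
  assumes L_haar: "\<forall>n. L n \<in> M \<rightarrow>\<^sub>M mat_space (Nf n) (Nf n) \<and>
                         haar_unitary (Nf n) (distr M (mat_space (Nf n) (Nf n)) (L n))"
  assumes Gam_diag: "\<forall>n. Gam n \<in> M \<rightarrow>\<^sub>M mat_space (Nf n) (Nf n) \<and>
        (\<forall>w\<in>space M. Gam n w \<in> carrier_mat (Nf n) (Nf n) \<and> diagonal_mat (Gam n w) \<and>
            (\<forall>k<Nf n. Gam n w $$ (k,k) \<in> \<real> \<and> 0 \<le> Re (Gam n w $$ (k,k))))"
  assumes W_haar: "\<forall>n. W n \<in> M \<rightarrow>\<^sub>M mat_space n n \<and>
                         haar_unitary n (distr M (mat_space n n) (W n))"
  assumes cols: "\<forall>n. inj_on (cols n) {..<Nf n} \<and> cols n ` {..<Nf n} \<subseteq> {..<n}"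
  assumes indep: "\<forall>n. prob_space.indep_vars M
        (\<lambda>k. [mat_space (Nf n) (Nf n), mat_space (Nf n) (Nf n), mat_space n (Nf n)] ! k)
        (\<lambda>k. [L n, Gam n, R n] ! k) {0, 1, 2}"
  (* (A3) *)
  assumes pi: "prob_space \<pi>" "sets \<pi> = sets borel" "lm \<le> lp" "measure \<pi> {lm..lp} = 1"
  assumes A3: "\<forall>z. 0 < Im z \<longrightarrow> (AE w in M.
        (\<lambda>n. mtrace (minv (X n w * mat_adjoint (X n w) - z \<cdot>\<^sub>m 1\<^sub>m (Nf n))) / of_nat (Nf n))
          \<longlonglongrightarrow> stieltjes \<pi> z)"
  (* (A4) *)
  assumes A4: "AE w in M. (\<lambda>n. opnorm (X n w * mat_adjoint (X n w))) \<longlonglongrightarrow> lp"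
  (* (A5) *)
  assumes groups: "\<forall>l<s. 0 < j l" "(\<Sum>l<s. j l) = r"
    "\<forall>l l'. l < l' \<and> l' < s \<longrightarrow> omega l' < omega l" "\<forall>l<s. 0 < omega l"
  assumes svd: "\<forall>\<^sub>F n in sequentially.
        P n \<in> carrier_mat (Nf n) n \<and>
        U n \<in> carrier_mat (Nf n) r \<and> mat_adjoint (U n) * U n = 1\<^sub>m r \<and>
        V n \<in> carrier_mat n r \<and> mat_adjoint (V n) * V n = 1\<^sub>m r \<and>
        (\<forall>k. k + 1 < r \<longrightarrow> om n (k + 1) \<le> om n k) \<and> (\<forall>k<r. 0 < om n k) \<and>
        P n = U n * mat_diag r (\<lambda>k. complex_of_real (om n k)) * mat_adjoint (V n)"
  assumes Om_lim: "\<forall>k<r. (\<lambda>n. om n k) \<longlonglongrightarrow> omega (blk j s k)"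
  (* ordered eigenvalues / orthonormal eigenvectors of Sig Sig^* (any choice) *)
  assumes eig: "\<forall>n. \<forall>w\<in>space M. \<forall>k<Nf n.
        uh n w k \<in> carrier_vec (Nf n) \<and>
        (Sig n w * mat_adjoint (Sig n w)) *\<^sub>v uh n w k = complex_of_real (lh n w k) \<cdot>\<^sub>v uh n w k \<and>
        (\<forall>k'<Nf n. uh n w k \<bullet>c uh n w k' = (if k = k' then 1 else 0)) \<and>
        (\<forall>k'<Nf n. k \<le> k' \<longrightarrow> lh n w k' \<le> lh n w k)"
  (* the theorem's hypotheses *)
  assumes i: "i < s"
  assumes thr: "ereal ((omega i)\<^sup>2) > 1 / Lim (at_right lp) (\<lambda>x. ereal (gfun c \<pi> x))"
  assumes rho: "lp < \<rho>" "(omega i)\<^sup>2 * gfun c \<pi> \<rho> = 1"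
  assumes b: "\<forall>n. b1 n \<in> carrier_vec (Nf n) \<and> b2 n \<in> carrier_vec (Nf n)"
    "\<exists>B. \<forall>n. vnorm (b1 n) \<le> B \<and> vnorm (b2 n) \<le> B"
  shows "AE w in M. (\<lambda>n.
      (\<Sum>k\<in>{k. k < r \<and> blk j s k = i}. (uh n w k \<bullet>c b1 n) * (b2 n \<bullet>c uh n w k))
      - complex_of_real (\<rho> * (stieltjes_r \<pi> \<rho>)\<^sup>2 * mtilde c \<pi> \<rho> / deriv (gfun c \<pi>) \<rho>)
        * (\<Sum>k\<in>{k. k < r \<and> blk j s k = i}. (col (U n) k \<bullet>c b1 n) * (b2 n \<bullet>c col (U n) k)))
    \<longlonglongrightarrow> 0"
proof -
  interpret prob_space M by (rule M)
  define g where "g n w k = Re (Gam n w $$ (k, k))" for n w k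
  define J where "J = (\<Sum>l\<le>i. j l)"
  define m0 where "m0 = (\<Sum>l<i. j l)"
  define G where "G = {k. k < r \<and> blk j s k = i}"
  define \<omega> where "\<omega> p = omega (blk j s p)" for p
  obtain B0 where B0: "\<And>n. vnorm (b1 n) \<le> B0" "\<And>n. vnorm (b2 n) \<le> B0" using b(2) by blast
  have bc: "b1 n \<in> carrier_vec (Nf n)" "b2 n \<in> carrier_vec (Nf n)" for n using b(1) by auto
  have vn: "(\<Sum>a<m. (cmod (v $ a))\<^sup>2) \<le> B0\<^sup>2" if "v \<in> carrier_vec m" "vnorm v \<le> B0" for v m
  proof -
    have "(\<Sum>a<m. (cmod (v $ a))\<^sup>2) = (vnorm v)\<^sup>2" using that(1) by (simp add: vnorm_def sum_nonneg)
    also have "\<dots> \<le> B0\<^sup>2" using that(2) by (intro power_mono) (simp_all add: vnorm_def sum_nonneg)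
    finally show ?thesis .
  qed
  have Uo: "\<forall>\<^sub>F n in sequentially. \<forall>p<r. \<forall>q<r. (\<Sum>a<Nf n. cnj (U n $$ (a, p)) * U n $$ (a, q)) = (if p = q then 1 else 0)"
    using svd by eventually_elim (use orthonormal_columns in blast)
  have Vo: "\<forall>\<^sub>F n in sequentially. \<forall>p<r. \<forall>q<r. (\<Sum>a<n. cnj (V n $$ (a, p)) * V n $$ (a, q)) = (if p = q then 1 else 0)"
    using svd by eventually_elim (use orthonormal_columns in blast)
  \<comment> \<open>Index \<open>r\<close> stands for \<open>b1\<close> and every larger one for
    \<open>b2\<close>, so one concentration statement covers spike directions and fixed
    vectors.\<close>
  define vL where "vL n l a = (if l < r then U n $$ (a, l) else if l = r then b1 n $ a else b2 n $ a)" for n l a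
  define vR where "vR n p a = V n $$ (a, p)" for n p a
  have vLb: "\<forall>\<^sub>F n in sequentially. (\<Sum>a<Nf n. (cmod (vL n l a))\<^sup>2) \<le> max 1 (B0\<^sup>2)" for l
    using Uo
  proof eventually_elim
    case (elim n)
    show ?case
    proof (cases "l < r")
      case True
      then have "(\<Sum>a<Nf n. (cmod (U n $$ (a, l)))\<^sup>2) \<le> 1" using elim by (intro eq_refl sum_cmod_square_eq_1) simp
      then show ?thesis using True by (simp add: vL_def)
    next
      case False
      then show ?thesis using vn[OF bc(1) B0(1), of n] vn[OF bc(2) B0(2), of n]
        by (cases "l = r") (simp_all add: vL_def le_max_iff_disj)
    qed
  qed
  have vRb: "\<forall>\<^sub>F n in sequentially. (\<Sum>a<n. (cmod (vR n p a))\<^sup>2) \<le> 1" if "p < r" for p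
    using Vo by eventually_elim (use that in \<open>auto simp: vR_def intro!: eq_refl sum_cmod_square_eq_1\<close>)

  have Lm: "L n \<in> M \<rightarrow>\<^sub>M mat_space (Nf n) (Nf n)" and Gm: "Gam n \<in> M \<rightarrow>\<^sub>M mat_space (Nf n) (Nf n)" for n
    using L_haar Gam_diag by auto
  have Linv: "left_invariant M (Nf n) (Nf n) (L n)" and LU: "AE w in M. unitary_mat (Nf n) (L n w)" for n
    using haar_left_invariant[OF Lm] L_haar by auto
  have Rinv: "left_invariant M n (Nf n) (R n)" and Riso: "AE w in M. isometric n (Nf n) (R n w)" for n
    using haar_columns_left_invariant[of "W n" M n "cols n" "Nf n"] W_haar cols unfolding R_def by auto
  have Liso: "AE w in M. isometric (Nf n) (Nf n) (L n w)" for n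
    using LU[of n] by eventually_elim (rule unitary_mat_entries)
  define Mp where "Mp n = (\<lambda>k::nat. [mat_space (Nf n) (Nf n), mat_space (Nf n) (Nf n), mat_space n (Nf n)] ! k)" for n
  \<comment> \<open>The companion of the left Haar factor is the pair of \<open>Gam\<close> and
    \<open>R\<close>; forms in \<open>R\<close> alone involve only the diagonal, so there it is
    \<open>Gam\<close>.\<close>
  define YL where "YL n w = (\<lambda>k\<in>{1, 2::nat}. ([L n, Gam n, R n] ! k) w)" for n w
  define YR where "YR n w = (\<lambda>k\<in>{1::nat}. ([L n, Gam n, R n] ! k) w)" for n w
  have indL: "indep_pair M (mat_space (Nf n) (Nf n)) (L n) (PiM {1, 2} (Mp n)) (YL n)" for n
    using indep_vars_indep_pair[OF M indep[rule_format, of n], of 0 "{1, 2}"]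
    unfolding YL_def[abs_def] Mp_def by simp
  have indR: "indep_pair M (mat_space n (Nf n)) (R n) (PiM {1} (Mp n)) (YR n)" for n
    using indep_vars_indep_pair[OF M indep[rule_format, of n], of 2 "{1}"]
    unfolding YR_def[abs_def] Mp_def by simp
  define \<gamma> :: "nat \<Rightarrow> (nat \<Rightarrow> complex mat) \<Rightarrow> nat \<Rightarrow> real" where "\<gamma> n y k = Re (y 1 $$ (k, k))" for n y k
  have comp: "(\<lambda>y. y l) \<in> PiM I (Mp n) \<rightarrow>\<^sub>M Mp n l" if "l \<in> I" for l I n
    using that by (rule measurable_component_singleton)
  have \<gamma>m: "(\<lambda>y. \<gamma> n y k) \<in> borel_measurable (PiM I (Mp n))" if "k < Nf n" "1 \<in> I" for n k I
  proof -
    have "(\<lambda>y. y 1) \<in> PiM I (Mp n) \<rightarrow>\<^sub>M mat_space (Nf n) (Nf n)" using comp[OF that(2), of n] by (simp add: Mp_def)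
    from measurable_compose[OF measurable_compose[OF this measurable_entry[OF that(1) that(1)]] borel_measurable_Re]
    show ?thesis unfolding \<gamma>_def .
  qed
  have \<gamma>g: "\<gamma> n (YL n w) k = g n w k" "\<gamma> n (YR n w) k = g n w k" for n w k
    by (simp_all add: \<gamma>_def YL_def YR_def g_def)
  have hatm: "(\<lambda>y. hat n (y 2) (vR n q) k) \<in> borel_measurable (PiM {1, 2} (Mp n))" if "k < Nf n" for n q k
  proof -
    have "(\<lambda>y. y 2) \<in> PiM {1, 2} (Mp n) \<rightarrow>\<^sub>M mat_space n (Nf n)" using comp[of 2 "{1, 2}" n] by (simp add: Mp_def)
    from measurable_compose[OF this measurable_hat[OF that]] show ?thesis .
  qed
  have Gd: "Gam n w \<in> carrier_mat (Nf n) (Nf n)" "diagonal_mat (Gam n w)"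
    "\<And>k. k < Nf n \<Longrightarrow> Gam n w $$ (k, k) = of_real (g n w k)" if "w \<in> space M" for n w
  proof -
    show "Gam n w \<in> carrier_mat (Nf n) (Nf n)" "diagonal_mat (Gam n w)" using Gam_diag that by auto
    show "Gam n w $$ (k, k) = of_real (g n w k)" if "k < Nf n" for k
      using Gam_diag \<open>w \<in> space M\<close> that unfolding g_def by (simp add: of_real_Re)
  qed
  have Rc: "R n w \<in> carrier_mat n (Nf n)" for n w unfolding R_def by simp
  have Lc: "L n w \<in> carrier_mat (Nf n) (Nf n)" if "w \<in> space M" for n w
    using measurable_space[OF Lm that] by (simp add: space_mat_space)
  have Xc: "X n w \<in> carrier_mat (Nf n) n" if "w \<in> space M" for n w
    unfolding X_def using mult_carrier_mat[OF mult_carrier_mat[OF Lc[OF that] Gd(1)[OF that]] mat_adjoint_carrier[OF Rc]] .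
  have Xi: "X n w $$ (a, b) = (\<Sum>k<Nf n. L n w $$ (a, k) * of_real (g n w k) * cnj (R n w $$ (b, k)))"
    if "w \<in> space M" "a < Nf n" "b < n" for n w a b
    unfolding X_def singular_model_index[OF Lc[OF that(1)] Gd(1,2)[OF that(1)] Rc that(2,3)]
    by (intro sum.cong refl) (simp add: Gd(3)[OF that(1)])
  have XX: "X n w * mat_adjoint (X n w) = spectral_mat (Nf n) (L n w) (\<lambda>k. of_real ((g n w k)\<^sup>2))"
    if "w \<in> space M" "isometric n (Nf n) (R n w)" for n w
    by (rule gram_of_singular_model[OF that(2) Xc[OF that(1)] Xi[OF that(1)]])
  have AEL: "AE w in M. \<forall>n. unitary_mat (Nf n) (L n w)" using LU by (simp add: AE_all_countable)
  have AER: "AE w in M. \<forall>n. isometric n (Nf n) (R n w)" using Riso by (simp add: AE_all_countable)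
  have gle: "(g n w k)\<^sup>2 \<le> opnorm (X n w * mat_adjoint (X n w))"
    if "w \<in> space M" "\<forall>n. unitary_mat (Nf n) (L n w)" "\<forall>n. isometric n (Nf n) (R n w)" "k < Nf n" for n w k
    unfolding XX[OF that(1) that(3)[rule_format]]
    by (rule spectral_mat_le_opnorm[OF unitary_mat_entries(1)[OF that(2)[rule_format]] that(4)]) simp
  \<comment> \<open>Squared singular values are at most the operator norm of the Gram matrix of X,
    which converges to \<open>lp\<close>; the bound sets in at an \<open>n\<close> that depends on
    the path.\<close>
  have K: "AE w in M. \<exists>K. \<forall>\<^sub>F n in sequentially. \<forall>k<Nf n. \<bar>g n w k\<bar> \<le> K"
    using A4 AEL AER AE_space
  proof eventually_elim
    case (elim w)
    have "\<forall>\<^sub>F n in sequentially. opnorm (X n w * mat_adjoint (X n w)) < lp + 1"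
      using order_tendstoD(2)[OF elim(1), of "lp + 1"] by simp
    then have "\<forall>\<^sub>F n in sequentially. \<forall>k<Nf n. \<bar>g n w k\<bar> \<le> sqrt (lp + 1)"
    proof eventually_elim
      case (elim n)
      show ?case
      proof (intro allI impI)
        fix k assume "k < Nf n"
        from gle[OF \<open>w \<in> space M\<close> \<open>\<forall>n. unitary_mat (Nf n) (L n w)\<close> \<open>\<forall>n. isometric n (Nf n) (R n w)\<close> this] elim
        have "(g n w k)\<^sup>2 \<le> lp + 1" by simp
        then show "\<bar>g n w k\<bar> \<le> sqrt (lp + 1)" by (rule real_le_rsqrt[OF _, of "\<bar>g n w k\<bar>", unfolded power2_abs])
      qed
    qed
    then show ?case by blast
  qed
  note Nlin = linear_growth_of_ratio(1)[OF A1(2,3)] and Nlarge = linear_growth_of_ratio(2)[OF A1(2,3), of r]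
  \<comment> \<open>Each triple of natural numbers has its own null set; countably many of them are
    merged afterwards.\<close>
  have "AE w in M. (\<lambda>n. (\<Sum>k<Nf n. of_real (\<gamma> n (YL n w) k ^ m) *
        (cnj (hat (Nf n) (L n w) (vL n l) k) * hat (Nf n) (L n w) (vL n q) k))
        - (\<Sum>a<Nf n. cnj (vL n l a) * vL n q a) * of_real ((\<Sum>k<Nf n. \<gamma> n (YL n w) k ^ m) / Nf n)) \<longlonglongrightarrow> 0" for l q m
    by (rule sesquilinear_form_concentration[OF M Linv indL Liso \<gamma>m order_refl _ Nlin _ vLb vLb])
      (use A1(3) K in \<open>auto simp: \<gamma>g\<close>)
  then have AEcu: "AE w in M. \<forall>l q m. (\<lambda>n. (\<Sum>k<Nf n. of_real (g n w k ^ m) *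
        (cnj (hat (Nf n) (L n w) (vL n l) k) * hat (Nf n) (L n w) (vL n q) k))
        - (\<Sum>a<Nf n. cnj (vL n l a) * vL n q a) * of_real ((\<Sum>k<Nf n. g n w k ^ m) / Nf n)) \<longlonglongrightarrow> 0"
    unfolding AE_all_countable \<gamma>g by blast
  have "AE w in M. (\<lambda>n. (\<Sum>k<Nf n. of_real (\<gamma> n (YR n w) k ^ m) *
        (cnj (hat n (R n w) (vR n p) k) * hat n (R n w) (vR n q) k))
        - (\<Sum>a<n. cnj (vR n p a) * vR n q a) * of_real ((\<Sum>k<Nf n. \<gamma> n (YR n w) k ^ m) / n)) \<longlonglongrightarrow> 0"
    if "p < r" "q < r" for p q m
    by (rule sesquilinear_form_concentration[where \<delta> = 1, OF M Rinv indR Riso \<gamma>m A1(1)[rule_format] _ _ _ vRb[OF that(1)] vRb[OF that(2)]])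
      (use K in \<open>auto simp: \<gamma>g\<close>)
  \<comment> \<open>The bounds on \<open>p\<close> and \<open>q\<close> become premises inside the
    event, so that the quantifiers range over all natural numbers and
    \<open>AE_all_countable\<close> applies.\<close>
  then have "AE w in M. p < r \<longrightarrow> q < r \<longrightarrow> (\<lambda>n. (\<Sum>k<Nf n. of_real (g n w k ^ m) *
        (cnj (hat n (R n w) (vR n p) k) * hat n (R n w) (vR n q) k))
        - (\<Sum>a<n. cnj (vR n p a) * vR n q a) * of_real ((\<Sum>k<Nf n. g n w k ^ m) / n)) \<longlonglongrightarrow> 0" for p q m
    unfolding \<gamma>g by (cases "p < r \<and> q < r") auto
  then have AEcv: "AE w in M. \<forall>p q m. p < r \<longrightarrow> q < r \<longrightarrow> (\<lambda>n. (\<Sum>k<Nf n. of_real (g n w k ^ m) *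
        (cnj (hat n (R n w) (vR n p) k) * hat n (R n w) (vR n q) k))
        - (\<Sum>a<n. cnj (vR n p a) * vR n q a) * of_real ((\<Sum>k<Nf n. g n w k ^ m) / n)) \<longlonglongrightarrow> 0"
    unfolding AE_all_countable by blast
  have YL2: "YL n w 2 = R n w" for n w by (simp add: YL_def)
  have "AE w in M. (\<lambda>n. \<Sum>k<Nf n. of_real (\<gamma> n (YL n w) k ^ m) *
        (cnj (hat (Nf n) (L n w) (vL n l) k) * hat n (YL n w 2) (vR n q) k)) \<longlonglongrightarrow> 0" if q: "q < r" for l q m
  proof (rule bilinear_form_concentration[OF M Linv indL Liso \<gamma>m hatm _ Nlin _ vLb, where V = 1])
    show "\<forall>\<^sub>F n in sequentially. AE w in M. (\<Sum>k<Nf n. (cmod (hat n (YL n w 2) (vR n q) k))\<^sup>2) \<le> 1"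
      using vRb[OF q]
    proof eventually_elim
      case (elim n)
      show ?case using Riso[of n]
        by eventually_elim (use order_trans[OF isometric_bessel elim] in \<open>simp add: YL2\<close>)
    qed
  qed (use A1(3) K in \<open>auto simp: \<gamma>g\<close>)
  then have "AE w in M. q < r \<longrightarrow> (\<lambda>n. \<Sum>k<Nf n. of_real (g n w k ^ m) *
        (cnj (hat (Nf n) (L n w) (vL n l) k) * hat n (R n w) (vR n q) k)) \<longlonglongrightarrow> 0" for l q m
    unfolding \<gamma>g YL2 by (cases "q < r") auto
  then have AEcx: "AE w in M. \<forall>l q m. q < r \<longrightarrow> (\<lambda>n. \<Sum>k<Nf n. of_real (g n w k ^ m) *
        (cnj (hat (Nf n) (L n w) (vL n l) k) * hat n (R n w) (vR n q) k)) \<longlonglongrightarrow> 0"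
    unfolding AE_all_countable by blast
  have "AE w in M. 0 < y \<longrightarrow> (\<lambda>n. mtrace (minv (X n w * mat_adjoint (X n w) - (\<i> * of_nat y) \<cdot>\<^sub>m 1\<^sub>m (Nf n))) / of_nat (Nf n))
          \<longlonglongrightarrow> stieltjes \<pi> (\<i> * of_nat y)" for y :: nat
    using A3[rule_format, of "\<i> * of_nat y"] by (cases "0 < y") auto
  then have AEst: "AE w in M. \<forall>y::nat. 0 < y \<longrightarrow> (\<lambda>n. mtrace (minv (X n w * mat_adjoint (X n w) - (\<i> * of_nat y) \<cdot>\<^sub>m 1\<^sub>m (Nf n))) / of_nat (Nf n))
          \<longlonglongrightarrow> stieltjes \<pi> (\<i> * of_nat y)"
    unfolding AE_all_countable by blast

  have r: "r = (\<Sum>l<s. j l)" using groups(2) by simp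
  have ij: "0 < j i" "J \<le> r" "m0 < J" "J = m0 + j i"
  proof -
    show "0 < j i" using groups(1) i by blast
    show "J \<le> r" unfolding J_def r using i by (intro sum_mono2) auto
    show "J = m0 + j i" unfolding J_def m0_def by (simp add: lessThan_Suc_atMost[symmetric])
    then show "m0 < J" using \<open>0 < j i\<close> by simp
  qed
  have omono: "omega l' \<le> omega l" if "l \<le> l'" "l' < s" for l l'
    using groups(3) that by (cases "l = l'") (auto simp: less_imp_le)
  have blks: "blk j s p < s" if "p < r" for p using blk_bounds(1)[of p j s] that r by simp
  \<comment> \<open>The limits strictly decrease from block to block, so the first \<open>J\<close>
    indices are exactly those with limit at least \<open>omega i\<close>.\<close>
  have Jiff: "p < J \<longleftrightarrow> omega i \<le> \<omega> p" if p: "p < r" for p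
  proof -
    have 1: "p < J \<longleftrightarrow> blk j s p \<le> i" using blk_le_iff(1)[of p j s i] p r unfolding J_def by simp
    show ?thesis
    proof (cases "blk j s p \<le> i")
      case True then show ?thesis using 1 omono[OF True i] by (simp add: \<omega>_def)
    next
      case False
      then have "omega (blk j s p) < omega i" using groups(3) blks[OF p] by simp
      then show ?thesis using 1 False by (simp add: \<omega>_def)
    qed
  qed
  have Giff: "p \<in> G \<longleftrightarrow> \<omega> p = omega i" if p: "p < r" for p
  proof -
    have "blk j s p = i" if "omega (blk j s p) = omega i"
      using groups(3) blks[OF p] i that by (metis less_irrefl linorder_neqE_nat)
    then show ?thesis using p by (auto simp: G_def \<omega>_def)
  qed
  have Geq: "G = {m0..<J}"
  proof -
    have bi: "blk j s p = i \<longleftrightarrow> m0 \<le> p \<and> p < J" if "p < r" for p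
      using blk_le_iff[of p j s i] that r unfolding J_def m0_def by auto
    have "p \<in> G \<longleftrightarrow> p \<in> {m0..<J}" for p
      using bi[of p] ij(2) by (cases "p < r") (simp_all add: G_def)
    then show ?thesis by blast
  qed
  have pi_ae: "AE x in \<pi>. x \<in> {lm..lp}"
  proof -
    interpret P: prob_space \<pi> by (rule pi)
    show ?thesis using pi(4) by (subst P.AE_in_set_eq_1) (auto simp: pi(2))
  qed
  \<comment> \<open>On the intersection of these events a path is fixed and the deterministic
    version applies.\<close>
  show ?thesis
    using A4 AEL AER AE_space AEcu AEcv AEcx AEst
  proof eventually_elim
    case (elim w)
    note w = elim(4)
    have Lw: "isometric (Nf n) (Nf n) (L n w)"
      "\<And>a b. a < Nf n \<Longrightarrow> b < Nf n \<Longrightarrow> (\<Sum>k<Nf n. L n w $$ (a, k) * cnj (L n w $$ (b, k))) = (if a = b then 1 else 0)" for n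
      using unitary_mat_entries[OF elim(2)[rule_format]] by auto
    have Rw: "isometric n (Nf n) (R n w)" for n using elim(3) by blast
    have uhc: "uh n w k \<in> carrier_vec (Nf n)" if "k < Nf n" for n k using eig w that by blast
    have uho: "(\<Sum>a<Nf n. cnj (uh n w q $ a) * uh n w q' $ a) = (if q = q' then 1 else 0)" if "q < Nf n" "q' < Nf n" for n q q'
    proof -
      have "uh n w q' \<bullet>c uh n w q = (if q' = q then 1 else 0)" using eig w that by blast
      then show ?thesis using uhc[OF that(1)] uhc[OF that(2)]
        by (auto simp: scalar_prod_def atLeast0LessThan mult.commute split: if_splits)
    qed
    define bb where "bb b n a = (if b then b1 n $ a else b2 n $ a)" for b n a
    have bbv: "bb b n = vL n (if b then r else r + 1)" for b n by (rule ext) (simp add: bb_def vL_def)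
    have Pi: "\<forall>\<^sub>F n in sequentially. P n \<in> carrier_mat (Nf n) n \<and> (\<forall>a<Nf n. \<forall>b<n. P n $$ (a, b) =
        (\<Sum>p<r. U n $$ (a, p) * of_real (om n p) * cnj (V n $$ (b, p))))"
      using svd
    proof eventually_elim
      case (elim n)
      then have c: "U n \<in> carrier_mat (Nf n) r" "V n \<in> carrier_mat n r"
        and P: "P n \<in> carrier_mat (Nf n) n" "P n = U n * mat_diag r (\<lambda>k. complex_of_real (om n k)) * mat_adjoint (V n)" by auto
      have d: "mat_diag r (\<lambda>k. complex_of_real (om n k)) \<in> carrier_mat r r" "diagonal_mat (mat_diag r (\<lambda>k. complex_of_real (om n k)))"
        by (auto simp: mat_diag_def diagonal_mat_def)
      have "P n $$ (a, b) = (\<Sum>p<r. U n $$ (a, p) * of_real (om n p) * cnj (V n $$ (b, p)))" if "a < Nf n" "b < n" for a b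
        unfolding P(2) singular_model_index[OF c(1) d c(2) that] by (intro sum.cong refl) (simp add: mat_diag_def)
      then show ?case using P(1) by blast
    qed
    have st: "(\<lambda>n. (\<Sum>k<Nf n. 1 / (of_real ((g n w k)\<^sup>2) - \<i> * of_nat y)) / of_nat (Nf n)) \<longlonglongrightarrow> (\<integral>x. 1 / (of_real x - \<i> * of_nat y) \<partial>\<pi>)"
      if y: "0 < y" for y :: nat
    proof -
      have "mtrace (minv (X n w * mat_adjoint (X n w) - (\<i> * of_nat y) \<cdot>\<^sub>m 1\<^sub>m (Nf n))) = (\<Sum>k<Nf n. 1 / (of_real ((g n w k)\<^sup>2) - \<i> * of_nat y))" for n
      proof -
        have ne: "complex_of_real x - \<i> * of_nat y \<noteq> 0" for x using y by (auto simp: complex_eq_iff)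
        have "spectral_mat (Nf n) (L n w) (\<lambda>k. of_real ((g n w k)\<^sup>2)) - (\<i> * of_nat y) \<cdot>\<^sub>m 1\<^sub>m (Nf n)
            = spectral_mat (Nf n) (L n w) (\<lambda>k. of_real ((g n w k)\<^sup>2) - \<i> * of_nat y)"
          by (rule spectral_mat_shift) (rule Lw(2))
        moreover have "minv (spectral_mat (Nf n) (L n w) (\<lambda>k. of_real ((g n w k)\<^sup>2) - \<i> * of_nat y))
            = spectral_mat (Nf n) (L n w) (\<lambda>k. 1 / (of_real ((g n w k)\<^sup>2) - \<i> * of_nat y))"
          by (rule minv_spectral_mat) (rule Lw(1), rule Lw(2), assumption+, rule ne)
        ultimately show ?thesis by (simp only: XX[OF w Rw] spectral_mat_trace[OF Lw(1)])
      qed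
      note tr = this
      from elim(8)[rule_format, OF y] show ?thesis unfolding stieltjes_def tr .
    qed
    have Sigi: "\<forall>\<^sub>F n in sequentially. Sig n w \<in> carrier_mat (Nf n) n \<and> (\<forall>a<Nf n. \<forall>b<n. Sig n w $$ (a, b) =
        (\<Sum>k<Nf n. L n w $$ (a, k) * of_real (g n w k) * cnj (R n w $$ (b, k)))
        + (\<Sum>p<r. U n $$ (a, p) * of_real (om n p) * cnj (V n $$ (b, p))))"
      using Pi
    proof eventually_elim
      case (elim n)
      then have Pc: "P n \<in> carrier_mat (Nf n) n" by blast
      have "Sig n w $$ (a, b) = X n w $$ (a, b) + P n $$ (a, b)" if "a < Nf n" "b < n" for a b
        unfolding Sig_def using Pc that by simp
      then show ?case using elim Xi[OF w] Pc Xc[OF w] by (simp add: Sig_def)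
    qed
    have main: "(\<lambda>n. (\<Sum>q\<in>G. (\<Sum>a<Nf n. cnj (bb True n a) * uh n w q $ a) * (\<Sum>a<Nf n. cnj (uh n w q $ a) * bb False n a))
     - of_real (\<rho> * (stieltjes_r \<pi> \<rho>)\<^sup>2 * mtilde c \<pi> \<rho> / deriv (gfun c \<pi>) \<rho>)
       * (\<Sum>p\<in>G. (\<Sum>a<Nf n. cnj (bb True n a) * vL n p a) * (\<Sum>a<Nf n. cnj (vL n p a) * bb False n a))) \<longlonglongrightarrow> 0"
    proof (rule spiked_model_pathwise[OF pi(1,2) pi_ae A1(3,2) Lw Rw elim(1) gle[OF w elim(2,3)] st,
          where uv = vL and vv = vR and uh = "\<lambda>n q a. uh n w q $ a" and lh = "\<lambda>n. lh n w" and S = "\<lambda>n a b. Sig n w $$ (a, b)"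
            and om = om and \<omega> = \<omega> and r = r and \<omega>i = "omega i" and J = J and G = G and ?m0.0 = m0 and Bd = "B0\<^sup>2" and bb = bb])
      show "\<forall>\<^sub>F n in sequentially. \<forall>p<r. \<forall>q<r. (\<Sum>a<Nf n. cnj (vL n p a) * vL n q a) = (if p = q then 1 else 0)"
        using Uo by eventually_elim (simp add: vL_def)
      show "\<forall>\<^sub>F n in sequentially. \<forall>p<r. \<forall>q<r. (\<Sum>a<n. cnj (vR n p a) * vR n q a) = (if p = q then 1 else 0)"
        using Vo unfolding vR_def .
      show "(\<Sum>a<Nf n. (cmod (bb b n a))\<^sup>2) \<le> B0\<^sup>2" for b n
        using vn[OF bc(1) B0(1)] vn[OF bc(2) B0(2)] by (cases b) (simp_all add: bb_def)
      show "(\<lambda>n. om n p) \<longlonglongrightarrow> \<omega> p" if "p < r" for p using Om_lim that unfolding \<omega>_def by blast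
      show "0 < \<omega> p" if "p < r" for p using groups(4) blks[OF that] unfolding \<omega>_def by blast
      show "\<forall>\<^sub>F n in sequentially. \<forall>a<Nf n. \<forall>b<n. Sig n w $$ (a, b) =
        (\<Sum>k<Nf n. L n w $$ (a, k) * of_real (g n w k) * cnj (R n w $$ (b, k)))
        + (\<Sum>p<r. vL n p a * of_real (om n p) * cnj (vR n p b))"
        using Sigi by eventually_elim (simp add: vL_def vR_def)
      show "\<forall>\<^sub>F n in sequentially. \<forall>q<Nf n. \<forall>a<Nf n.
        (\<Sum>b<n. Sig n w $$ (a, b) * (\<Sum>a'<Nf n. cnj (Sig n w $$ (a', b)) * uh n w q $ a')) = of_real (lh n w q) * uh n w q $ a"
        using Sigi
      proof (eventually_elim, intro allI impI)
        fix n q a assume S: "Sig n w \<in> carrier_mat (Nf n) n \<and> (\<forall>a<Nf n. \<forall>b<n. Sig n w $$ (a, b) =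
          (\<Sum>k<Nf n. L n w $$ (a, k) * of_real (g n w k) * cnj (R n w $$ (b, k)))
          + (\<Sum>p<r. U n $$ (a, p) * of_real (om n p) * cnj (V n $$ (b, p))))" and qa: "q < Nf n" "a < Nf n"
        have "(Sig n w * mat_adjoint (Sig n w)) *\<^sub>v uh n w q = complex_of_real (lh n w q) \<cdot>\<^sub>v uh n w q"
          using eig w qa by blast
        then have "((Sig n w * mat_adjoint (Sig n w)) *\<^sub>v uh n w q) $ a = of_real (lh n w q) * uh n w q $ a"
          using uhc[OF qa(1)] qa(2) by simp
        then show "(\<Sum>b<n. Sig n w $$ (a, b) * (\<Sum>a'<Nf n. cnj (Sig n w $$ (a', b)) * uh n w q $ a')) = of_real (lh n w q) * uh n w q $ a"
          using gram_mult_vec_index[OF conjunct1[OF S] uhc[OF qa(1)] qa(2)] by simp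
      qed
      show "lh n w q' \<le> lh n w q" if "q' < Nf n" "q \<le> q'" for n q q'
        using eig w that le_less_trans[OF that(2,1)] by blast
      show "0 < omega i" using groups(4) i by blast
      show "0 < J" using ij by simp
    qed (use elim(5,6,7) uho rho ij Jiff Giff Geq in \<open>simp_all add: bbv\<close>)
    \<comment> \<open>Once \<open>r \<le> Nf n\<close>, the eigenvectors indexed by \<open>G\<close>
      exist and the inner products can be written as sums; \<open>\<bullet>c\<close> conjugates its
      second argument.\<close>
    have "\<forall>\<^sub>F n in sequentially. (\<Sum>q\<in>G. (\<Sum>a<Nf n. cnj (bb True n a) * uh n w q $ a) * (\<Sum>a<Nf n. cnj (uh n w q $ a) * bb False n a))
     - of_real (\<rho> * (stieltjes_r \<pi> \<rho>)\<^sup>2 * mtilde c \<pi> \<rho> / deriv (gfun c \<pi>) \<rho>)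
       * (\<Sum>p\<in>G. (\<Sum>a<Nf n. cnj (bb True n a) * vL n p a) * (\<Sum>a<Nf n. cnj (vL n p a) * bb False n a))
     = (\<Sum>k\<in>{k. k < r \<and> blk j s k = i}. (uh n w k \<bullet>c b1 n) * (b2 n \<bullet>c uh n w k))
      - complex_of_real (\<rho> * (stieltjes_r \<pi> \<rho>)\<^sup>2 * mtilde c \<pi> \<rho> / deriv (gfun c \<pi>) \<rho>)
        * (\<Sum>k\<in>{k. k < r \<and> blk j s k = i}. (col (U n) k \<bullet>c b1 n) * (b2 n \<bullet>c col (U n) k))"
      using svd Nlarge
    proof eventually_elim
      case (elim n)
      then have Uc: "U n \<in> carrier_mat (Nf n) r" by blast
      have ipc: "u \<bullet>c v = (\<Sum>a<Nf n. cnj (v $ a) * u $ a)" if "u \<in> carrier_vec (Nf n)" "v \<in> carrier_vec (Nf n)" for u v :: "complex vec"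
        using that by (simp add: scalar_prod_def atLeast0LessThan mult.commute)
      have Gr: "k < r" if "k \<in> G" for k using that by (simp add: G_def)
      have 1: "uh n w k \<bullet>c b1 n = (\<Sum>a<Nf n. cnj (bb True n a) * uh n w k $ a)"
        "b2 n \<bullet>c uh n w k = (\<Sum>a<Nf n. cnj (uh n w k $ a) * bb False n a)" if "k \<in> G" for k
        using ipc[OF uhc bc(1), of k] ipc[OF bc(2) uhc, of k] Gr[OF that] elim(2) by (simp_all add: bb_def)
      have cc: "col (U n) k \<in> carrier_vec (Nf n)" "\<And>a. a < Nf n \<Longrightarrow> col (U n) k $ a = vL n k a" if "k \<in> G" for k
        using Uc Gr[OF that] by (auto simp: vL_def)
      have 2: "col (U n) k \<bullet>c b1 n = (\<Sum>a<Nf n. cnj (bb True n a) * vL n k a)"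
        "b2 n \<bullet>c col (U n) k = (\<Sum>a<Nf n. cnj (vL n k a) * bb False n a)" if "k \<in> G" for k
        using ipc[OF cc(1)[OF that] bc(1)] ipc[OF bc(2) cc(1)[OF that]] cc(2)[OF that] by (simp_all add: bb_def)
      show ?case unfolding G_def[symmetric] by (simp add: 1 2)
    qed
    then show ?case by (rule Lim_transform_eventually[OF main])
  qed
qed

end
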